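(* Let $\mathbf{Quant}$ be the symmetric monoidal category of finite-dimensional complex Hilbert spaces and completely positive maps, where each finite-dimensional Hilbert space $A$ is equipped with the completely mixed state $\mu_A\colon\mathbb C\to A$ whose density matrix is the identity and the discarding effect $\varepsilon_A\colon A\to\mathbb C$ given by the trace. Then $\mathbf{Quant}$ has purification and copurification. Hence the pairs $(\mathcal M,\mathcal P)$ (mixing and pure morphisms) and $(\mathcal C,\mathcal D)$ (copure and discarding morphisms) are symmetric monoidal weak factorisation systems.
   Context: $\mathbf{Quant}$: objects are finite-dimensional complex Hilbert spaces; morphisms $A\to B$ are completely positive maps from the algebra $L(A)$ of linear operators on $A$ to $L(B)$ (not required to preserve trace), with the usual tensor product and unit $\mathbb C$. The completely mixed state $\mu_A\colon\mathbb C\to A$ is the completely positive map sending $1$ to $\mathrm{id}_A$; the discarding effect $\varepsilon_A\colon A\to\mathbb C$ is $\rho\mapsto\mathrm{Tr}(\rho)$. Lifting: for morphisms $f\colon A\to B$ and $g\colon C\to D$ of a category, $f$ has the lifting property against $g$ when for all $u\colon A\to C$, $v\colon B\to D$ with $g\circ u=v\circ f$ there is $h\colon B\to C$ with $h\circ f=u$ and $g\circ h=v$. In a symmetric monoidal category, $f\oslash g$ means: for all objects $A',B'$, the morphism $f\otimes\mathrm{id}_{A'}$ has the lifting property against $g\otimes\mathrm{id}_{B'}$. For a collection $\mathcal A$ of morphisms, $\mathcal A^{\oslash}=\{g\mid \forall f\in\mathcal A\colon f\oslash g\}$ and ${}^{\oslash}\mathcal A=\{f\mid\forall g\in\mathcal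 A\colon f\oslash g\}$. Let $\mathcal M'$ be the collection of all completely mixed states $\mu_A$ and $\mathcal D'$ the collection of all discarding effects $\varepsilon_A$ ($A$ ranging over all finite-dimensional Hilbert spaces). Pure morphisms: $\mathcal P=\mathcal M'^{\oslash}$; mixing morphisms: $\mathcal M={}^{\oslash}\mathcal P$; copure morphisms: $\mathcal C={}^{\oslash}\mathcal D'$; discarding morphisms: $\mathcal D=\mathcal C^{\oslash}$. The category has purification if every morphism $f\colon A\to B$ equals $p\circ(\mathrm{id}_A\otimes\mu_C)$ for some object $C$ and some pure $p\colon A\otimes C\to B$ (identifying $A$ with $A\otimes\mathbb C$). It has copurification if every morphism $f\colon A\to B$ equals $(\varepsilon_C\otimes\mathrm{id}_B)\circ c$ for some object $C$ and some copure $c\colon A\to C\otimes B$ (identifying $\mathbb C\otimes B$ with $B$). A symmetric monoidal weak factorisation system is a pair $(\mathcal L,\mathcal R)$ of collections of morphisms such that every morphism can be written as $r\circ l$ with $l\in\mathcal L$, $r\in\mathcal R$, and such that $\mathcal L={}^{\oslash}\mathcal R$ and $\mathcal R=\mathcal L^{\oslash}$.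
   Formalization: The zero Hilbert space is excluded from the objects, since with its mixed state and discarding effect included purification fails; the spaces have their points among complex vectors, which covers every nonzero finite-dimensional Hilbert space up to isometric isomorphism. *)

theory Defs
  imports "Jordan_Normal_Form.VS_Connect"
begin

section \<open>Lifting properties in symmetric monoidal categories\<close>

text \<open>
  The data of a symmetric monoidal category used below. The associator and the symmetry are left
  out because none of the following notions mentions them. \<open>Lunit C A\<close> is the arrow
  \<open>I \<otimes> A \<rightarrow> A\<close> and \<open>Runit C A\<close> is the arrow \<open>A \<otimes> I \<rightarrow> A\<close>; \<open>Comp C g f\<close> is
  \<open>g\<close> after \<open>f\<close>.
\<close>

record ('o, 'm) moncat =
  Obj :: "'o set"
  Arr :: "'m set"
  Dom :: "'m \<Rightarrow> 'o"
  Cod :: "'m \<Rightarrow> 'o"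
  Id :: "'o \<Rightarrow> 'm"
  Comp :: "'m \<Rightarrow> 'm \<Rightarrow> 'm"
  TObj :: "'o \<Rightarrow> 'o \<Rightarrow> 'o"
  TArr :: "'m \<Rightarrow> 'm \<Rightarrow> 'm"
  Unit :: "'o"
  Lunit :: "'o \<Rightarrow> 'm"
  Runit :: "'o \<Rightarrow> 'm"

definition Hom :: "('o, 'm) moncat \<Rightarrow> 'o \<Rightarrow> 'o \<Rightarrow> 'm set" where
  "Hom C A B = {f \<in> Arr C. Dom C f = A \<and> Cod C f = B}"

definition lifts :: "('o, 'm) moncat \<Rightarrow> 'm \<Rightarrow> 'm \<Rightarrow> bool" where
  "lifts C f g \<longleftrightarrow>
     (\<forall>u \<in> Hom C (Dom C f) (Dom C g). \<forall>v \<in> Hom C (Cod C f) (Cod C g).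
        Comp C g u = Comp C v f \<longrightarrow>
        (\<exists>h \<in> Hom C (Cod C f) (Dom C g). Comp C h f = u \<and> Comp C g h = v))"

definition oslash :: "('o, 'm) moncat \<Rightarrow> 'm \<Rightarrow> 'm \<Rightarrow> bool" where
  "oslash C f g \<longleftrightarrow>
     (\<forall>A' \<in> Obj C. \<forall>B' \<in> Obj C. lifts C (TArr C f (Id C A')) (TArr C g (Id C B')))"

definition oslash_right :: "('o, 'm) moncat \<Rightarrow> 'm set \<Rightarrow> 'm set" where
  "oslash_right C F = {g \<in> Arr C. \<forall>f \<in> F. oslash C f g}"

definition oslash_left :: "('o, 'm) moncat \<Rightarrow> 'm set \<Rightarrow> 'm set" where
  "oslash_left C G = {f \<in> Arr C. \<forall>g \<in> G. oslash C f g}"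

definition sm_wfs :: "('o, 'm) moncat \<Rightarrow> 'm set \<Rightarrow> 'm set \<Rightarrow> bool" where
  "sm_wfs C L R \<longleftrightarrow>
     L \<subseteq> Arr C \<and> R \<subseteq> Arr C \<and>
     (\<forall>f \<in> Arr C. \<exists>l \<in> L. \<exists>r \<in> R.
        Dom C l = Dom C f \<and> Cod C l = Dom C r \<and> Cod C r = Cod C f \<and> f = Comp C r l) \<and>
     L = oslash_left C R \<and> R = oslash_right C L"

text \<open>
  Here \<open>mu A : I \<rightarrow> A\<close> and \<open>eps A : A \<rightarrow> I\<close> are the chosen completely mixed states and
  discarding effects.
\<close>

definition pure :: "('o, 'm) moncat \<Rightarrow> ('o \<Rightarrow> 'm) \<Rightarrow> 'm set" where
  "pure C mu = oslash_right C (mu ` Obj C)"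

definition mixing :: "('o, 'm) moncat \<Rightarrow> ('o \<Rightarrow> 'm) \<Rightarrow> 'm set" where
  "mixing C mu = oslash_left C (pure C mu)"

definition copure :: "('o, 'm) moncat \<Rightarrow> ('o \<Rightarrow> 'm) \<Rightarrow> 'm set" where
  "copure C eps = oslash_left C (eps ` Obj C)"

definition discarding :: "('o, 'm) moncat \<Rightarrow> ('o \<Rightarrow> 'm) \<Rightarrow> 'm set" where
  "discarding C eps = oslash_right C (copure C eps)"

text \<open>
  The identification of \<open>A\<close> with \<open>A \<otimes> I\<close> is precomposition with the unitor \<open>A \<otimes> I \<rightarrow> A\<close>.
\<close>

definition has_purification :: "('o, 'm) moncat \<Rightarrow> ('o \<Rightarrow> 'm) \<Rightarrow> bool" where
  "has_purification C mu \<longleftrightarrow>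
     (\<forall>A \<in> Obj C. \<forall>B \<in> Obj C. \<forall>f \<in> Hom C A B.
        \<exists>E \<in> Obj C. \<exists>p \<in> pure C mu \<inter> Hom C (TObj C A E) B.
          Comp C f (Runit C A) = Comp C p (TArr C (Id C A) (mu E)))"

definition has_copurification :: "('o, 'm) moncat \<Rightarrow> ('o \<Rightarrow> 'm) \<Rightarrow> bool" where
  "has_copurification C eps \<longleftrightarrow>
     (\<forall>A \<in> Obj C. \<forall>B \<in> Obj C. \<forall>f \<in> Hom C A B.
        \<exists>E \<in> Obj C. \<exists>c \<in> copure C eps \<inter> Hom C A (TObj C E B).
          f = Comp C (Lunit C B) (Comp C (TArr C (eps E) (Id C B)) c))"

section \<open>Finite-dimensional complex Hilbert spaces\<close>

record 'a hilb = "(complex, 'a) module" +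
  ip :: "'a \<Rightarrow> 'a \<Rightarrow> complex"

text \<open>
  The inner product is linear in its first argument. Orderings on \<^typ>\<open>complex\<close> are those of
  \<open>Complex_Order\<close>: \<open>0 \<le> z\<close> says that \<open>z\<close> is real and nonnegative. Completeness is automatic in
  finite dimension.
\<close>

definition fd_hilbert :: "'a hilb \<Rightarrow> bool" where
  "fd_hilbert A \<longleftrightarrow>
     vectorspace class_ring A \<and> vectorspace.fin_dim class_ring A \<and>
     (\<forall>x \<in> carrier A. \<forall>y \<in> carrier A. \<forall>z \<in> carrier A.
        ip A (x \<oplus>\<^bsub>A\<^esub> y) z = ip A x z + ip A y z) \<and>
     (\<forall>c. \<forall>x \<in> carrier A. \<forall>y \<in> carrier A. ip A (c \<odot>\<^bsub>A\<^esub> x) y = c * ip A x y) \<and>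
     (\<forall>x \<in> carrier A. \<forall>y \<in> carrier A. ip A y x = cnj (ip A x y)) \<and>
     (\<forall>x \<in> carrier A. x \<noteq> \<zero>\<^bsub>A\<^esub> \<longrightarrow> 0 < ip A x x)"

text \<open>
  The objects are all nonzero finite-dimensional Hilbert spaces whose points are taken from the
  type \<^typ>\<open>complex vec\<close>: the underlying set is an arbitrary subset of that type, and
  the vector space operations and the inner product are arbitrary. A fixed type of points
  is needed to quantify over all spaces inside a formula. This one contains each
  \<open>\<complex>\<^sup>n\<close> and so an isometric copy of every finite-dimensional Hilbert space.

  The zero space is excluded: with \<open>\<mu>\<^sub>0 : \<complex> \<rightarrow> 0\<close> among the completely mixed states, a
  pure \<open>p\<close> would have to satisfy \<open>p \<circ> u = 0 \<Longrightarrow> u = 0\<close>, and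
  \<open>\<rho> \<mapsto> \<langle>0|\<rho>|0\<rangle>\<close> on \<open>\<complex>\<^sup>2\<close> would have no purification.
\<close>

type_synonym hsp = "complex vec hilb"

definition hobjs :: "hsp set" where
  "hobjs = {A. fd_hilbert A \<and> carrier A \<noteq> {\<zero>\<^bsub>A\<^esub>}}"

definition hunit :: hsp where
  "hunit = module.extend (module_vec TYPE(complex) 1) (hilb.fields (\<lambda>x y. x \<bullet>c y))"

text \<open>
  The Hilbert space tensor product: a space \<open>T\<close> with a bilinear map
  \<open>t\<close> such that \<open>\<langle>a \<otimes> b, a' \<otimes> b'\<rangle> = \<langle>a, a'\<rangle> \<langle>b, b'\<rangle>\<close> and the product vectors span \<open>T\<close>.
  This determines \<open>(T, t)\<close> up to a unique unitary.
\<close>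

definition is_tensor :: "'a hilb \<Rightarrow> 'a hilb \<Rightarrow> 'a hilb \<Rightarrow> ('a \<Rightarrow> 'a \<Rightarrow> 'a) \<Rightarrow> bool" where
  "is_tensor A B T t \<longleftrightarrow>
     fd_hilbert T \<and>
     (\<forall>b \<in> carrier B. (\<lambda>a. t a b) \<in> LinearCombinations.module_hom class_ring A T) \<and>
     (\<forall>a \<in> carrier A. t a \<in> LinearCombinations.module_hom class_ring B T) \<and>
     (\<forall>a \<in> carrier A. \<forall>b \<in> carrier B. \<forall>a' \<in> carrier A. \<forall>b' \<in> carrier B.
        ip T (t a b) (t a' b') = ip A a a' * ip B b b') \<and>
     LinearCombinations.module.span class_ring T
       {t a b | a b. a \<in> carrier A \<and> b \<in> carrier B} = carrier T"

definition htensor :: "hsp \<Rightarrow> hsp \<Rightarrow> hsp \<times> (complex vec \<Rightarrow> complex vec \<Rightarrow> complex vec)" where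
  "htensor A B = (SOME p. is_tensor A B (fst p) (snd p))"

definition tspace :: "hsp \<Rightarrow> hsp \<Rightarrow> hsp" where
  "tspace A B = fst (htensor A B)"

definition tvec :: "hsp \<Rightarrow> hsp \<Rightarrow> complex vec \<Rightarrow> complex vec \<Rightarrow> complex vec" where
  "tvec A B = snd (htensor A B)"

section \<open>Operators\<close>

text \<open>
  The algebra \<open>L(A)\<close>. Operators are extensional functions, so that equality of operators is
  equality of HOL functions; likewise for maps between operator algebras below.
\<close>

definition L :: "'a hilb \<Rightarrow> (complex, 'a \<Rightarrow> 'a) module" where
  "L A = \<lparr>
     carrier = LinearCombinations.module_hom class_ring A A \<inter> extensional (carrier A),
     mult = compose (carrier A),
     one = (\<lambda>x \<in> carrier A. x),
     zero = (\<lambda>x \<in> carrier A. \<zero>\<^bsub>A\<^esub>),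
     add = (\<lambda>S T. \<lambda>x \<in> carrier A. S x \<oplus>\<^bsub>A\<^esub> T x),
     smult = (\<lambda>c S. \<lambda>x \<in> carrier A. c \<odot>\<^bsub>A\<^esub> S x)\<rparr>"

definition pos_op :: "'a hilb \<Rightarrow> ('a \<Rightarrow> 'a) \<Rightarrow> bool" where
  "pos_op A T \<longleftrightarrow> T \<in> carrier (L A) \<and> (\<forall>x \<in> carrier A. 0 \<le> ip A (T x) x)"

definition orthonormal_basis :: "'a hilb \<Rightarrow> 'a set \<Rightarrow> bool" where
  "orthonormal_basis A E \<longleftrightarrow>
     finite E \<and> E \<subseteq> carrier A \<and>
     (\<forall>e \<in> E. \<forall>e' \<in> E. ip A e e' = (if e = e' then 1 else 0)) \<and>
     LinearCombinations.module.span class_ring A E = carrier A"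

definition op_trace :: "'a hilb \<Rightarrow> ('a \<Rightarrow> 'a) \<Rightarrow> complex" where
  "op_trace A T = (THE t. \<forall>E. orthonormal_basis A E \<longrightarrow> t = (\<Sum>e\<in>E. ip A (T e) e))"

type_synonym hop = "complex vec \<Rightarrow> complex vec"

definition tensor_op :: "hsp \<Rightarrow> hsp \<Rightarrow> hop \<Rightarrow> hop \<Rightarrow> hop" where
  "tensor_op A B S T = (THE R. R \<in> carrier (L (tspace A B)) \<and>
     (\<forall>a \<in> carrier A. \<forall>b \<in> carrier B. R (tvec A B a b) = tvec A B (S a) (T b)))"

section \<open>Completely positive maps\<close>

definition superops :: "'a hilb \<Rightarrow> 'a hilb \<Rightarrow> (('a \<Rightarrow> 'a) \<Rightarrow> ('a \<Rightarrow> 'a)) set" where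
  "superops A B = LinearCombinations.module_hom class_ring (L A) (L B) \<inter>
     extensional (carrier (L A))"

definition tensor_super ::
  "hsp \<Rightarrow> hsp \<Rightarrow> hsp \<Rightarrow> hsp \<Rightarrow> (hop \<Rightarrow> hop) \<Rightarrow> (hop \<Rightarrow> hop) \<Rightarrow> (hop \<Rightarrow> hop)" where
  "tensor_super A B A' B' f g = (THE h. h \<in> superops (tspace A A') (tspace B B') \<and>
     (\<forall>S \<in> carrier (L A). \<forall>T \<in> carrier (L A').
        h (tensor_op A A' S T) = tensor_op B B' (f S) (g T)))"

definition super_id :: "hsp \<Rightarrow> hop \<Rightarrow> hop" where
  "super_id A = (\<lambda>T \<in> carrier (L A). T)"

definition completely_positive :: "hsp \<Rightarrow> hsp \<Rightarrow> (hop \<Rightarrow> hop) \<Rightarrow> bool" where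
  "completely_positive A B f \<longleftrightarrow>
     f \<in> superops A B \<and>
     (\<forall>E \<in> hobjs. \<forall>R. pos_op (tspace A E) R \<longrightarrow>
        pos_op (tspace B E) (tensor_super A B E E f (super_id E) R))"

section \<open>The category of quantum processes\<close>

datatype qarr = QArr (qdom: hsp) (qmap: "hop \<Rightarrow> hop") (qcod: hsp)

definition Quant :: "(hsp, qarr) moncat" where
  "Quant = \<lparr>
     Obj = hobjs,
     Arr = {QArr A f B | A f B. A \<in> hobjs \<and> B \<in> hobjs \<and> completely_positive A B f},
     Dom = qdom,
     Cod = qcod,
     Id = (\<lambda>A. QArr A (super_id A) A),
     Comp = (\<lambda>g f. QArr (qdom f) (compose (carrier (L (qdom f))) (qmap g) (qmap f)) (qcod g)),
     TObj = tspace,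
     TArr = (\<lambda>f g. QArr (tspace (qdom f) (qdom g))
                        (tensor_super (qdom f) (qcod f) (qdom g) (qcod g) (qmap f) (qmap g))
                        (tspace (qcod f) (qcod g))),
     Unit = hunit,
     Lunit = (\<lambda>A. QArr (tspace hunit A)
                (THE l. l \<in> superops (tspace hunit A) A \<and>
                   (\<forall>S \<in> carrier (L A). l (tensor_op hunit A \<one>\<^bsub>L hunit\<^esub> S) = S)) A),
     Runit = (\<lambda>A. QArr (tspace A hunit)
                (THE r. r \<in> superops (tspace A hunit) A \<and>
                   (\<forall>S \<in> carrier (L A). r (tensor_op A hunit S \<one>\<^bsub>L hunit\<^esub>) = S)) A)\<rparr>"

text \<open>
  The scalar \<open>z\<close> of \<open>\<complex>\<close> is the operator \<open>z \<cdot> id\<close> on the one-dimensional space \<^const>\<open>hunit\<close>.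
\<close>

definition mixed_state :: "hsp \<Rightarrow> qarr" where
  "mixed_state A =
     QArr hunit (THE m. m \<in> superops hunit A \<and> m \<one>\<^bsub>L hunit\<^esub> = \<one>\<^bsub>L A\<^esub>) A"

definition discard :: "hsp \<Rightarrow> qarr" where
  "discard A =
     QArr A (\<lambda>R \<in> carrier (L A). op_trace A R \<odot>\<^bsub>L hunit\<^esub> \<one>\<^bsub>L hunit\<^esub>) hunit"

end

theory Submission
  imports Defs
begin

text \<open>
  By Choi's theorem the completely positive maps are exactly the maps
  \<open>\<rho> \<mapsto> \<Sum>\<^sub>i K\<^sub>i \<rho> K\<^sub>i\<^sup>*\<close>, and two Kraus families of the same map differ by an isometric matrix. The maps
  \<open>\<rho> \<mapsto> V \<rho> V\<^sup>*\<close> with a single Kraus operator are both pure and copure: in a lifting problem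
  against a mixed state, the Kraus operators of \<open>v \<circ> (\<mu> \<otimes> id)\<close> are isometric combinations of those of
  \<open>(V \<otimes> id) \<circ> u\<close>, and the same combinations of the Kraus operators of \<open>u\<close>, bent along \<open>X\<close>, form the
  lift; discarding effects are treated dually. Stinespring dilation then gives purification and copurification.
  The remaining factors \<open>id \<otimes> \<mu>\<close> and \<open>\<epsilon> \<otimes> id\<close> of the factorisations inherit their
  lifting properties from \<open>\<mu>\<close> and \<open>\<epsilon>\<close> along associators and unitors.
\<close>

text \<open>The tensor product is an arbitrary choice among isomorphic ones, so there are neither
  coordinates nor strict associativity. Identities are therefore tested by inner products: vectors
  by \<open>ip_eqI\<close>, linear maps on product bases, superoperators on rank one operators;
  adjoints never appear. The lifting argument rests on a count. A family expressed through another
  by an isometric matrix must be at least as long as it. Padding with zero operators arranges this: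
  for pure maps the m |F| operators W_j \<iota>_f must be no fewer than the n operators V U_r; for
  copure maps it is the family of u that is padded. With F empty the longer side would be empty, so
  nonzero objects are essential here. The isometric matrix J has row indices (j, f). Treating f as
  an input basis vector of X, rather than as part of the Kraus label, turns J into the coefficients
  of the lift; that is the bending of the overview. Its two properties do separate jobs: for pure
  maps the isometry makes the lift restrict to u and the expansion makes it compose to v; for copure
  maps these roles are exchanged.\<close>

abbreviation (input) onb :: "'a hilb \<Rightarrow> 'a set \<Rightarrow> bool" where
  "onb \<equiv> orthonormal_basis"

abbreviation lin :: "'a hilb \<Rightarrow> 'b hilb \<Rightarrow> ('a \<Rightarrow> 'b) set" where
  "lin A B \<equiv> LinearCombinations.module_hom class_ring A B"

abbreviation (input) hspan :: "'a hilb \<Rightarrow> 'a set \<Rightarrow> 'a set" where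
  "hspan A \<equiv> LinearCombinations.module.span class_ring A"

subsection \<open>Hilbert spaces\<close>

lemma fd_module: "fd_hilbert A \<Longrightarrow> Module.module class_ring A"
  unfolding fd_hilbert_def vectorspace_def by simp

lemma fd_abelian_group: "fd_hilbert A \<Longrightarrow> abelian_group A"
  using fd_module Module.module.axioms(2) by blast

lemma fd_abelian_monoid: "fd_hilbert A \<Longrightarrow> abelian_monoid A"
  using fd_abelian_group abelian_group.axioms(1) by blast

lemma hs_closed [simp]:
  assumes "fd_hilbert A"
  shows "x \<in> carrier A \<Longrightarrow> y \<in> carrier A \<Longrightarrow> x \<oplus>\<^bsub>A\<^esub> y \<in> carrier A"
    and "x \<in> carrier A \<Longrightarrow> c \<odot>\<^bsub>A\<^esub> x \<in> carrier A"
    and "\<zero>\<^bsub>A\<^esub> \<in> carrier A"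
  using abelian_monoid.a_closed[OF fd_abelian_monoid[OF assms]]
    abelian_monoid.zero_closed[OF fd_abelian_monoid[OF assms]]
    Module.module.smult_closed[OF fd_module[OF assms]] by auto

lemma hs_finsum_closed [simp]:
  assumes "fd_hilbert A" and "\<And>i. i \<in> I \<Longrightarrow> v i \<in> carrier A"
  shows "finsum A v I \<in> carrier A"
  by (rule abelian_monoid.finsum_closed[OF fd_abelian_monoid[OF assms(1)]]) (use assms(2) in blast)

lemma ip_left [simp]:
  assumes "fd_hilbert A"
  shows "x \<in> carrier A \<Longrightarrow> y \<in> carrier A \<Longrightarrow> z \<in> carrier A \<Longrightarrow> ip A (x \<oplus>\<^bsub>A\<^esub> y) z = ip A x z + ip A y z"
    and "x \<in> carrier A \<Longrightarrow> y \<in> carrier A \<Longrightarrow> ip A (c \<odot>\<^bsub>A\<^esub> x) y = c * ip A x y"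
  using assms unfolding fd_hilbert_def by blast+

lemma ip_cnj:
  assumes "fd_hilbert A" "x \<in> carrier A" "y \<in> carrier A"
  shows "cnj (ip A x y) = ip A y x"
  using assms unfolding fd_hilbert_def by metis

lemma ip_right [simp]:
  assumes A: "fd_hilbert A"
  shows "x \<in> carrier A \<Longrightarrow> y \<in> carrier A \<Longrightarrow> z \<in> carrier A \<Longrightarrow> ip A x (y \<oplus>\<^bsub>A\<^esub> z) = ip A x y + ip A x z"
    and "x \<in> carrier A \<Longrightarrow> y \<in> carrier A \<Longrightarrow> ip A x (c \<odot>\<^bsub>A\<^esub> y) = cnj c * ip A x y"
proof -
  show "ip A x (y \<oplus>\<^bsub>A\<^esub> z) = ip A x y + ip A x z"
    if "x \<in> carrier A" "y \<in> carrier A" "z \<in> carrier A"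
    using that A ip_cnj[OF A, of "y \<oplus>\<^bsub>A\<^esub> z" x] ip_cnj[OF A, of y x] ip_cnj[OF A, of z x] by simp
  show "ip A x (c \<odot>\<^bsub>A\<^esub> y) = cnj c * ip A x y" if "x \<in> carrier A" "y \<in> carrier A"
    using that A ip_cnj[OF A, of "c \<odot>\<^bsub>A\<^esub> y" x] ip_cnj[OF A, of y x] by simp
qed

lemma ip_zero [simp]:
  assumes A: "fd_hilbert A" and x: "x \<in> carrier A"
  shows "ip A \<zero>\<^bsub>A\<^esub> x = 0" "ip A x \<zero>\<^bsub>A\<^esub> = 0"
proof -
  have "\<zero>\<^bsub>A\<^esub> \<oplus>\<^bsub>A\<^esub> \<zero>\<^bsub>A\<^esub> = \<zero>\<^bsub>A\<^esub>"
    using abelian_monoid.l_zero[OF fd_abelian_monoid[OF A]] A by simp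
  then show "ip A \<zero>\<^bsub>A\<^esub> x = 0" "ip A x \<zero>\<^bsub>A\<^esub> = 0"
    using ip_left(1)[OF A, of "\<zero>\<^bsub>A\<^esub>" "\<zero>\<^bsub>A\<^esub>" x] ip_right(1)[OF A x, of "\<zero>\<^bsub>A\<^esub>" "\<zero>\<^bsub>A\<^esub>"] A x by simp_all
qed

lemma finsum_insert_hs:
  assumes "fd_hilbert A" "finite I" "j \<notin> I" "\<And>i. i \<in> insert j I \<Longrightarrow> v i \<in> carrier A"
  shows "finsum A v (insert j I) = v j \<oplus>\<^bsub>A\<^esub> finsum A v I"
  using abelian_monoid.finsum_insert[OF fd_abelian_monoid[OF assms(1)] assms(2,3), of v] assms(4) by auto

lemma ip_finsum [simp]:
  assumes A: "fd_hilbert A" and v: "\<And>i. i \<in> I \<Longrightarrow> v i \<in> carrier A" and x: "x \<in> carrier A"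
  shows "ip A (finsum A v I) x = (\<Sum>i\<in>I. ip A (v i) x)"
    and "ip A x (finsum A v I) = (\<Sum>i\<in>I. ip A x (v i))"
proof -
  have "ip A (finsum A v I) x = (\<Sum>i\<in>I. ip A (v i) x) \<and> ip A x (finsum A v I) = (\<Sum>i\<in>I. ip A x (v i))"
    using v
  proof (induction I rule: infinite_finite_induct)
    case (insert j I)
    have c: "v i \<in> carrier A" if "i \<in> insert j I" for i using insert.prems that by blast
    then have "finsum A v I \<in> carrier A" "v j \<in> carrier A" using A by simp_all
    then show ?case using A x insert.IH c insert.hyps
      by (subst (1 2) finsum_insert_hs[OF A insert.hyps c]) simp_all
  qed (simp_all add: A x abelian_monoid.finsum_empty[OF fd_abelian_monoid[OF A]]
    abelian_monoid.finsum_infinite[OF fd_abelian_monoid[OF A]])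
  then show "ip A (finsum A v I) x = (\<Sum>i\<in>I. ip A (v i) x)"
    and "ip A x (finsum A v I) = (\<Sum>i\<in>I. ip A x (v i))" by auto
qed

lemma ip_self_zero:
  assumes "fd_hilbert A" "x \<in> carrier A" "ip A x x = 0"
  shows "x = \<zero>\<^bsub>A\<^esub>"
  using assms unfolding fd_hilbert_def by (metis less_irrefl)

lemma hs_sub_eq_zero:
  assumes A: "fd_hilbert A" and xy: "x \<in> carrier A" "y \<in> carrier A"
    and 0: "x \<oplus>\<^bsub>A\<^esub> (- 1) \<odot>\<^bsub>A\<^esub> y = \<zero>\<^bsub>A\<^esub>"
  shows "x = y"
proof -
  interpret Module.module class_ring A by (rule fd_module[OF A])
  have "(- 1) \<odot>\<^bsub>A\<^esub> y \<oplus>\<^bsub>A\<^esub> y = ((- 1) \<odot>\<^bsub>A\<^esub> y) \<oplus>\<^bsub>A\<^esub> (1 \<odot>\<^bsub>A\<^esub> y)"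
    using smult_one xy by simp
  also have "\<dots> = (- 1 + 1) \<odot>\<^bsub>A\<^esub> y" using smult_l_distr[of "-1" 1 y] xy by simp
  also have "\<dots> = \<zero>\<^bsub>A\<^esub>" using smult_l_null xy by simp
  finally have 1: "(- 1) \<odot>\<^bsub>A\<^esub> y \<oplus>\<^bsub>A\<^esub> y = \<zero>\<^bsub>A\<^esub>" .
  have "x = x \<oplus>\<^bsub>A\<^esub> ((- 1) \<odot>\<^bsub>A\<^esub> y \<oplus>\<^bsub>A\<^esub> y)" using 1 xy by simp
  also have "\<dots> = (x \<oplus>\<^bsub>A\<^esub> (- 1) \<odot>\<^bsub>A\<^esub> y) \<oplus>\<^bsub>A\<^esub> y" using xy A by (simp add: M.a_assoc)
  also have "\<dots> = y" using 0 xy by simp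
  finally show ?thesis .
qed

text \<open>The difference is orthogonal to itself. Most vector identities below are reduced by this
  to identities of complex sums.\<close>

lemma ip_eqI:
  assumes A: "fd_hilbert A" and xy: "x \<in> carrier A" "y \<in> carrier A"
    and eq: "\<And>z. z \<in> carrier A \<Longrightarrow> ip A x z = ip A y z"
  shows "x = y"
  by (rule hs_sub_eq_zero[OF A xy], rule ip_self_zero[OF A]) (use A xy eq in simp_all)

subsection \<open>Orthonormal bases\<close>

lemma onb_simps:
  assumes "onb A E"
  shows "finite E" "e \<in> E \<Longrightarrow> e \<in> carrier A"
    "e \<in> E \<Longrightarrow> e' \<in> E \<Longrightarrow> ip A e e' = (if e = e' then 1 else 0)"
  using assms unfolding orthonormal_basis_def by auto

text \<open>Parseval's identity. A finite expansion of \<open>x\<close> taken from the span has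
  coefficients that orthonormality identifies as \<open>ip A x e\<close>; basis vectors missing from
  the expansion have coefficient 0.\<close>

lemma onb_ip:
  assumes A: "fd_hilbert A" and E: "onb A E" and x: "x \<in> carrier A" and y: "y \<in> carrier A"
  shows "ip A x y = (\<Sum>e\<in>E. ip A x e * ip A e y)"
proof -
  note Es = onb_simps[OF E]
  have "x \<in> hspan A E"
    using E x unfolding orthonormal_basis_def by simp
  then obtain a S where S: "finite S" "S \<subseteq> E" and xe: "x = finsum A (\<lambda>v. a v \<odot>\<^bsub>A\<^esub> v) S"
    unfolding LinearCombinations.module.span_def[OF fd_module[OF A]] LinearCombinations.module.lincomb_def[OF fd_module[OF A]] by auto
  have car: "v \<in> S \<Longrightarrow> v \<in> carrier A" for v using S Es by auto
  have co: "ip A x e = (if e \<in> S then a e else 0)" if e: "e \<in> E" for e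
  proof -
    have "ip A x e = (\<Sum>v\<in>S. a v * ip A v e)"
      unfolding xe using A car Es(2)[OF e] by simp
    also have "\<dots> = (\<Sum>v\<in>S. if e = v then a v else 0)"
      by (rule sum.cong) (use Es(3)[OF _ e] S in auto)
    finally show ?thesis using S(1) by simp
  qed
  have "ip A x y = (\<Sum>v\<in>S. a v * ip A v y)"
    unfolding xe using A car y by simp
  also have "\<dots> = (\<Sum>e\<in>E. if e \<in> S then a e * ip A e y else 0)"
    using S Es(1) by (simp add: sum.If_cases Int_absorb1)
  also have "\<dots> = (\<Sum>e\<in>E. ip A x e * ip A e y)"
    by (rule sum.cong) (use co in auto)
  finally show ?thesis .
qed

text \<open>Parseval's identity forces spanning, since by \<open>ip_eqI\<close> every
  \<open>x\<close> equals its Fourier sum. Bases are produced through this rule, so that spans need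
  not be computed again.\<close>

lemma onbI:
  assumes A: "fd_hilbert A" and E: "finite E" "E \<subseteq> carrier A"
    and orth: "\<And>e e'. e \<in> E \<Longrightarrow> e' \<in> E \<Longrightarrow> ip A e e' = (if e = e' then 1 else 0)"
    and exp: "\<And>x y. x \<in> carrier A \<Longrightarrow> y \<in> carrier A \<Longrightarrow> ip A x y = (\<Sum>e\<in>E. ip A x e * ip A e y)"
  shows "onb A E"
proof -
  have car: "e \<in> E \<Longrightarrow> e \<in> carrier A" for e using E by auto
  have "x \<in> hspan A E" if x: "x \<in> carrier A" for x
  proof -
    have "x = finsum A (\<lambda>e. ip A x e \<odot>\<^bsub>A\<^esub> e) E"
    proof (rule ip_eqI[OF A x])
      show "ip A x z = ip A (finsum A (\<lambda>e. ip A x e \<odot>\<^bsub>A\<^esub> e) E) z" if z: "z \<in> carrier A" for z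
        by (subst exp[OF x z]) (use A car z in simp)
    qed (use A car in simp)
    then show ?thesis
      unfolding LinearCombinations.module.span_def[OF fd_module[OF A]] LinearCombinations.module.lincomb_def[OF fd_module[OF A]] using E by auto
  qed
  moreover have "hspan A E \<subseteq> carrier A"
    using LinearCombinations.module.span_is_subset2[OF fd_module[OF A] E(2)] by simp
  ultimately show ?thesis unfolding orthonormal_basis_def using E orth by auto
qed

lemma onb_expand:
  assumes A: "fd_hilbert A" and E: "onb A E" and x: "x \<in> carrier A"
  shows "x = finsum A (\<lambda>e. ip A x e \<odot>\<^bsub>A\<^esub> e) E"
proof (rule ip_eqI[OF A x])
  show "ip A x z = ip A (finsum A (\<lambda>e. ip A x e \<odot>\<^bsub>A\<^esub> e) E) z" if z: "z \<in> carrier A" for z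
    by (subst onb_ip[OF A E x z]) (use A onb_simps(2)[OF E] z in simp)
qed (use A onb_simps(2)[OF E] in simp)

text \<open>Gram-Schmidt, one vector of \<open>S\<close> at a time. In place of a span inclusion the
  invariant is Parseval's identity for each \<open>s\<close>, the form that \<open>onbI\<close> asks
  for.\<close>

lemma orthonormal_extend:
  assumes A: "fd_hilbert A" and S: "finite S" "S \<subseteq> carrier A"
  shows "\<exists>E. finite E \<and> E \<subseteq> carrier A \<and> (\<forall>e\<in>E. \<forall>e'\<in>E. ip A e e' = (if e = e' then 1 else 0)) \<and>
    (\<forall>s\<in>S. \<forall>y\<in>carrier A. ip A s y = (\<Sum>e\<in>E. ip A s e * ip A e y))"
  using S
proof (induction S)
  case empty
  show ?case by (rule exI[of _ "{}"]) auto
next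
  case (insert s S)
  have "S \<subseteq> carrier A" using insert.prems by simp
  from insert.IH[OF this] obtain E where E: "finite E" "E \<subseteq> carrier A"
      and orth': "\<forall>e\<in>E. \<forall>e'\<in>E. ip A e e' = (if e = e' then 1 else 0)"
      and exp': "\<forall>s\<in>S. \<forall>y\<in>carrier A. ip A s y = (\<Sum>e\<in>E. ip A s e * ip A e y)"
    by (elim exE conjE)
  have orth: "ip A e e' = (if e = e' then 1 else 0)" if "e \<in> E" "e' \<in> E" for e e'
    using orth' that by blast
  have exp: "ip A s y = (\<Sum>e\<in>E. ip A s e * ip A e y)" if "s \<in> S" "y \<in> carrier A" for s y
    using exp' that by blast
  have car: "e \<in> E \<Longrightarrow> e \<in> carrier A" for e using E by auto
  have s: "s \<in> carrier A" using insert by simp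
  \<comment> \<open>The component of \<open>s\<close> orthogonal to the vectors found so
    far.\<close>
  define r where "r = s \<oplus>\<^bsub>A\<^esub> (- 1) \<odot>\<^bsub>A\<^esub> finsum A (\<lambda>e. ip A s e \<odot>\<^bsub>A\<^esub> e) E"
  have r: "r \<in> carrier A" unfolding r_def using A s car by simp
  have ipr: "ip A r y = ip A s y - (\<Sum>e\<in>E. ip A s e * ip A e y)" if "y \<in> carrier A" for y
    unfolding r_def using A s car that by simp
  show ?case
  proof (cases "r = \<zero>\<^bsub>A\<^esub>")
    case True
    then have "ip A s y = (\<Sum>e\<in>E. ip A s e * ip A e y)" if "y \<in> carrier A" for y
      using ipr[OF that] A that by simp
    then have "\<forall>t\<in>insert s S. \<forall>y\<in>carrier A. ip A t y = (\<Sum>e\<in>E. ip A t e * ip A e y)" using exp' by blast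
    then show ?thesis using E orth' by blast
  next
    case False
    then have "0 < ip A r r" using A r unfolding fd_hilbert_def by blast
    then obtain q where q: "q > 0" "ip A r r = complex_of_real q"
      by (intro that[of "Re (ip A r r)"]) (auto simp: less_complex_def complex_eq_iff)
    \<comment> \<open>This is 1 / |r|, so that \<open>u\<close> has norm 1; it is real, hence no
      conjugate shows up in \<open>cc\<close>.\<close>
    define c where "c = complex_of_real (1 / sqrt q)"
    define u where "u = c \<odot>\<^bsub>A\<^esub> r"
    have u: "u \<in> carrier A" unfolding u_def using A r by simp
    have sq: "complex_of_real (sqrt q) * complex_of_real (sqrt q) = complex_of_real q"
      using q(1) by (simp flip: of_real_mult)
    have cc: "c * (c * complex_of_real q) = 1"
      unfolding c_def using q(1) by (simp add: sq[symmetric])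
    have uu: "ip A u u = 1" unfolding u_def using A r q(2) cc by (simp add: c_def)
    have re: "ip A r e = 0" if e: "e \<in> E" for e
    proof -
      have "(\<Sum>e'\<in>E. ip A s e' * ip A e' e) = (\<Sum>e'\<in>E. if e = e' then ip A s e' else 0)"
        by (rule sum.cong) (use orth e in auto)
      then show ?thesis using ipr[OF car[OF e]] E(1) e by simp
    qed
    have ue: "ip A u e = 0" if "e \<in> E" for e unfolding u_def using A r re[OF that] car[OF that] by simp
    have eu: "ip A e u = 0" if "e \<in> E" for e
      using ip_cnj[OF A u car[OF that]] ue[OF that] by simp
    have uE: "u \<notin> E" using uu ue by force
    have sr: "ip A s y = ip A r y + (\<Sum>e\<in>E. ip A s e * ip A e y)" if "y \<in> carrier A" for y
      using ipr[OF that] by simp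
    have su: "ip A s u = c * complex_of_real q"
    proof -
      have "ip A s u = ip A r u + (\<Sum>e\<in>E. ip A s e * ip A e u)" by (rule sr[OF u])
      also have "\<dots> = ip A r u" using eu by simp
      also have "\<dots> = c * complex_of_real q" unfolding u_def using A r q(2) by (simp add: c_def)
      finally show ?thesis .
    qed
    have sy: "ip A s y = (\<Sum>e\<in>insert u E. ip A s e * ip A e y)" if y: "y \<in> carrier A" for y
    proof -
      have "ip A s u * ip A u y = ip A r y"
      proof -
        have "ip A u y = c * ip A r y" unfolding u_def using A r y by simp
        moreover have "c * complex_of_real q * (c * ip A r y) = (c * (c * complex_of_real q)) * ip A r y"
          by (simp add: ac_simps)
        ultimately show ?thesis unfolding su using cc by simp
      qed
      then show ?thesis using sr[OF y] uE E(1) by simp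
    qed
    have Sy: "ip A t y = (\<Sum>e\<in>insert u E. ip A t e * ip A e y)" if t: "t \<in> S" and y: "y \<in> carrier A" for t y
    proof -
      have "ip A t u = 0" using exp[OF t u] eu by simp
      then show ?thesis using exp[OF t y] uE E(1) by simp
    qed
    have "\<forall>t\<in>insert s S. \<forall>y\<in>carrier A. ip A t y = (\<Sum>e\<in>insert u E. ip A t e * ip A e y)"
      using sy Sy by blast
    moreover have "\<forall>e\<in>insert u E. \<forall>e'\<in>insert u E. ip A e e' = (if e = e' then 1 else 0)"
      using uu ue eu orth uE by auto
    ultimately show ?thesis using E u by (intro exI[of _ "insert u E"]) blast
  qed
qed

text \<open>Parseval's identity holds on the generating set and is linear in its first vector, so it
  extends to the whole space.\<close>

lemma onb_exists:
  assumes A: "fd_hilbert A"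
  obtains E where "onb A E"
proof -
  obtain S where S: "finite S" "S \<subseteq> carrier A" and gen: "hspan A S = carrier A"
    using A vectorspace.fin_dim_def[of class_ring A] unfolding fd_hilbert_def by auto
  from orthonormal_extend[OF A S] obtain E where E: "finite E" "E \<subseteq> carrier A"
      and orth': "\<forall>e\<in>E. \<forall>e'\<in>E. ip A e e' = (if e = e' then 1 else 0)"
      and exp': "\<forall>s\<in>S. \<forall>y\<in>carrier A. ip A s y = (\<Sum>e\<in>E. ip A s e * ip A e y)"
    by (elim exE conjE)
  have orth: "ip A e e' = (if e = e' then 1 else 0)" if "e \<in> E" "e' \<in> E" for e e'
    using orth' that by blast
  have exp: "ip A s y = (\<Sum>e\<in>E. ip A s e * ip A e y)" if "s \<in> S" "y \<in> carrier A" for s y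
    using exp' that by blast
  have car: "e \<in> E \<Longrightarrow> e \<in> carrier A" for e using E by auto
  have "ip A x y = (\<Sum>e\<in>E. ip A x e * ip A e y)" if x: "x \<in> carrier A" and y: "y \<in> carrier A" for x y
  proof -
    have "x \<in> hspan A S" using x gen by simp
    then obtain a T where T: "finite T" "T \<subseteq> S" and xe: "x = finsum A (\<lambda>v. a v \<odot>\<^bsub>A\<^esub> v) T"
      unfolding LinearCombinations.module.span_def[OF fd_module[OF A]] LinearCombinations.module.lincomb_def[OF fd_module[OF A]] by auto
    have carT: "v \<in> T \<Longrightarrow> v \<in> carrier A" for v using T S by auto
    have "(\<Sum>e\<in>E. ip A x e * ip A e y) = (\<Sum>e\<in>E. \<Sum>v\<in>T. a v * (ip A v e * ip A e y))"
      unfolding xe by (rule sum.cong) (use A carT car in \<open>simp_all add: sum_distrib_right mult.assoc\<close>)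
    also have "\<dots> = (\<Sum>v\<in>T. \<Sum>e\<in>E. a v * (ip A v e * ip A e y))" by (rule sum.swap)
    also have "\<dots> = (\<Sum>v\<in>T. a v * ip A v y)"
      by (rule sum.cong) (use exp[OF _ y] T(2) in \<open>auto simp: sum_distrib_left\<close>)
    also have "\<dots> = ip A x y" unfolding xe using A carT y by simp
    finally show ?thesis by simp
  qed
  then have "onb A E" by (intro onbI[OF A E orth])
  then show ?thesis using that by blast
qed

text \<open>With no basis vectors Parseval would make every <x, x> zero. This is how the exclusion
  of the zero space becomes usable, as \<open>F \<noteq> {}\<close> in
  \<open>direct_sum\<close>.\<close>

lemma onb_nonempty:
  assumes A: "fd_hilbert A" and E: "onb A E" and "carrier A \<noteq> {\<zero>\<^bsub>A\<^esub>}"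
  shows "E \<noteq> {}"
proof
  assume "E = {}"
  then have "x = \<zero>\<^bsub>A\<^esub>" if "x \<in> carrier A" for x
    using onb_ip[OF A E that that] ip_self_zero[OF A that] by simp
  then show False using assms(3) hs_closed(3)[OF A] by blast
qed

subsection \<open>Linear maps\<close>

lemma linI:
  assumes "\<And>x. x \<in> carrier A \<Longrightarrow> K x \<in> carrier B"
    and "\<And>x y. x \<in> carrier A \<Longrightarrow> y \<in> carrier A \<Longrightarrow> K (x \<oplus>\<^bsub>A\<^esub> y) = K x \<oplus>\<^bsub>B\<^esub> K y"
    and "\<And>c x. x \<in> carrier A \<Longrightarrow> K (c \<odot>\<^bsub>A\<^esub> x) = c \<odot>\<^bsub>B\<^esub> K x"
  shows "K \<in> lin A B"
  using assms unfolding LinearCombinations.module_hom_def by auto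

lemma lin_simps:
  assumes "K \<in> lin A B"
  shows "x \<in> carrier A \<Longrightarrow> K x \<in> carrier B"
    and "x \<in> carrier A \<Longrightarrow> y \<in> carrier A \<Longrightarrow> K (x \<oplus>\<^bsub>A\<^esub> y) = K x \<oplus>\<^bsub>B\<^esub> K y"
    and "x \<in> carrier A \<Longrightarrow> K (c \<odot>\<^bsub>A\<^esub> x) = c \<odot>\<^bsub>B\<^esub> K x"
  using assms unfolding LinearCombinations.module_hom_def by auto

text \<open>After pairing with \<open>z\<close> the two laws are equations of complex numbers, where
  \<open>ip\<close> can be pushed through finite sums.\<close>

lemma linI_ip:
  assumes A: "fd_hilbert A" and B: "fd_hilbert B"
    and "\<And>x. x \<in> carrier A \<Longrightarrow> K x \<in> carrier B"
    and "\<And>x y z. x \<in> carrier A \<Longrightarrow> y \<in> carrier A \<Longrightarrow> z \<in> carrier B \<Longrightarrow>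
      ip B (K (x \<oplus>\<^bsub>A\<^esub> y)) z = ip B (K x) z + ip B (K y) z"
    and "\<And>c x z. x \<in> carrier A \<Longrightarrow> z \<in> carrier B \<Longrightarrow> ip B (K (c \<odot>\<^bsub>A\<^esub> x)) z = c * ip B (K x) z"
  shows "K \<in> lin A B"
  by (rule linI) (use assms in \<open>auto intro!: ip_eqI[OF B]\<close>)

lemma lin_finsum:
  assumes A: "fd_hilbert A" and B: "fd_hilbert B" and K: "K \<in> lin A B"
    and v: "\<And>i. i \<in> I \<Longrightarrow> v i \<in> carrier A"
  shows "K (finsum A v I) = finsum B (\<lambda>i. K (v i)) I"
proof -
  have "K (0 \<odot>\<^bsub>A\<^esub> \<zero>\<^bsub>A\<^esub>) = 0 \<odot>\<^bsub>B\<^esub> K \<zero>\<^bsub>A\<^esub>" using lin_simps(3)[OF K] A by simp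
  moreover have "0 \<odot>\<^bsub>A\<^esub> \<zero>\<^bsub>A\<^esub> = \<zero>\<^bsub>A\<^esub>" by (rule ip_eqI[OF A]) (use A in simp_all)
  moreover have "0 \<odot>\<^bsub>B\<^esub> K \<zero>\<^bsub>A\<^esub> = \<zero>\<^bsub>B\<^esub>"
    by (rule ip_eqI[OF B]) (use A B lin_simps(1)[OF K] in simp_all)
  ultimately have 0: "K \<zero>\<^bsub>A\<^esub> = \<zero>\<^bsub>B\<^esub>" by simp
  show ?thesis using v
  proof (induction I rule: infinite_finite_induct)
    case (insert j I)
    have c: "v i \<in> carrier A" if "i \<in> insert j I" for i using insert.prems that by blast
    have c': "K (v i) \<in> carrier B" if "i \<in> insert j I" for i using c[OF that] lin_simps(1)[OF K] by blast
    have "finsum A v I \<in> carrier A" "v j \<in> carrier A" using A c by simp_all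
    then have "K (finsum A v (insert j I)) = K (v j) \<oplus>\<^bsub>B\<^esub> K (finsum A v I)"
      by (subst finsum_insert_hs[OF A insert.hyps c]) (simp_all add: lin_simps(2)[OF K])
    then show ?case using insert.IH c
      by (subst finsum_insert_hs[OF B insert.hyps c']) simp_all
  qed (simp_all add: 0 abelian_monoid.finsum_empty[OF fd_abelian_monoid[OF A]] abelian_monoid.finsum_empty[OF fd_abelian_monoid[OF B]]
    abelian_monoid.finsum_infinite[OF fd_abelian_monoid[OF A]] abelian_monoid.finsum_infinite[OF fd_abelian_monoid[OF B]])
qed

lemma lin_onb:
  assumes A: "fd_hilbert A" and B: "fd_hilbert B" and K: "K \<in> lin A B" and E: "onb A E"
    and x: "x \<in> carrier A" and z: "z \<in> carrier B"
  shows "ip B (K x) z = (\<Sum>e\<in>E. ip A x e * ip B (K e) z)"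
proof -
  have "ip B (K x) z = ip B (K (finsum A (\<lambda>e. ip A x e \<odot>\<^bsub>A\<^esub> e) E)) z"
    using onb_expand[OF A E x] by simp
  then show ?thesis
    using lin_finsum[OF A B K, of E "\<lambda>e. ip A x e \<odot>\<^bsub>A\<^esub> e"] A B onb_simps(2)[OF E] lin_simps[OF K] z by simp
qed

lemma lin_eqI:
  assumes A: "fd_hilbert A" and B: "fd_hilbert B" and K: "K \<in> lin A B" and M: "M \<in> lin A B"
    and E: "onb A E" and eq: "\<And>e. e \<in> E \<Longrightarrow> K e = M e" and x: "x \<in> carrier A"
  shows "K x = M x"
  by (rule ip_eqI[OF B lin_simps(1)[OF K x] lin_simps(1)[OF M x]])
    (simp add: lin_onb[OF A B K E x] lin_onb[OF A B M E x] eq)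

lemma lin_comp: "K \<in> lin A B \<Longrightarrow> M \<in> lin B C \<Longrightarrow> (\<lambda>x. M (K x)) \<in> lin A C"
  by (rule linI) (auto simp: lin_simps)

lemma lin_id: "(\<lambda>x. x) \<in> lin A A"
  by (rule linI) auto

lemma lin_lincomb:
  assumes A: "fd_hilbert A" and B: "fd_hilbert B" and K: "\<And>i. i \<in> I \<Longrightarrow> K i \<in> lin A B"
  shows "(\<lambda>x. finsum B (\<lambda>i. c i \<odot>\<^bsub>B\<^esub> K i x) I) \<in> lin A B"
  by (rule linI_ip[OF A B])
    (use A B lin_simps[OF K] in \<open>simp_all add: sum.distrib algebra_simps sum_distrib_left\<close>)

text \<open>Linear extension to \<open>A\<close> of values \<open>w\<close> prescribed on the basis
  \<open>E\<close>. The formula is linear in \<open>w\<close> too, which \<open>purifier\<close>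
  exploits.\<close>

definition lext :: "'a hilb \<Rightarrow> 'a set \<Rightarrow> 'b hilb \<Rightarrow> ('a \<Rightarrow> 'b) \<Rightarrow> 'a \<Rightarrow> 'b" where
  "lext A E B w = (\<lambda>x. finsum B (\<lambda>e. ip A x e \<odot>\<^bsub>B\<^esub> w e) E)"

lemma lext:
  assumes A: "fd_hilbert A" and B: "fd_hilbert B" and E: "onb A E"
    and w: "\<And>e. e \<in> E \<Longrightarrow> w e \<in> carrier B"
  shows "lext A E B w \<in> lin A B" "e \<in> E \<Longrightarrow> lext A E B w e = w e"
proof -
  note Es = onb_simps[OF E]
  show "lext A E B w \<in> lin A B" unfolding lext_def
    by (rule linI_ip[OF A B]) (use A B w Es in \<open>simp_all add: sum.distrib algebra_simps sum_distrib_left\<close>)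
  assume e: "e \<in> E"
  show "lext A E B w e = w e" unfolding lext_def
  proof (rule ip_eqI[OF B])
    fix z assume z: "z \<in> carrier B"
    have "ip B (finsum B (\<lambda>e'. ip A e e' \<odot>\<^bsub>B\<^esub> w e') E) z = (\<Sum>e'\<in>E. ip A e e' * ip B (w e') z)"
      using B w z by simp
    also have "\<dots> = (\<Sum>e'\<in>E. if e = e' then ip B (w e') z else 0)"
      by (rule sum.cong) (use Es(3)[OF e] in auto)
    finally show "ip B (finsum B (\<lambda>e'. ip A e e' \<odot>\<^bsub>B\<^esub> w e') E) z = ip B (w e) z"
      using Es(1) e by simp
  qed (use B w e in auto)
qed

subsection \<open>Tensor products\<close>

definition cspace :: "nat \<Rightarrow> hsp" where
  "cspace n = module.extend (module_vec TYPE(complex) n) (hilb.fields (\<lambda>x y. x \<bullet>c y))"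

lemma cspace_simps [simp]:
  "carrier (cspace n) = carrier_vec n" "add (cspace n) = (+)" "zero (cspace n) = 0\<^sub>v n"
  "module.smult (cspace n) = (\<cdot>\<^sub>v)" "ip (cspace n) x y = x \<bullet>c y"
  unfolding cspace_def module.defs hilb.defs module_vec_def by simp_all

lemma cspace_ip:
  assumes "x \<in> carrier_vec n" "y \<in> carrier_vec n"
  shows "x \<bullet>c y = (\<Sum>i<n. x $ i * cnj (y $ i))"
  using assms unfolding scalar_prod_def by (auto simp: atLeast0LessThan intro!: sum.cong)

lemma cspace_module: "Module.module class_ring (cspace n)"
  apply unfold_locales
  apply (auto simp: class_ring_simps Units_def add_smult_distrib_vec smult_add_distrib_vec intro!: bexI[of _ "- _"])
  done

text \<open>\<open>finsum\<close> sees only the additive structure, which both records share. This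
  carries finite dimension over from \<open>vec_space\<close>.\<close>

lemma cspace_finsum: "finsum (cspace n) f S = finsum (module_vec TYPE(complex) n) f S"
  unfolding finsum_def finprod_def by (simp add: module_vec_simps)

lemma cspace_hilbert: "fd_hilbert (cspace n)"
proof -
  have vs: "vectorspace class_ring (cspace n)"
    unfolding vectorspace_def using cspace_module class_field by blast
  interpret V: vec_space "TYPE(complex)" n .
  have "vectorspace.fin_dim class_ring (cspace n)"
  proof -
    have "hspan (cspace n) S = V.span S" for S
      unfolding LinearCombinations.module.span_def[OF cspace_module] V.span_def
        LinearCombinations.module.lincomb_def[OF cspace_module] V.lincomb_def
      by (simp add: cspace_finsum module_vec_simps)
    then show ?thesis
      unfolding vectorspace.fin_dim_def[OF vs] using V.fin_dim unfolding V.fin_dim_def by auto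
  qed
  moreover have "ip (cspace n) y x = cnj (ip (cspace n) x y)"
    if "x \<in> carrier_vec n" "y \<in> carrier_vec n" for x y :: "complex vec"
    using that by (simp add: cspace_ip mult.commute)
  moreover have "0 < (\<Sum>i<n. x $ i * cnj (x $ i))" if "x \<in> carrier_vec n" "x \<noteq> 0\<^sub>v n" for x :: "complex vec"
    using conjugate_square_greater_0_vec[OF that(1)] that by (simp add: cspace_ip)
  ultimately show ?thesis unfolding fd_hilbert_def using vs
    by (auto simp: cspace_ip sum.distrib algebra_simps sum_distrib_left add_scalar_prod_distrib
       simp del: index_add_vec)
qed

lemma span_repr:
  assumes A: "fd_hilbert A" and "hspan A S = carrier A"
    and x: "x \<in> carrier A"
  obtains a T where "finite T" "T \<subseteq> S" "x = finsum A (\<lambda>v. a v \<odot>\<^bsub>A\<^esub> v) T"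
proof -
  have "x \<in> hspan A S" using assms by simp
  then show ?thesis using that
    unfolding LinearCombinations.module.span_def[OF fd_module[OF A]] LinearCombinations.module.lincomb_def[OF fd_module[OF A]]
    by auto
qed

lemma cspace_onb: "onb (cspace n) (unit_vec n ` {..<n})"
proof (rule onbI[OF cspace_hilbert])
  have ip_unit: "x \<bullet>c unit_vec n i = x $ i" "unit_vec n i \<bullet>c x = cnj (x $ i)"
    if "i < n" "x \<in> carrier_vec n" for i and x :: "complex vec"
  proof -
    have "x \<bullet>c unit_vec n i = (\<Sum>j<n. if i = j then x $ j else 0)"
      unfolding cspace_ip[OF that(2) unit_vec_carrier] by (rule sum.cong) (use that in auto)
    then show "x \<bullet>c unit_vec n i = x $ i" using that by simp
    have "unit_vec n i \<bullet>c x = (\<Sum>j<n. if i = j then cnj (x $ j) else 0)"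
      unfolding cspace_ip[OF unit_vec_carrier that(2)] by (rule sum.cong) (use that in auto)
    then show "unit_vec n i \<bullet>c x = cnj (x $ i)" using that by simp
  qed
  have inj: "inj_on (unit_vec n :: nat \<Rightarrow> complex vec) {..<n}"
    by (rule inj_onI) (metis index_unit_vec(1) lessThan_iff zero_neq_one)
  show "ip (cspace n) e e' = (if e = e' then 1 else 0)"
    if "e \<in> unit_vec n ` {..<n}" "e' \<in> unit_vec n ` {..<n}" for e e'
    using that inj by (auto simp: ip_unit inj_on_def)
  show "ip (cspace n) x y = (\<Sum>e\<in>unit_vec n ` {..<n}. ip (cspace n) x e * ip (cspace n) e y)"
    if "x \<in> carrier (cspace n)" "y \<in> carrier (cspace n)" for x y
    unfolding cspace_simps using that by (subst cspace_ip) (simp_all add: sum.reindex[OF inj] ip_unit)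
qed auto

text \<open>Makes the choice in \<open>htensor\<close> meaningful. The model is C^N with N = |E|
  |F|: the coordinates of \<open>t a b\<close> are products of Fourier coefficients of
  \<open>a\<close> and \<open>b\<close>. The inner product law is Parseval in both factors, and the
  unit vectors are the images of basis pairs, which gives spanning.\<close>

lemma tensor_exists:
  fixes A B :: hsp
  assumes A: "fd_hilbert A" and B: "fd_hilbert B"
  shows "\<exists>p. is_tensor A B (fst p) (snd p)"
proof -
  obtain E where E: "onb A E" using onb_exists[OF A] .
  obtain F where F: "onb B F" using onb_exists[OF B] .
  note Es = onb_simps[OF E] and Fs = onb_simps[OF F]
  define N where "N = card (E \<times> F)"
  obtain h where h: "bij_betw h {..<N} (E \<times> F)"
    using ex_bij_betw_nat_finite[of "E \<times> F"] Es(1) Fs(1) unfolding N_def atLeast0LessThan by auto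
  have hE: "fst (h k) \<in> E" "snd (h k) \<in> F" if "k < N" for k
    using bij_betwE[OF h] that by (auto simp: mem_Times_iff)
  note hc = Es(2)[OF hE(1)] Fs(2)[OF hE(2)]
  define t where "t a b = vec N (\<lambda>k. ip A a (fst (h k)) * ip B b (snd (h k)))" for a b
  have tc: "t a b \<in> carrier_vec N" for a b unfolding t_def by simp
  have ti: "t a b $ k = ip A a (fst (h k)) * ip B b (snd (h k))" if "k < N" for a b k
    unfolding t_def using that by simp
  have "(\<lambda>a. t a b) \<in> lin A (cspace N)" if "b \<in> carrier B" for b
    by (rule linI) (use A hc in \<open>auto simp: t_def algebra_simps intro!: eq_vecI\<close>)
  moreover have "t a \<in> lin B (cspace N)" if "a \<in> carrier A" for a
    by (rule linI) (use B hc in \<open>auto simp: t_def algebra_simps intro!: eq_vecI\<close>)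
  moreover have "ip (cspace N) (t a b) (t a' b') = ip A a a' * ip B b b'"
    if "a \<in> carrier A" "a' \<in> carrier A" "b \<in> carrier B" "b' \<in> carrier B" for a a' b b'
  proof -
    have "ip (cspace N) (t a b) (t a' b') =
        (\<Sum>k<N. (\<lambda>(e, f). (ip A a e * ip A e a') * (ip B b f * ip B f b')) (h k))"
      unfolding cspace_simps cspace_ip[OF tc tc]
      by (rule sum.cong) (use that A B hc in \<open>auto simp: ti ip_cnj split_beta\<close>)
    also have "\<dots> = (\<Sum>(e, f)\<in>E\<times>F. (ip A a e * ip A e a') * (ip B b f * ip B f b'))"
      by (rule sum.reindex_bij_betw[OF h])
    also have "\<dots> = (\<Sum>e\<in>E. ip A a e * ip A e a') * (\<Sum>f\<in>F. ip B b f * ip B f b')"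
      by (simp add: sum.cartesian_product sum_product)
    also have "\<dots> = ip A a a' * ip B b b'"
      by (simp only: onb_ip[OF A E that(1,2)] onb_ip[OF B F that(3,4)])
    finally show ?thesis .
  qed
  moreover have "hspan (cspace N)
      {t a b | a b. a \<in> carrier A \<and> b \<in> carrier B} = carrier (cspace N)"
  proof
    show "hspan (cspace N)
      {t a b | a b. a \<in> carrier A \<and> b \<in> carrier B} \<subseteq> carrier (cspace N)"
      by (rule LinearCombinations.module.span_is_subset2[OF cspace_module]) (use tc in auto)
    have "unit_vec N k \<in> {t a b | a b. a \<in> carrier A \<and> b \<in> carrier B}" if k: "k < N" for k
    proof -
      have "unit_vec N k = t (fst (h k)) (snd (h k))"
      proof (rule eq_vecI)
        fix j assume "j < dim_vec (t (fst (h k)) (snd (h k)))"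
        then have j: "j < N" unfolding t_def by simp
        have "(fst (h k) = fst (h j) \<and> snd (h k) = snd (h j)) \<longleftrightarrow> j = k"
          using h j k unfolding bij_betw_def inj_on_def by (metis lessThan_iff prod_eqI)
        then show "unit_vec N k $ j = t (fst (h k)) (snd (h k)) $ j"
          using j k by (cases "j = k") (auto simp: ti Es(3)[OF hE(1) hE(1)] Fs(3)[OF hE(2) hE(2)])
      qed (simp add: t_def)
      then show ?thesis using hc[OF k] by blast
    qed
    then have "unit_vec N ` {..<N} \<subseteq> {t a b | a b. a \<in> carrier A \<and> b \<in> carrier B}" by blast
    then show "carrier (cspace N) \<subseteq> hspan (cspace N)
      {t a b | a b. a \<in> carrier A \<and> b \<in> carrier B}"
      using LinearCombinations.module.span_is_monotone[OF cspace_module, of "unit_vec N ` {..<N}" _ N]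
        cspace_onb[of N] unfolding orthonormal_basis_def by simp
  qed
  ultimately have "is_tensor A B (cspace N) t"
    unfolding is_tensor_def using cspace_hilbert by blast
  then show ?thesis by (intro exI[of _ "(cspace N, t)"]) simp
qed

section \<open>The chosen tensor product through its universal property\<close>

lemma tensor_is_tensor:
  assumes "fd_hilbert A" "fd_hilbert B"
  shows "is_tensor A B (tspace A B) (tvec A B)"
  unfolding tspace_def tvec_def htensor_def using someI_ex[OF tensor_exists[OF assms]] .

lemma tspace_simps [simp]:
  assumes A: "fd_hilbert A" and B: "fd_hilbert B"
  shows "fd_hilbert (tspace A B)"
    and "b \<in> carrier B \<Longrightarrow> (\<lambda>a. tvec A B a b) \<in> lin A (tspace A B)"
    and "a \<in> carrier A \<Longrightarrow> tvec A B a \<in> lin B (tspace A B)"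
    and "a \<in> carrier A \<Longrightarrow> b \<in> carrier B \<Longrightarrow> tvec A B a b \<in> carrier (tspace A B)"
    and "a \<in> carrier A \<Longrightarrow> b \<in> carrier B \<Longrightarrow> a' \<in> carrier A \<Longrightarrow> b' \<in> carrier B \<Longrightarrow>
      ip (tspace A B) (tvec A B a b) (tvec A B a' b') = ip A a a' * ip B b b'"
  using tensor_is_tensor[OF A B] lin_simps(1)[of "tvec A B a" B "tspace A B"]
  unfolding is_tensor_def by blast+

lemma tspace_span:
  assumes A: "fd_hilbert A" and B: "fd_hilbert B"
  shows "hspan (tspace A B)
    {tvec A B a b | a b. a \<in> carrier A \<and> b \<in> carrier B} = carrier (tspace A B)"
  using tensor_is_tensor[OF A B] unfolding is_tensor_def by blast

text \<open>Here \<open>w\<close> is any bilinear map: it is \<open>tvec\<close> itself in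
  \<open>tensor_ip\<close>, and the map to be factored in \<open>tensor_lift\<close>.\<close>

lemma tvec_expand:
  assumes A: "fd_hilbert A" and B: "fd_hilbert B" and E: "onb A E" and F: "onb B F"
    and w1: "\<And>b. b \<in> carrier B \<Longrightarrow> (\<lambda>a. w a b) \<in> lin A C" and w2: "\<And>a. a \<in> carrier A \<Longrightarrow> w a \<in> lin B C"
    and C: "fd_hilbert C" and a: "a \<in> carrier A" and b: "b \<in> carrier B" and z: "z \<in> carrier C"
  shows "ip C (w a b) z = (\<Sum>e\<in>E. \<Sum>f\<in>F. ip A a e * ip B b f * ip C (w e f) z)"
proof -
  have "ip C (w a b) z = (\<Sum>e\<in>E. ip A a e * ip C (w e b) z)"
    by (rule lin_onb[OF A C w1[OF b] E a z])
  also have "\<dots> = (\<Sum>e\<in>E. ip A a e * (\<Sum>f\<in>F. ip B b f * ip C (w e f) z))"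
    by (rule sum.cong) (use lin_onb[OF B C w2 F b z] onb_simps(2)[OF E] in auto)
  finally show ?thesis by (simp add: sum_distrib_left mult.assoc)
qed

text \<open>Both sides are linear in \<open>x\<close> and product vectors span, so
  \<open>tvec_expand\<close> settles it. This is completeness of the product basis in the form
  required by \<open>onbI\<close>.\<close>

lemma tensor_ip:
  assumes A: "fd_hilbert A" and B: "fd_hilbert B" and E: "onb A E" and F: "onb B F"
    and x: "x \<in> carrier (tspace A B)" and y: "y \<in> carrier (tspace A B)"
  shows "ip (tspace A B) x y =
    (\<Sum>e\<in>E. \<Sum>f\<in>F. ip (tspace A B) x (tvec A B e f) * ip (tspace A B) (tvec A B e f) y)"
proof -
  let ?T = "tspace A B"
  have T: "fd_hilbert ?T" using A B by simp
  note Es = onb_simps[OF E] and Fs = onb_simps[OF F]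
  obtain a S where S: "finite S" "S \<subseteq> {tvec A B a b | a b. a \<in> carrier A \<and> b \<in> carrier B}"
    and xe: "x = finsum ?T (\<lambda>v. a v \<odot>\<^bsub>?T\<^esub> v) S"
    using span_repr[OF T tspace_span[OF A B] x] .
  have Sc: "v \<in> carrier ?T" if "v \<in> S" for v using S that A B by auto
  have prod: "ip ?T v y = (\<Sum>e\<in>E. \<Sum>f\<in>F. ip ?T v (tvec A B e f) * ip ?T (tvec A B e f) y)"
    if vS: "v \<in> S" for v
  proof -
    obtain p q where v: "v = tvec A B p q" and p: "p \<in> carrier A" and q: "q \<in> carrier B" using S vS by blast
    have "ip ?T v y = (\<Sum>e\<in>E. \<Sum>f\<in>F. ip A p e * ip B q f * ip ?T (tvec A B e f) y)"
      unfolding v by (rule tvec_expand[OF A B E F _ _ T p q y]) (use A B in simp_all)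
    also have "\<dots> = (\<Sum>e\<in>E. \<Sum>f\<in>F. ip ?T v (tvec A B e f) * ip ?T (tvec A B e f) y)"
      by (intro sum.cong) (use A B p q Es(2) Fs(2) v in simp_all)
    finally show ?thesis .
  qed
  have "ip ?T x y = (\<Sum>v\<in>S. a v * ip ?T v y)" unfolding xe using T Sc y by simp
  also have "\<dots> = (\<Sum>v\<in>S. \<Sum>e\<in>E. \<Sum>f\<in>F. a v * ip ?T v (tvec A B e f) * ip ?T (tvec A B e f) y)"
    by (rule sum.cong) (use prod in \<open>auto simp: sum_distrib_left mult.assoc\<close>)
  also have "\<dots> = (\<Sum>e\<in>E. \<Sum>f\<in>F. \<Sum>v\<in>S. a v * ip ?T v (tvec A B e f) * ip ?T (tvec A B e f) y)"
    by (subst sum.swap, rule sum.cong[OF refl], rule sum.swap)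
  also have "\<dots> = (\<Sum>e\<in>E. \<Sum>f\<in>F. ip ?T x (tvec A B e f) * ip ?T (tvec A B e f) y)"
    unfolding xe by (intro sum.cong refl) (use A B T Sc Es(2) Fs(2) in \<open>simp add: sum_distrib_right\<close>)
  finally show ?thesis .
qed

definition tbasis :: "hsp \<Rightarrow> hsp \<Rightarrow> complex vec set \<Rightarrow> complex vec set \<Rightarrow> complex vec set" where
  "tbasis A B E F = (\<lambda>(e, f). tvec A B e f) ` (E \<times> F)"

lemma tbasis_inj:
  assumes A: "fd_hilbert A" and B: "fd_hilbert B" and E: "onb A E" and F: "onb B F"
  shows "inj_on (\<lambda>(e, f). tvec A B e f) (E \<times> F)"
proof (rule inj_onI)
  note Es = onb_simps[OF E] and Fs = onb_simps[OF F]
  fix p q assume p: "p \<in> E \<times> F" and q: "q \<in> E \<times> F"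
    and eq: "(\<lambda>(e, f). tvec A B e f) p = (\<lambda>(e, f). tvec A B e f) q"
  obtain e f e' f' where pq: "p = (e, f)" "q = (e', f')" and m: "e \<in> E" "f \<in> F" "e' \<in> E" "f' \<in> F"
    using p q by auto
  have "ip (tspace A B) (tvec A B e f) (tvec A B e' f') = ip (tspace A B) (tvec A B e f) (tvec A B e f)"
    using eq pq by simp
  then have "ip A e e' * ip B f f' = ip A e e * ip B f f" using A B m Es(2) Fs(2) by simp
  then show "p = q" using m pq by (auto simp: Es(3) Fs(3) split: if_splits)
qed

lemma tbasis_onb:
  assumes A: "fd_hilbert A" and B: "fd_hilbert B" and E: "onb A E" and F: "onb B F"
  shows "onb (tspace A B) (tbasis A B E F)"
proof (rule onbI)
  note Es = onb_simps[OF E] and Fs = onb_simps[OF F]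
  note inj = tbasis_inj[OF A B E F]
  show "fd_hilbert (tspace A B)" using A B by simp
  show "finite (tbasis A B E F)" unfolding tbasis_def using Es Fs by simp
  show "tbasis A B E F \<subseteq> carrier (tspace A B)" unfolding tbasis_def using Es Fs A B by auto
  show "ip (tspace A B) e e' = (if e = e' then 1 else 0)"
    if ee: "e \<in> tbasis A B E F" "e' \<in> tbasis A B E F" for e e'
  proof -
    obtain p q p' q' where e: "e = tvec A B p q" "e' = tvec A B p' q'"
      and m: "p \<in> E" "q \<in> F" "p' \<in> E" "q' \<in> F" using ee unfolding tbasis_def by auto
    have "e = e' \<longleftrightarrow> p = p' \<and> q = q'" using inj_onD[OF inj, of "(p, q)" "(p', q')"] e m by auto
    then show ?thesis using A B m Es(2) Fs(2) by (simp add: e Es(3) Fs(3))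
  qed
  show "ip (tspace A B) x y = (\<Sum>e\<in>tbasis A B E F. ip (tspace A B) x e * ip (tspace A B) e y)"
    if "x \<in> carrier (tspace A B)" "y \<in> carrier (tspace A B)" for x y
    unfolding tbasis_def sum.reindex[OF inj] tensor_ip[OF A B E F that]
    by (simp add: sum.cartesian_product split_beta)
qed

text \<open>The universal property. \<open>R\<close> is the Fourier sum over the product basis with
  basis vectors replaced by values of \<open>w\<close>; bilinearity recovers \<open>w\<close> on all
  product vectors.\<close>

lemma tensor_lift:
  assumes A: "fd_hilbert A" and B: "fd_hilbert B" and C: "fd_hilbert C"
    and w1: "\<And>b. b \<in> carrier B \<Longrightarrow> (\<lambda>a. w a b) \<in> lin A C" and w2: "\<And>a. a \<in> carrier A \<Longrightarrow> w a \<in> lin B C"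
  shows "\<exists>R \<in> lin (tspace A B) C. \<forall>a \<in> carrier A. \<forall>b \<in> carrier B. R (tvec A B a b) = w a b"
proof -
  obtain E where E: "onb A E" using onb_exists[OF A] .
  obtain F where F: "onb B F" using onb_exists[OF B] .
  note Es = onb_simps[OF E] and Fs = onb_simps[OF F]
  have wc: "w a b \<in> carrier C" if "a \<in> carrier A" "b \<in> carrier B" for a b
    using lin_simps(1)[OF w2[OF that(1)] that(2)] .
  define R where "R x = finsum C (\<lambda>p. ip (tspace A B) x (tvec A B (fst p) (snd p)) \<odot>\<^bsub>C\<^esub> w (fst p) (snd p)) (E \<times> F)" for x
  have c: "w (fst p) (snd p) \<in> carrier C" "fst p \<in> carrier A" "snd p \<in> carrier B" if "p \<in> E \<times> F" for p
    using that wc Es(2) Fs(2) by auto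
  have R: "R \<in> lin (tspace A B) C" unfolding R_def
    by (rule linI_ip) (use A B C c in \<open>simp_all add: sum.distrib algebra_simps sum_distrib_left\<close>)
  have "R (tvec A B a b) = w a b" if a: "a \<in> carrier A" and b: "b \<in> carrier B" for a b
  proof (rule ip_eqI[OF C])
    fix z assume z: "z \<in> carrier C"
    have "ip C (R (tvec A B a b)) z = (\<Sum>p\<in>E\<times>F. ip A a (fst p) * ip B b (snd p) * ip C (w (fst p) (snd p)) z)"
      unfolding R_def by (subst ip_finsum[OF C]) (use A B C c a b z in simp_all)
    also have "\<dots> = ip C (w a b) z"
      using tvec_expand[of A B E F w C a b z, OF A B E F w1 w2 C a b z]
      by (simp add: sum.cartesian_product split_beta)
    finally show "ip C (R (tvec A B a b)) z = ip C (w a b) z" .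
  qed (use A B C wc a b lin_simps(1)[OF R] in simp_all)
  then show ?thesis using R by blast
qed

lemma lin_tensor_eqI:
  assumes A: "fd_hilbert A" and B: "fd_hilbert B" and C: "fd_hilbert C"
    and K: "K \<in> lin (tspace A B) C" and M: "M \<in> lin (tspace A B) C"
    and eq: "\<And>a b. a \<in> carrier A \<Longrightarrow> b \<in> carrier B \<Longrightarrow> K (tvec A B a b) = M (tvec A B a b)"
    and x: "x \<in> carrier (tspace A B)"
  shows "K x = M x"
proof -
  obtain E where E: "onb A E" using onb_exists[OF A] .
  obtain F where F: "onb B F" using onb_exists[OF B] .
  show ?thesis
    by (rule lin_eqI[OF _ C K M tbasis_onb[OF A B E F] _ x])
      (use A B eq onb_simps(2)[OF E] onb_simps(2)[OF F] in \<open>auto simp: tbasis_def\<close>)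
qed

text \<open>The linear map K \<otimes> M. Members of \<open>lin\<close> are unconstrained outside
  the carrier, so the map is not unique as a function and \<open>SOME\<close> takes the place of
  \<open>THE\<close>.\<close>

definition tmap :: "hsp \<Rightarrow> hsp \<Rightarrow> hsp \<Rightarrow> hsp \<Rightarrow> hop \<Rightarrow> hop \<Rightarrow> hop" where
  "tmap A B C D K M = (SOME R. R \<in> lin (tspace A B) (tspace C D) \<and>
     (\<forall>a \<in> carrier A. \<forall>b \<in> carrier B. R (tvec A B a b) = tvec C D (K a) (M b)))"

lemma tmap:
  assumes A: "fd_hilbert A" and B: "fd_hilbert B" and C: "fd_hilbert C" and D: "fd_hilbert D"
    and K: "K \<in> lin A C" and M: "M \<in> lin B D"
  shows "tmap A B C D K M \<in> lin (tspace A B) (tspace C D)"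
    and "a \<in> carrier A \<Longrightarrow> b \<in> carrier B \<Longrightarrow> tmap A B C D K M (tvec A B a b) = tvec C D (K a) (M b)"
proof -
  have "(\<lambda>a. tvec C D (K a) (M b)) \<in> lin A (tspace C D)" if "b \<in> carrier B" for b
    by (rule lin_comp[OF K]) (use C D lin_simps(1)[OF M that] in simp)
  moreover have "(\<lambda>b. tvec C D (K a) (M b)) \<in> lin B (tspace C D)" if "a \<in> carrier A" for a
    by (rule lin_comp[OF M]) (use C D lin_simps(1)[OF K that] in simp)
  ultimately have "\<exists>R. R \<in> lin (tspace A B) (tspace C D) \<and>
     (\<forall>a \<in> carrier A. \<forall>b \<in> carrier B. R (tvec A B a b) = tvec C D (K a) (M b))"
    using tensor_lift[OF A B tspace_simps(1)[OF C D], of "\<lambda>a b. tvec C D (K a) (M b)"] by blast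
  from someI_ex[OF this, folded tmap_def]
  show "tmap A B C D K M \<in> lin (tspace A B) (tspace C D)"
    and "a \<in> carrier A \<Longrightarrow> b \<in> carrier B \<Longrightarrow> tmap A B C D K M (tvec A B a b) = tvec C D (K a) (M b)" by blast+
qed

text \<open>Source of the unitors and associators: two orthonormal bases over one index set
  determine the isomorphism by linear extension, and both composites fix a basis.\<close>

lemma basis_bijection:
  assumes A: "fd_hilbert A" and B: "fd_hilbert B"
    and g: "inj_on g I" "onb A (g ` I)" and h: "inj_on h I" "onb B (h ` I)"
  obtains S T where "S \<in> lin A B" "T \<in> lin B A" "\<And>i. i \<in> I \<Longrightarrow> S (g i) = h i" "\<And>i. i \<in> I \<Longrightarrow> T (h i) = g i"
    "\<And>x. x \<in> carrier A \<Longrightarrow> T (S x) = x" "\<And>y. y \<in> carrier B \<Longrightarrow> S (T y) = y"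
proof -
  define S where "S = lext A (g ` I) B (\<lambda>e. h (inv_into I g e))"
  define T where "T = lext B (h ` I) A (\<lambda>e. g (inv_into I h e))"
  have hc: "h i \<in> carrier B" and gc: "g i \<in> carrier A" if "i \<in> I" for i
    using onb_simps(2)[OF h(2)] onb_simps(2)[OF g(2)] that by auto
  have S: "S \<in> lin A B" "\<And>i. i \<in> I \<Longrightarrow> S (g i) = h i"
    unfolding S_def using lext[OF A B g(2), of "\<lambda>e. h (inv_into I g e)"] hc g(1) by (simp_all add: inv_into_into)
  have T: "T \<in> lin B A" "\<And>i. i \<in> I \<Longrightarrow> T (h i) = g i"
    unfolding T_def using lext[OF B A h(2), of "\<lambda>e. g (inv_into I h e)"] gc h(1) by (simp_all add: inv_into_into)
  have "T (S x) = x" if "x \<in> carrier A" for x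
    by (rule lin_eqI[OF A A lin_comp[OF S(1) T(1)] lin_id g(2) _ that]) (use S T in auto)
  moreover have "S (T y) = y" if "y \<in> carrier B" for y
    by (rule lin_eqI[OF B B lin_comp[OF T(1) S(1)] lin_id h(2) _ that]) (use S T in auto)
  ultimately show ?thesis using that S T by blast
qed

subsection \<open>Operators\<close>

lemma L_simps [simp]:
  "add (L A) S T = (\<lambda>x \<in> carrier A. S x \<oplus>\<^bsub>A\<^esub> T x)"
  "module.smult (L A) c S = (\<lambda>x \<in> carrier A. c \<odot>\<^bsub>A\<^esub> S x)"
  "one (L A) = (\<lambda>x \<in> carrier A. x)"
  unfolding L_def by simp_all

lemma L_iff: "T \<in> carrier (L A) \<longleftrightarrow> T \<in> lin A A \<and> T \<in> extensional (carrier A)"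
  unfolding L_def by simp

lemma L_lin: "T \<in> carrier (L A) \<Longrightarrow> T \<in> lin A A"
  unfolding L_iff by simp

lemma L_closed [simp]: "T \<in> carrier (L A) \<Longrightarrow> x \<in> carrier A \<Longrightarrow> T x \<in> carrier A"
  by (rule lin_simps(1)[OF L_lin])

lemma L_restrict:
  assumes A: "fd_hilbert A" and T: "T \<in> lin A A"
  shows "(\<lambda>x \<in> carrier A. T x) \<in> carrier (L A)"
  unfolding L_iff using A lin_simps[OF T] by (auto intro!: linI)

lemma L_ops_closed [simp]:
  assumes "fd_hilbert A"
  shows "S \<in> carrier (L A) \<Longrightarrow> T \<in> carrier (L A) \<Longrightarrow> (\<lambda>x \<in> carrier A. S x \<oplus>\<^bsub>A\<^esub> T x) \<in> carrier (L A)"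
    and "S \<in> carrier (L A) \<Longrightarrow> (\<lambda>x \<in> carrier A. c \<odot>\<^bsub>A\<^esub> S x) \<in> carrier (L A)"
    and "(\<lambda>x \<in> carrier A. x) \<in> carrier (L A)"
proof -
  show "(\<lambda>x \<in> carrier A. x) \<in> carrier (L A)" by (rule L_restrict[OF assms lin_id])
  show "(\<lambda>x \<in> carrier A. S x \<oplus>\<^bsub>A\<^esub> T x) \<in> carrier (L A)" if "S \<in> carrier (L A)" "T \<in> carrier (L A)"
    by (rule L_restrict[OF assms], rule linI_ip[OF assms assms])
      (use assms that lin_simps[OF L_lin[OF that(1)]] lin_simps[OF L_lin[OF that(2)]] in \<open>simp_all add: algebra_simps\<close>)
  show "(\<lambda>x \<in> carrier A. c \<odot>\<^bsub>A\<^esub> S x) \<in> carrier (L A)" if "S \<in> carrier (L A)"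
    by (rule L_restrict[OF assms], rule linI_ip[OF assms assms])
      (use assms that lin_simps[OF L_lin[OF that(1)]] in \<open>simp_all add: algebra_simps\<close>)
qed

lemma op_eqI:
  assumes A: "fd_hilbert A" and S: "S \<in> carrier (L A)" and T: "T \<in> carrier (L A)"
    and eq: "\<And>x y. x \<in> carrier A \<Longrightarrow> y \<in> carrier A \<Longrightarrow> ip A (S x) y = ip A (T x) y"
  shows "S = T"
proof (rule extensionalityI[of _ "carrier A"])
  show "S x = T x" if x: "x \<in> carrier A" for x
    by (rule ip_eqI[OF A L_closed[OF S x] L_closed[OF T x] eq[OF x]])
qed (use S T in \<open>simp_all add: L_iff\<close>)

text \<open>The operator |x><y|. The bra is \<open>ip A z y\<close> because \<open>ip\<close> is
  linear in its first argument.\<close>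

definition ketbra :: "'a hilb \<Rightarrow> 'a \<Rightarrow> 'a \<Rightarrow> 'a \<Rightarrow> 'a" where
  "ketbra A x y = (\<lambda>z \<in> carrier A. ip A z y \<odot>\<^bsub>A\<^esub> x)"

lemma ketbra_closed [simp]:
  assumes A: "fd_hilbert A" and x: "x \<in> carrier A" and y: "y \<in> carrier A"
  shows "ketbra A x y \<in> carrier (L A)"
  unfolding ketbra_def
  by (rule L_restrict[OF A], rule linI_ip[OF A A]) (use A x y in \<open>simp_all add: algebra_simps\<close>)

lemma ketbra_ip [simp]:
  assumes "fd_hilbert A" "x \<in> carrier A" "y \<in> carrier A" "z \<in> carrier A" "w \<in> carrier A"
  shows "ip A (ketbra A x y z) w = ip A z y * ip A x w"
  using assms unfolding ketbra_def by simp

text \<open>Linear combinations of operators are formed pointwise in \<open>A\<close>, which avoids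
  setting up \<open>L A\<close> as a module in order to use its own \<open>finsum\<close>.\<close>

definition opsum :: "'a hilb \<Rightarrow> 'i set \<Rightarrow> ('i \<Rightarrow> complex) \<Rightarrow> ('i \<Rightarrow> 'a \<Rightarrow> 'a) \<Rightarrow> 'a \<Rightarrow> 'a" where
  "opsum A I c T = (\<lambda>x \<in> carrier A. finsum A (\<lambda>i. c i \<odot>\<^bsub>A\<^esub> T i x) I)"

lemma opsum_closed [simp]:
  assumes A: "fd_hilbert A" and T: "\<forall>i\<in>I. T i \<in> carrier (L A)"
  shows "opsum A I c T \<in> carrier (L A)"
  unfolding opsum_def by (rule L_restrict[OF A], rule lin_lincomb[OF A A]) (use L_lin T in blast)

lemma opsum_ip [simp]:
  assumes A: "fd_hilbert A" and T: "\<forall>i\<in>I. T i \<in> carrier (L A)"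
    and xy: "x \<in> carrier A" "y \<in> carrier A"
  shows "ip A (opsum A I c T x) y = (\<Sum>i\<in>I. c i * ip A (T i x) y)"
proof -
  have "T i x \<in> carrier A" if "i \<in> I" for i using T that xy by simp
  then show ?thesis unfolding opsum_def using A xy by simp
qed

text \<open>Expansion in matrix units: the coefficient of |e'><e| is <T e, e'>. Consequently
  superoperators are determined by their values on rank one operators.\<close>

lemma op_expand:
  assumes A: "fd_hilbert A" and E: "onb A E" and T: "T \<in> carrier (L A)"
  shows "T = opsum A (E \<times> E) (\<lambda>p. ip A (T (fst p)) (snd p)) (\<lambda>p. ketbra A (snd p) (fst p))"
proof (rule op_eqI[OF A T])
  have c: "fst p \<in> carrier A" "snd p \<in> carrier A" if "p \<in> E \<times> E" for p
    using that onb_simps(2)[OF E] by auto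
  then show "opsum A (E \<times> E) (\<lambda>p. ip A (T (fst p)) (snd p)) (\<lambda>p. ketbra A (snd p) (fst p)) \<in> carrier (L A)"
    using A by simp
  fix x y assume x: "x \<in> carrier A" and y: "y \<in> carrier A"
  have "ip A (T x) y = (\<Sum>e\<in>E. ip A x e * ip A (T e) y)"
    by (rule lin_onb[OF A A L_lin[OF T] E x y])
  also have "\<dots> = (\<Sum>e\<in>E. ip A x e * (\<Sum>e'\<in>E. ip A (T e) e' * ip A e' y))"
    by (intro sum.cong refl, subst onb_ip[OF A E _ y]) (use onb_simps(2)[OF E] T in simp_all)
  also have "\<dots> = (\<Sum>p\<in>E\<times>E. ip A (T (fst p)) (snd p) * (ip A x (fst p) * ip A (snd p) y))"
    by (simp add: sum.cartesian_product split_beta sum_distrib_left mult.left_commute)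
  also have "\<dots> = ip A (opsum A (E \<times> E) (\<lambda>p. ip A (T (fst p)) (snd p)) (\<lambda>p. ketbra A (snd p) (fst p)) x) y"
    using A c x y by simp
  finally show "ip A (T x) y = \<dots>" .
qed

subsection \<open>Superoperators\<close>

lemma superops_simps:
  assumes "f \<in> superops A B"
  shows "T \<in> carrier (L A) \<Longrightarrow> f T \<in> carrier (L B)" "f \<in> extensional (carrier (L A))"
  using assms unfolding superops_def LinearCombinations.module_hom_def by auto

lemma superops_lin:
  assumes "f \<in> superops A B" "T \<in> carrier (L A)"
  shows "S \<in> carrier (L A) \<Longrightarrow> f (\<lambda>x \<in> carrier A. S x \<oplus>\<^bsub>A\<^esub> T x) = (\<lambda>x \<in> carrier B. f S x \<oplus>\<^bsub>B\<^esub> f T x)"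
    "f (\<lambda>x \<in> carrier A. c \<odot>\<^bsub>A\<^esub> T x) = (\<lambda>x \<in> carrier B. c \<odot>\<^bsub>B\<^esub> f T x)"
  using assms unfolding superops_def LinearCombinations.module_hom_def by auto

lemma superops_opsum:
  assumes A: "fd_hilbert A" and B: "fd_hilbert B" and f: "f \<in> superops A B"
    and fin: "finite I" and T: "\<forall>i\<in>I. T i \<in> carrier (L A)"
  shows "f (opsum A I c T) = opsum B I c (\<lambda>i. f (T i))"
  using fin T
proof (induction I)
  case empty
  \<comment> \<open>The zero operator is 0 times some operator, so homogeneity alone gives that
    \<open>f\<close> maps it to zero.\<close>
  obtain one where one: "one \<in> carrier (L A)" using L_ops_closed(3)[OF A] by blast
  note f1 = superops_simps(1)[OF f one]
  have "opsum A {} c T = (\<lambda>x \<in> carrier A. 0 \<odot>\<^bsub>A\<^esub> one x)"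
    by (rule op_eqI[OF A opsum_closed[OF A] L_ops_closed(2)[OF A one]])
      (use A one in \<open>simp_all add: opsum_ip[OF A]\<close>)
  then have "f (opsum A {} c T) = (\<lambda>x \<in> carrier B. 0 \<odot>\<^bsub>B\<^esub> f one x)"
    using superops_lin(2)[OF f one] by simp
  also have "\<dots> = opsum B {} c (\<lambda>i. f (T i))"
    by (rule op_eqI[OF B L_ops_closed(2)[OF B f1] opsum_closed[OF B]])
      (use B f1 in \<open>simp_all add: opsum_ip[OF B]\<close>)
  finally show ?case .
next
  case (insert j I)
  have Tc: "\<forall>i\<in>insert j I. T i \<in> carrier (L A)" by (rule insert.prems)
  then have Tj: "T j \<in> carrier (L A)" and Ti: "\<forall>i\<in>I. T i \<in> carrier (L A)" by simp_all
  have fj: "f (T j) \<in> carrier (L B)" and fi: "\<forall>i\<in>I. f (T i) \<in> carrier (L B)"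
    and fc: "\<forall>i\<in>insert j I. f (T i) \<in> carrier (L B)"
    using superops_simps(1)[OF f] Tj Ti by simp_all
  let ?s = "\<lambda>x \<in> carrier A. c j \<odot>\<^bsub>A\<^esub> T j x"
  have s: "?s \<in> carrier (L A)" using A Tj by simp
  have o: "opsum A I c T \<in> carrier (L A)" using A Ti by simp
  have "opsum A (insert j I) c T = (\<lambda>x \<in> carrier A. ?s x \<oplus>\<^bsub>A\<^esub> opsum A I c T x)"
    by (rule op_eqI[OF A opsum_closed[OF A Tc] L_ops_closed(1)[OF A s o]])
      (use A Tj Ti Tc o s insert.hyps in \<open>simp_all add: opsum_ip[OF A Tc]\<close>)
  then have "f (opsum A (insert j I) c T) = (\<lambda>x \<in> carrier B. f ?s x \<oplus>\<^bsub>B\<^esub> opsum B I c (\<lambda>i. f (T i)) x)"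
    using superops_lin(1)[OF f o s] insert.IH[OF Ti] by simp
  also have "\<dots> = (\<lambda>x \<in> carrier B. (\<lambda>x \<in> carrier B. c j \<odot>\<^bsub>B\<^esub> f (T j) x) x \<oplus>\<^bsub>B\<^esub> opsum B I c (\<lambda>i. f (T i)) x)"
    using superops_lin(2)[OF f Tj] by simp
  also have "\<dots> = opsum B (insert j I) c (\<lambda>i. f (T i))"
    by (rule op_eqI[OF B L_ops_closed(1)[OF B L_ops_closed(2)[OF B fj] opsum_closed[OF B fi]] opsum_closed[OF B fc]])
      (use B fj fi fc insert.hyps in \<open>simp_all add: opsum_ip[OF B fc]\<close>)
  finally show ?case .
qed

lemma superop_form:
  assumes A: "fd_hilbert A" and B: "fd_hilbert B" and f: "f \<in> superops A B"
    and E: "onb A E" and T: "T \<in> carrier (L A)" and b: "b \<in> carrier B" and c: "c \<in> carrier B"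
  shows "ip B (f T b) c =
    (\<Sum>p\<in>E\<times>E. ip A (T (fst p)) (snd p) * ip B (f (ketbra A (snd p) (fst p)) b) c)"
proof -
  have k: "\<forall>p\<in>E \<times> E. ketbra A (snd p) (fst p) \<in> carrier (L A)"
    using A onb_simps(2)[OF E] by auto
  have "f T = opsum B (E \<times> E) (\<lambda>p. ip A (T (fst p)) (snd p)) (\<lambda>p. f (ketbra A (snd p) (fst p)))"
    using superops_opsum[OF A B f, of "E \<times> E" "\<lambda>p. ketbra A (snd p) (fst p)"] k onb_simps(1)[OF E]
    by (subst op_expand[OF A E T]) simp
  then show ?thesis using B superops_simps(1)[OF f] k b c by simp
qed

lemma superop_eqI:
  assumes A: "fd_hilbert A" and B: "fd_hilbert B" and f: "f \<in> superops A B" and g: "g \<in> superops A B"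
    and E: "onb A E"
    and eq: "\<And>d e b c. d \<in> E \<Longrightarrow> e \<in> E \<Longrightarrow> b \<in> carrier B \<Longrightarrow> c \<in> carrier B \<Longrightarrow>
      ip B (f (ketbra A d e) b) c = ip B (g (ketbra A d e) b) c"
  shows "f = g"
proof (rule extensionalityI[of _ "carrier (L A)"])
  fix T assume T: "T \<in> carrier (L A)"
  show "f T = g T"
    by (rule op_eqI[OF B superops_simps(1)[OF f T] superops_simps(1)[OF g T]])
      (auto simp: superop_form[OF A B f E T] superop_form[OF A B g E T] eq intro!: sum.cong)
qed (rule superops_simps(2)[OF f], rule superops_simps(2)[OF g])

lemma superopsI:
  assumes A: "fd_hilbert A" and B: "fd_hilbert B"
    and cl: "\<And>T. T \<in> carrier (L A) \<Longrightarrow> f T \<in> carrier (L B)" and ext: "f \<in> extensional (carrier (L A))"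
    and add: "\<And>S T b c. S \<in> carrier (L A) \<Longrightarrow> T \<in> carrier (L A) \<Longrightarrow> b \<in> carrier B \<Longrightarrow> c \<in> carrier B \<Longrightarrow>
      ip B (f (\<lambda>x \<in> carrier A. S x \<oplus>\<^bsub>A\<^esub> T x) b) c = ip B (f S b) c + ip B (f T b) c"
    and smult: "\<And>k T b c. T \<in> carrier (L A) \<Longrightarrow> b \<in> carrier B \<Longrightarrow> c \<in> carrier B \<Longrightarrow>
      ip B (f (\<lambda>x \<in> carrier A. k \<odot>\<^bsub>A\<^esub> T x) b) c = k * ip B (f T b) c"
  shows "f \<in> superops A B"
proof -
  have "f (\<lambda>x \<in> carrier A. S x \<oplus>\<^bsub>A\<^esub> T x) = (\<lambda>x \<in> carrier B. f S x \<oplus>\<^bsub>B\<^esub> f T x)"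
    if "S \<in> carrier (L A)" "T \<in> carrier (L A)" for S T
    by (rule op_eqI[OF B]) (use A B that cl add in simp_all)
  moreover have "f (\<lambda>x \<in> carrier A. k \<odot>\<^bsub>A\<^esub> T x) = (\<lambda>x \<in> carrier B. k \<odot>\<^bsub>B\<^esub> f T x)"
    if "T \<in> carrier (L A)" for k T
    by (rule op_eqI[OF B]) (use A B that cl smult in simp_all)
  ultimately show ?thesis
    unfolding superops_def LinearCombinations.module_hom_def using ext cl by auto
qed

lemma superops_compose:
  assumes A: "fd_hilbert A" and B: "fd_hilbert B" and C: "fd_hilbert C"
    and f: "f \<in> superops A B" and g: "g \<in> superops B C"
  shows "compose (carrier (L A)) g f \<in> superops A C"
proof -
  note fs = superops_simps[OF f] superops_lin[OF f]
  note gs = superops_simps[OF g] superops_lin[OF g]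
  show ?thesis
    by (rule superopsI[OF A C]) (use A B C fs gs in \<open>simp_all add: compose_def\<close>)
qed

subsection \<open>Kraus families\<close>

definition some_onb :: "'a hilb \<Rightarrow> 'a set" where
  "some_onb A = (SOME E. onb A E)"

lemma some_onb: "fd_hilbert A \<Longrightarrow> onb A (some_onb A)"
  unfolding some_onb_def by (metis onb_exists someI_ex)

text \<open>The map \<open>T \<mapsto> \<Sum>\<^sub>i K\<^sub>i T K\<^sub>i\<^sup>*\<close>, written without adjoints.\<close>

definition kmap :: "'a hilb \<Rightarrow> 'a hilb \<Rightarrow> 'i set \<Rightarrow> ('i \<Rightarrow> 'a \<Rightarrow> 'a) \<Rightarrow> ('a \<Rightarrow> 'a) \<Rightarrow> 'a \<Rightarrow> 'a" where
  "kmap A B I K = (\<lambda>T \<in> carrier (L A). \<lambda>z \<in> carrier B.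
     finsum B (\<lambda>p. ip B z (K (fst p) (snd p)) \<odot>\<^bsub>B\<^esub> K (fst p) (T (snd p))) (I \<times> some_onb A))"

text \<open>The coefficient of the summand comes from <K_i^* z, e> = <z, K_i e>, that is, from
  expanding K_i^* z in \<open>some_onb A\<close>.\<close>

lemma kmap_form:
  assumes A: "fd_hilbert A" and B: "fd_hilbert B" and K: "\<forall>i\<in>I. K i \<in> lin A B"
    and T: "T \<in> carrier (L A)"
  shows "kmap A B I K T \<in> carrier (L B)"
    "z \<in> carrier B \<Longrightarrow> w \<in> carrier B \<Longrightarrow> ip B (kmap A B I K T z) w =
      (\<Sum>p\<in>I \<times> some_onb A. ip B z (K (fst p) (snd p)) * ip B (K (fst p) (T (snd p))) w)"
proof -
  have c: "K (fst p) (snd p) \<in> carrier B" "K (fst p) (T (snd p)) \<in> carrier B" if "p \<in> I \<times> some_onb A" for p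
  proof -
    have "K (fst p) \<in> lin A B" "snd p \<in> carrier A" using that K onb_simps(2)[OF some_onb[OF A]] by auto
    then show "K (fst p) (snd p) \<in> carrier B" "K (fst p) (T (snd p)) \<in> carrier B"
      using T by (simp_all add: lin_simps(1)[of "K (fst p)" A B])
  qed
  show "kmap A B I K T \<in> carrier (L B)"
    unfolding kmap_def using T
    by (simp, intro L_restrict[OF B] linI_ip[OF B B])
      (use A B c in \<open>simp_all add: sum.distrib algebra_simps sum_distrib_left\<close>)
  show "z \<in> carrier B \<Longrightarrow> w \<in> carrier B \<Longrightarrow> ip B (kmap A B I K T z) w =
      (\<Sum>p\<in>I \<times> some_onb A. ip B z (K (fst p) (snd p)) * ip B (K (fst p) (T (snd p))) w)"
    unfolding kmap_def using T B c by simp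
qed

lemma kmap_superop:
  assumes A: "fd_hilbert A" and B: "fd_hilbert B" and K: "\<forall>i\<in>I. K i \<in> lin A B"
  shows "kmap A B I K \<in> superops A B"
proof (rule superopsI[OF A B kmap_form(1)[OF A B K]])
  have e: "snd p \<in> carrier A" and ks: "K (fst p) \<in> lin A B" if "p \<in> I \<times> some_onb A" for p
    using that onb_simps(2)[OF some_onb[OF A]] K by auto
  note ks = lin_simps[OF ks]
  show "kmap A B I K \<in> extensional (carrier (L A))" unfolding kmap_def by simp
  fix S T b c assume S: "S \<in> carrier (L A)" and T: "T \<in> carrier (L A)" and bc: "b \<in> carrier B" "c \<in> carrier B"
  have ST: "(\<lambda>x \<in> carrier A. S x \<oplus>\<^bsub>A\<^esub> T x) \<in> carrier (L A)" using A S T by simp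
  show "ip B (kmap A B I K (\<lambda>x \<in> carrier A. S x \<oplus>\<^bsub>A\<^esub> T x) b) c =
    ip B (kmap A B I K S b) c + ip B (kmap A B I K T b) c"
    unfolding kmap_form(2)[OF A B K ST bc] kmap_form(2)[OF A B K S bc] kmap_form(2)[OF A B K T bc]
    unfolding sum.distrib[symmetric]
    by (rule sum.cong) (use A B S T e ks bc in \<open>simp_all add: algebra_simps\<close>)
next
  have e: "snd p \<in> carrier A" and ks: "K (fst p) \<in> lin A B" if "p \<in> I \<times> some_onb A" for p
    using that onb_simps(2)[OF some_onb[OF A]] K by auto
  note ks = lin_simps[OF ks]
  fix r T b c assume T: "T \<in> carrier (L A)" and bc: "b \<in> carrier B" "c \<in> carrier B"
  have rT: "(\<lambda>x \<in> carrier A. r \<odot>\<^bsub>A\<^esub> T x) \<in> carrier (L A)" using A T by simp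
  show "ip B (kmap A B I K (\<lambda>x \<in> carrier A. r \<odot>\<^bsub>A\<^esub> T x) b) c = r * ip B (kmap A B I K T b) c"
    unfolding kmap_form(2)[OF A B K rT bc] kmap_form(2)[OF A B K T bc]
    unfolding sum_distrib_left
    by (rule sum.cong) (use A B T e ks bc in \<open>simp_all add: algebra_simps\<close>)
qed

lemma lin_onb_right:
  assumes A: "fd_hilbert A" and B: "fd_hilbert B" and K: "K \<in> lin A B" and E: "onb A E"
    and x: "x \<in> carrier A" and z: "z \<in> carrier B"
  shows "ip B z (K x) = (\<Sum>e\<in>E. ip A e x * ip B z (K e))"
proof -
  have "ip B z (K x) = cnj (ip B (K x) z)" using ip_cnj[OF B] lin_simps(1)[OF K x] z by simp
  also have "\<dots> = (\<Sum>e\<in>E. cnj (ip A x e) * cnj (ip B (K e) z))"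
    unfolding lin_onb[OF A B K E x z] by simp
  also have "\<dots> = (\<Sum>e\<in>E. ip A e x * ip B z (K e))"
    by (rule sum.cong) (use ip_cnj[OF A x] ip_cnj[OF B _ z] lin_simps(1)[OF K] onb_simps(2)[OF E] in auto)
  finally show ?thesis .
qed

text \<open>K |x><y| K^* = |K x><K y|, so the auxiliary basis drops out. Equalities of Kraus maps
  are proved through this formula.\<close>

lemma kmap_ketbra:
  assumes A: "fd_hilbert A" and B: "fd_hilbert B" and K: "\<forall>i\<in>I. K i \<in> lin A B"
    and x: "x \<in> carrier A" and y: "y \<in> carrier A" and z: "z \<in> carrier B" and w: "w \<in> carrier B"
  shows "ip B (kmap A B I K (ketbra A x y) z) w = (\<Sum>i\<in>I. ip B z (K i y) * ip B (K i x) w)"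
proof -
  let ?E = "some_onb A"
  note E = some_onb[OF A]
  have k: "ketbra A x y \<in> carrier (L A)" using A x y by simp
  have "ip B (kmap A B I K (ketbra A x y) z) w =
      (\<Sum>i\<in>I. \<Sum>e\<in>?E. ip B z (K i e) * ip B (K i (ketbra A x y e)) w)"
    unfolding kmap_form(2)[OF A B K k z w] by (simp add: sum.cartesian_product split_beta)
  also have "\<dots> = (\<Sum>i\<in>I. \<Sum>e\<in>?E. (ip A e y * ip B z (K i e)) * ip B (K i x) w)"
    by (intro sum.cong refl)
      (use A B onb_simps(2)[OF E] x y w K in \<open>simp add: ketbra_def lin_simps(3)[where A=A and B=B] lin_simps(1)[where A=A and B=B]\<close>)
  also have "\<dots> = (\<Sum>i\<in>I. ip B z (K i y) * ip B (K i x) w)"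
    by (intro sum.cong refl) (simp add: lin_onb_right[OF A B bspec[OF K] E y z] sum_distrib_right)
  finally show ?thesis .
qed

lemma eq_kmapI:
  assumes A: "fd_hilbert A" and B: "fd_hilbert B" and K: "\<forall>i\<in>I. K i \<in> lin A B"
    and f: "f \<in> superops A B" and E: "onb A E"
    and eq: "\<And>x y z w. x \<in> E \<Longrightarrow> y \<in> E \<Longrightarrow> z \<in> carrier B \<Longrightarrow> w \<in> carrier B \<Longrightarrow>
      ip B (f (ketbra A x y) z) w = (\<Sum>i\<in>I. ip B z (K i y) * ip B (K i x) w)"
  shows "f = kmap A B I K"
  by (rule superop_eqI[OF A B f kmap_superop[OF A B K] E])
    (auto simp: eq kmap_ketbra[OF A B K] onb_simps(2)[OF E])

text \<open>The index sets may differ, so this is the rule for replacing one Kraus family by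
  another.\<close>

lemma kmap_eqI:
  assumes A: "fd_hilbert A" and B: "fd_hilbert B" and K: "\<forall>i\<in>I. K i \<in> lin A B"
    and M: "\<forall>j\<in>J. M j \<in> lin A B"
    and eq: "\<And>x y z w. x \<in> carrier A \<Longrightarrow> y \<in> carrier A \<Longrightarrow> z \<in> carrier B \<Longrightarrow> w \<in> carrier B \<Longrightarrow>
      (\<Sum>i\<in>I. ip B z (K i y) * ip B (K i x) w) = (\<Sum>j\<in>J. ip B z (M j y) * ip B (M j x) w)"
  shows "kmap A B I K = kmap A B J M"
  by (rule eq_kmapI[OF A B M kmap_superop[OF A B K] some_onb[OF A]])
    (auto simp: eq kmap_ketbra[OF A B K] onb_simps(2)[OF some_onb[OF A]])

lemma kmap_cong:
  assumes A: "fd_hilbert A" and B: "fd_hilbert B" and K: "\<forall>i\<in>I. K i \<in> lin A B"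
    and M: "\<forall>i\<in>I. M i \<in> lin A B"
    and eq: "\<And>i x. i \<in> I \<Longrightarrow> x \<in> carrier A \<Longrightarrow> K i x = M i x"
  shows "kmap A B I K = kmap A B I M"
  by (rule kmap_eqI[OF A B K M]) (auto simp: eq intro!: sum.cong)

text \<open>The inner map sends |x><y| to the sum of the operators |K_i x><K_i y|, to which the
  outer map applies termwise.\<close>

lemma kmap_comp:
  assumes A: "fd_hilbert A" and B: "fd_hilbert B" and C: "fd_hilbert C"
    and K: "\<forall>i\<in>I. K i \<in> lin A B" and M: "\<forall>j\<in>J. M j \<in> lin B C" and fin: "finite I"
  shows "compose (carrier (L A)) (kmap B C J M) (kmap A B I K) =
    kmap A C (J \<times> I) (\<lambda>p x. M (fst p) (K (snd p) x))"
proof (rule eq_kmapI[OF A C _ superops_compose[OF A B C kmap_superop[OF A B K] kmap_superop[OF B C M]] some_onb[OF A]])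
  show "\<forall>p\<in>J \<times> I. (\<lambda>x. M (fst p) (K (snd p) x)) \<in> lin A C"
    by (rule ballI, rule lin_comp[of _ A B]) (use K M in auto)
  fix x y z w assume "x \<in> some_onb A" "y \<in> some_onb A" and zw: "z \<in> carrier C" "w \<in> carrier C"
  then have xy: "x \<in> carrier A" "y \<in> carrier A" using onb_simps(2)[OF some_onb[OF A]] by auto
  have Kc: "K i x \<in> carrier B" "K i y \<in> carrier B" if "i \<in> I" for i using lin_simps(1)[OF bspec[OF K that]] xy by auto
  have kc: "\<forall>i\<in>I. ketbra B (K i x) (K i y) \<in> carrier (L B)" using B Kc by simp
  have k: "ketbra A x y \<in> carrier (L A)" using A xy by simp
  have "kmap A B I K (ketbra A x y) = opsum B I (\<lambda>_. 1) (\<lambda>i. ketbra B (K i x) (K i y))"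
    by (rule op_eqI[OF B kmap_form(1)[OF A B K k]]) (use B kc Kc in \<open>simp_all add: kmap_ketbra[OF A B K xy]\<close>)
  then have "kmap B C J M (kmap A B I K (ketbra A x y)) =
      opsum C I (\<lambda>_. 1) (\<lambda>i. kmap B C J M (ketbra B (K i x) (K i y)))"
    using superops_opsum[OF B C kmap_superop[OF B C M] fin kc] by simp
  then have "ip C (compose (carrier (L A)) (kmap B C J M) (kmap A B I K) (ketbra A x y) z) w =
      (\<Sum>i\<in>I. ip C (kmap B C J M (ketbra B (K i x) (K i y)) z) w)"
    using C k kmap_form(1)[OF B C M] kc zw by (simp add: compose_def)
  also have "\<dots> = (\<Sum>i\<in>I. \<Sum>j\<in>J. ip C z (M j (K i y)) * ip C (M j (K i x)) w)"
    by (rule sum.cong) (use kmap_ketbra[OF B C M Kc zw] in auto)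
  also have "\<dots> = (\<Sum>j\<in>J. \<Sum>i\<in>I. ip C z (M j (K i y)) * ip C (M j (K i x)) w)" by (rule sum.swap)
  also have "\<dots> = (\<Sum>p\<in>J \<times> I. ip C z (M (fst p) (K (snd p) y)) * ip C (M (fst p) (K (snd p) x)) w)"
    by (simp add: sum.cartesian_product split_beta)
  finally show "ip C (compose (carrier (L A)) (kmap B C J M) (kmap A B I K) (ketbra A x y) z) w = \<dots>" .
qed

lemma super_id_kmap:
  assumes A: "fd_hilbert A"
  shows "super_id A = kmap A A {()} (\<lambda>_ x. x)" "super_id A \<in> superops A A"
proof -
  show id: "super_id A \<in> superops A A"
    by (rule superopsI[OF A A]) (use A in \<open>simp_all add: super_id_def\<close>)
  show "super_id A = kmap A A {()} (\<lambda>_ x. x)"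
    by (rule eq_kmapI[OF A A _ id some_onb[OF A]])
      (use A lin_id onb_simps(2)[OF some_onb[OF A]] in \<open>simp_all add: super_id_def\<close>)
qed

subsection \<open>Tensor products of operators and superoperators\<close>

lemma tensor_vec_eqI:
  assumes A: "fd_hilbert A" and B: "fd_hilbert B"
    and x: "x \<in> carrier (tspace A B)" and y: "y \<in> carrier (tspace A B)"
    and eq: "\<And>a b. a \<in> carrier A \<Longrightarrow> b \<in> carrier B \<Longrightarrow>
      ip (tspace A B) x (tvec A B a b) = ip (tspace A B) y (tvec A B a b)"
  shows "x = y"
proof (rule ip_eqI[OF tspace_simps(1)[OF A B] x y])
  note E = some_onb[OF A] and F = some_onb[OF B]
  fix z assume z: "z \<in> carrier (tspace A B)"
  show "ip (tspace A B) x z = ip (tspace A B) y z"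
    unfolding tensor_ip[OF A B E F x z] tensor_ip[OF A B E F y z]
    by (intro sum.cong refl) (simp add: eq onb_simps(2)[OF E] onb_simps(2)[OF F])
qed

lemma tensor_op_eqI:
  assumes A: "fd_hilbert A" and B: "fd_hilbert B"
    and S: "S \<in> carrier (L (tspace A B))" and T: "T \<in> carrier (L (tspace A B))"
    and eq: "\<And>a b a' b'. a \<in> carrier A \<Longrightarrow> b \<in> carrier B \<Longrightarrow> a' \<in> carrier A \<Longrightarrow> b' \<in> carrier B \<Longrightarrow>
      ip (tspace A B) (S (tvec A B a b)) (tvec A B a' b') = ip (tspace A B) (T (tvec A B a b)) (tvec A B a' b')"
  shows "S = T"
proof (rule extensionalityI[of _ "carrier (tspace A B)"])
  show "S x = T x" if "x \<in> carrier (tspace A B)" for x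
    by (rule lin_tensor_eqI[OF A B _ L_lin[OF S] L_lin[OF T] _ that])
      (use A B S T eq in \<open>auto intro!: tensor_vec_eqI[OF A B]\<close>)
qed (use S T in \<open>auto simp: L_iff\<close>)

text \<open>Justifies the definite description: the restriction of \<open>tmap\<close> to the
  carrier exists, and values on product vectors leave no freedom.\<close>

lemma tensor_op:
  assumes A: "fd_hilbert A" and B: "fd_hilbert B" and S: "S \<in> carrier (L A)" and T: "T \<in> carrier (L B)"
  shows "tensor_op A B S T \<in> carrier (L (tspace A B))"
    and "a \<in> carrier A \<Longrightarrow> b \<in> carrier B \<Longrightarrow> tensor_op A B S T (tvec A B a b) = tvec A B (S a) (T b)"
proof -
  let ?P = "\<lambda>R. R \<in> carrier (L (tspace A B)) \<and>
     (\<forall>a \<in> carrier A. \<forall>b \<in> carrier B. R (tvec A B a b) = tvec A B (S a) (T b))"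
  note t = tmap[OF A B A B L_lin[OF S] L_lin[OF T]]
  have "\<exists>!R. ?P R"
  proof (rule ex1I[of _ "\<lambda>x \<in> carrier (tspace A B). tmap A B A B S T x"])
    show "?P (\<lambda>x \<in> carrier (tspace A B). tmap A B A B S T x)"
      using A B t(2) L_restrict[OF _ t(1)] by simp
    then show "R = (\<lambda>x \<in> carrier (tspace A B). tmap A B A B S T x)" if "?P R" for R
      using that by (intro tensor_op_eqI[OF A B]) simp_all
  qed
  from theI'[OF this, folded tensor_op_def]
  show "tensor_op A B S T \<in> carrier (L (tspace A B))"
    and "a \<in> carrier A \<Longrightarrow> b \<in> carrier B \<Longrightarrow> tensor_op A B S T (tvec A B a b) = tvec A B (S a) (T b)"
    by blast+
qed

lemma tensor_op_ketbra:
  assumes A: "fd_hilbert A" and B: "fd_hilbert B"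
    and xy: "x \<in> carrier A" "y \<in> carrier A" "x' \<in> carrier B" "y' \<in> carrier B"
  shows "tensor_op A B (ketbra A x y) (ketbra B x' y') = ketbra (tspace A B) (tvec A B x x') (tvec A B y y')"
proof -
  have k: "ketbra A x y \<in> carrier (L A)" "ketbra B x' y' \<in> carrier (L B)" using A B xy by simp_all
  note t = tensor_op[OF A B k]
  show ?thesis
    by (rule tensor_op_eqI[OF A B t(1)]) (use A B xy k in \<open>simp_all add: t(2)\<close>)
qed

text \<open>Justifies the definite description. Existence: an operator on the product is expanded in
  products of matrix units, whose images are forced. Uniqueness: the matrix units of a product basis
  are such products, by \<open>tensor_op_ketbra\<close>.\<close>

lemma tensor_super:
  assumes A: "fd_hilbert A" and B: "fd_hilbert B" and A': "fd_hilbert A'" and B': "fd_hilbert B'"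
    and f: "f \<in> superops A B" and g: "g \<in> superops A' B'"
  shows "tensor_super A B A' B' f g \<in> superops (tspace A A') (tspace B B')" (is ?c)
    and "\<And>S T. S \<in> carrier (L A) \<Longrightarrow> T \<in> carrier (L A') \<Longrightarrow>
      tensor_super A B A' B' f g (tensor_op A A' S T) = tensor_op B B' (f S) (g T)"
proof -
  let ?T = "tspace A A'" and ?U = "tspace B B'"
  let ?P = "\<lambda>h. h \<in> superops ?T ?U \<and> (\<forall>S \<in> carrier (L A). \<forall>T \<in> carrier (L A').
        h (tensor_op A A' S T) = tensor_op B B' (f S) (g T))"
  define E E' where "E = some_onb A" and "E' = some_onb A'"
  have E: "onb A E" and E': "onb A' E'"
    unfolding E_def E'_def using some_onb A A' by auto
  note Es = onb_simps(2)[OF E] onb_simps(2)[OF E']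
  have T: "fd_hilbert ?T" and U: "fd_hilbert ?U" using A A' B B' by simp_all
  let ?I = "(E \<times> E) \<times> (E' \<times> E')"
  define k where "k p = ketbra A (snd p) (fst p)" for p
  define k' where "k' p = ketbra A' (snd p) (fst p)" for p
  have kc: "k p \<in> carrier (L A)" if "p \<in> E \<times> E" for p unfolding k_def using A Es that by auto
  have kc': "k' p \<in> carrier (L A')" if "p \<in> E' \<times> E'" for p unfolding k'_def using A' Es that by auto
  have pc: "fst p \<in> carrier A" "snd p \<in> carrier A" if "p \<in> E \<times> E" for p using Es that by auto
  have pc': "fst p \<in> carrier A'" "snd p \<in> carrier A'" if "p \<in> E' \<times> E'" for p using Es that by auto
  define W where "W i = tensor_op B B' (f (k (fst i))) (g (k' (snd i)))" for i
  have Wc: "\<forall>i\<in>?I. W i \<in> carrier (L ?U)"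
    unfolding W_def using kc kc' by (intro ballI tensor_op(1)[OF B B' superops_simps(1)[OF f] superops_simps(1)[OF g]]) auto
  \<comment> \<open>A matrix entry of \<open>R\<close> between product vectors; \<open>W i\<close>
    is the prescribed image of the matching product of matrix units.\<close>
  define co where "co R i = ip ?T (R (tvec A A' (fst (fst i)) (fst (snd i)))) (tvec A A' (snd (fst i)) (snd (snd i)))"
    for R and i :: "(complex vec \<times> complex vec) \<times> (complex vec \<times> complex vec)"
  define h where "h = (\<lambda>R \<in> carrier (L ?T). opsum ?U ?I (co R) W)"
  have tc: "tvec A A' (fst (fst i)) (fst (snd i)) \<in> carrier ?T" "tvec A A' (snd (fst i)) (snd (snd i)) \<in> carrier ?T"
    if "i \<in> ?I" for i using that A A' Es by auto
  have h: "h \<in> superops ?T ?U"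
  proof (rule superopsI[OF T U])
    fix S R b c assume *: "S \<in> carrier (L ?T)" "R \<in> carrier (L ?T)" and bc: "b \<in> carrier ?U" "c \<in> carrier ?U"
    have o: "ip ?U (opsum ?U ?I a W b) c = (\<Sum>i\<in>?I. a i * ip ?U (W i b) c)" for a
      by (rule opsum_ip[OF U Wc bc])
    have hX: "h X = opsum ?U ?I (co X) W" if "X \<in> carrier (L ?T)" for X unfolding h_def using that by simp
    have "co (\<lambda>x \<in> carrier ?T. S x \<oplus>\<^bsub>?T\<^esub> R x) i = co S i + co R i" if "i \<in> ?I" for i
      unfolding co_def using T * tc[OF that] by simp
    then show "ip ?U (h (\<lambda>x \<in> carrier ?T. S x \<oplus>\<^bsub>?T\<^esub> R x) b) c = ip ?U (h S b) c + ip ?U (h R b) c"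
      unfolding hX[OF *(1)] hX[OF *(2)] hX[OF L_ops_closed(1)[OF T *]] o sum.distrib[symmetric]
      by (intro sum.cong refl) (simp add: algebra_simps)
    have "co (\<lambda>x \<in> carrier ?T. r \<odot>\<^bsub>?T\<^esub> R x) i = r * co R i" if "i \<in> ?I" for i r
      unfolding co_def using T * tc[OF that] by simp
    then show "ip ?U (h (\<lambda>x \<in> carrier ?T. r \<odot>\<^bsub>?T\<^esub> R x) b) c = r * ip ?U (h R b) c" for r
      unfolding hX[OF *(2)] hX[OF L_ops_closed(2)[OF T *(2)]] o sum_distrib_left
      by (intro sum.cong refl) (simp add: algebra_simps)
  qed (use U Wc in \<open>simp_all add: h_def\<close>)
  have hp: "h (tensor_op A A' S R) = tensor_op B B' (f S) (g R)"
    if S: "S \<in> carrier (L A)" and R: "R \<in> carrier (L A')" for S R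
  proof (rule tensor_op_eqI[OF B B'])
    note t = tensor_op[OF A A' S R]
    show "h (tensor_op A A' S R) \<in> carrier (L ?U)" using superops_simps(1)[OF h t(1)] .
    show "tensor_op B B' (f S) (g R) \<in> carrier (L ?U)"
      by (rule tensor_op(1)[OF B B' superops_simps(1)[OF f S] superops_simps(1)[OF g R]])
    fix b b' c c' assume b: "b \<in> carrier B" "b' \<in> carrier B'" "c \<in> carrier B" "c' \<in> carrier B'"
    have bc: "tvec B B' b b' \<in> carrier ?U" "tvec B B' c c' \<in> carrier ?U" using B B' b by simp_all
    have "ip ?U (h (tensor_op A A' S R) (tvec B B' b b')) (tvec B B' c c') =
      (\<Sum>i\<in>?I. co (tensor_op A A' S R) i * ip ?U (W i (tvec B B' b b')) (tvec B B' c c'))"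
      unfolding h_def using t(1) by (simp add: opsum_ip[OF U Wc bc])
    also have "\<dots> = (\<Sum>i\<in>?I. (ip A (S (fst (fst i))) (snd (fst i)) * ip B (f (k (fst i)) b) c) *
       (ip A' (R (fst (snd i))) (snd (snd i)) * ip B' (g (k' (snd i)) b') c'))"
    proof (rule sum.cong[OF refl])
      fix i assume i: "i \<in> ?I"
      have i1: "fst i \<in> E \<times> E" and i2: "snd i \<in> E' \<times> E'" using i by auto
      note fk = superops_simps(1)[OF f kc[OF i1]] and gk = superops_simps(1)[OF g kc'[OF i2]]
      show "co (tensor_op A A' S R) i * ip ?U (W i (tvec B B' b b')) (tvec B B' c c') =
        (ip A (S (fst (fst i))) (snd (fst i)) * ip B (f (k (fst i)) b) c) *
       (ip A' (R (fst (snd i))) (snd (snd i)) * ip B' (g (k' (snd i)) b') c')"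
        unfolding co_def W_def using pc[OF i1] pc'[OF i2] A A' B B' S R b fk gk
        by (simp add: t(2) tensor_op(2)[OF B B' fk gk])
    qed
    also have "\<dots> = (\<Sum>p\<in>E\<times>E. ip A (S (fst p)) (snd p) * ip B (f (k p) b) c) *
       (\<Sum>q\<in>E'\<times>E'. ip A' (R (fst q)) (snd q) * ip B' (g (k' q) b') c')"
      unfolding sum_product sum.cartesian_product by (rule sum.cong) auto
    also have "\<dots> = ip B (f S b) c * ip B' (g R b') c'"
      unfolding k_def k'_def superop_form[OF A B f E S b(1,3)] superop_form[OF A' B' g E' R b(2,4)] ..
    also have "\<dots> = ip ?U (tensor_op B B' (f S) (g R) (tvec B B' b b')) (tvec B B' c c')"
      using B B' b superops_simps(1)[OF f S] superops_simps(1)[OF g R]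
      by (simp add: tensor_op(2)[OF B B' superops_simps(1)[OF f S] superops_simps(1)[OF g R]])
    finally show "ip ?U (h (tensor_op A A' S R) (tvec B B' b b')) (tvec B B' c c') = \<dots>" .
  qed
  have "\<exists>!h. ?P h"
  proof (rule ex1I[of _ h])
    show "?P h" using h hp by blast
    fix h' assume h': "?P h'"
    show "h' = h"
    proof (rule superop_eqI[OF T U _ h tbasis_onb[OF A A' E E']])
      show "h' \<in> superops ?T ?U" using h' by blast
      fix d e b c assume "d \<in> tbasis A A' E E'" "e \<in> tbasis A A' E E'"
      then obtain p q p' q' where d: "d = tvec A A' p p'" and e: "e = tvec A A' q q'"
        and c: "p \<in> carrier A" "q \<in> carrier A" "p' \<in> carrier A'" "q' \<in> carrier A'"
        unfolding tbasis_def using Es by auto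
      have "h' (ketbra ?T d e) = h (ketbra ?T d e)"
        unfolding d e tensor_op_ketbra[OF A A' c, symmetric]
        using h' hp A A' c by simp
      then show "ip ?U (h' (ketbra ?T d e) b) c = ip ?U (h (ketbra ?T d e) b) c" for b c by simp
    qed
  qed
  from theI'[OF this, folded tensor_super_def]
  show ?c and "\<And>S T. S \<in> carrier (L A) \<Longrightarrow> T \<in> carrier (L A') \<Longrightarrow>
      tensor_super A B A' B' f g (tensor_op A A' S T) = tensor_op B B' (f S) (g T)" by blast+
qed

text \<open>On a matrix unit of a product basis both sides factor into a part for \<open>A\<close>
  and a part for \<open>A'\<close>, and the sum over \<open>I \<times> J\<close> is the product of
  the two sums.\<close>

lemma tensor_super_kmap:
  assumes A: "fd_hilbert A" and B: "fd_hilbert B" and A': "fd_hilbert A'" and B': "fd_hilbert B'"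
    and K: "\<forall>i\<in>I. K i \<in> lin A B" and M: "\<forall>j\<in>J. M j \<in> lin A' B'"
  shows "tensor_super A B A' B' (kmap A B I K) (kmap A' B' J M) =
    kmap (tspace A A') (tspace B B') (I \<times> J) (\<lambda>p. tmap A A' B B' (K (fst p)) (M (snd p)))"
proof -
  let ?T = "tspace A A'" and ?U = "tspace B B'"
  have T: "fd_hilbert ?T" and U: "fd_hilbert ?U" using A A' B B' by simp_all
  let ?h = "tensor_super A B A' B' (kmap A B I K) (kmap A' B' J M)"
  let ?k = "kmap ?T ?U (I \<times> J) (\<lambda>p. tmap A A' B B' (K (fst p)) (M (snd p)))"
  note h = tensor_super[OF A B A' B' kmap_superop[OF A B K] kmap_superop[OF A' B' M]]
  note E = some_onb[OF A] and E' = some_onb[OF A']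
  have l: "\<forall>p\<in>I \<times> J. tmap A A' B B' (K (fst p)) (M (snd p)) \<in> lin ?T ?U"
    by (intro ballI tmap(1)[OF A A' B B']) (use K M in auto)
  show ?thesis
  proof (rule superop_eqI[OF T U h(1) kmap_superop[OF T U l] tbasis_onb[OF A A' E E']])
    fix d e b c assume "d \<in> tbasis A A' (some_onb A) (some_onb A')" "e \<in> tbasis A A' (some_onb A) (some_onb A')"
    then obtain p q p' q' where d: "d = tvec A A' p p'" and e: "e = tvec A A' q q'"
      and m: "p \<in> carrier A" "q \<in> carrier A" "p' \<in> carrier A'" "q' \<in> carrier A'"
      unfolding tbasis_def using onb_simps(2)[OF E] onb_simps(2)[OF E'] by auto
    have k: "ketbra A p q \<in> carrier (L A)" "ketbra A' p' q' \<in> carrier (L A')" using A A' m by simp_all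
    have de: "d \<in> carrier ?T" "e \<in> carrier ?T" unfolding d e using A A' m by simp_all
    have ke: "ketbra ?T d e \<in> carrier (L ?T)" using T de by simp
    have kk: "kmap A B I K (ketbra A p q) \<in> carrier (L B)" "kmap A' B' J M (ketbra A' p' q') \<in> carrier (L B')"
      using kmap_form(1)[OF A B K k(1)] kmap_form(1)[OF A' B' M k(2)] by simp_all
    have hk: "?h (ketbra ?T d e) = tensor_op B B' (kmap A B I K (ketbra A p q)) (kmap A' B' J M (ketbra A' p' q'))"
      unfolding d e tensor_op_ketbra[OF A A' m, symmetric] by (rule h(2)[OF k])
    have "?h (ketbra ?T d e) = ?k (ketbra ?T d e)"
    proof (rule tensor_op_eqI[OF B B' superops_simps(1)[OF h(1) ke] kmap_form(1)[OF T U l ke]])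
      fix b b' c c' assume b: "b \<in> carrier B" "b' \<in> carrier B'" "c \<in> carrier B" "c' \<in> carrier B'"
      have bc: "tvec B B' b b' \<in> carrier ?U" "tvec B B' c c' \<in> carrier ?U" using B B' b by simp_all
      have "ip ?U (?h (ketbra ?T d e) (tvec B B' b b')) (tvec B B' c c') =
        (\<Sum>i\<in>I. ip B b (K i q) * ip B (K i p) c) * (\<Sum>j\<in>J. ip B' b' (M j q') * ip B' (M j p') c')"
        unfolding hk tensor_op(2)[OF B B' kk b(1,2)]
        using B B' b kk kmap_ketbra[OF A B K m(1,2) b(1,3)] kmap_ketbra[OF A' B' M m(3,4) b(2,4)] by simp
      also have "\<dots> = (\<Sum>r\<in>I\<times>J. ip ?U (tvec B B' b b') (tmap A A' B B' (K (fst r)) (M (snd r)) e) *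
         ip ?U (tmap A A' B B' (K (fst r)) (M (snd r)) d) (tvec B B' c c'))"
        unfolding sum_product sum.cartesian_product
      proof (rule sum.cong[OF refl], clarify)
        fix i j assume ij: "i \<in> I" "j \<in> J"
        note Kl = bspec[OF K ij(1)] and Ml = bspec[OF M ij(2)]
        note Ki = lin_simps(1)[OF Kl] and Mj = lin_simps(1)[OF Ml]
        note tm = tmap(2)[OF A A' B B' Kl Ml]
        show "ip B b (K i q) * ip B (K i p) c * (ip B' b' (M j q') * ip B' (M j p') c') =
         ip ?U (tvec B B' b b') (tmap A A' B B' (K (fst (i, j))) (M (snd (i, j))) e) *
         ip ?U (tmap A A' B B' (K (fst (i, j))) (M (snd (i, j))) d) (tvec B B' c c')"
          unfolding d e fst_conv snd_conv tm[OF m(1,3)] tm[OF m(2,4)] using B B' b m Ki Mj by simp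
      qed
      also have "\<dots> = ip ?U (?k (ketbra ?T d e) (tvec B B' b b')) (tvec B B' c c')"
        by (rule kmap_ketbra[OF T U l de bc, symmetric])
      finally show "ip ?U (?h (ketbra ?T d e) (tvec B B' b b')) (tvec B B' c c') = \<dots>" .
    qed
    then show "ip ?U (?h (ketbra ?T d e) b) c = ip ?U (?k (ketbra ?T d e) b) c" by simp
  qed
qed

subsection \<open>Positive operators and complete positivity\<close>

lemma complex_nonneg_iff: "0 \<le> z \<longleftrightarrow> 0 \<le> Re z \<and> Im z = 0" for z :: complex
  by (auto simp: less_eq_complex_def)

text \<open>Cholesky decomposition. If the pivot \<open>M a a\<close> vanishes, so does its row, and the divisions by
  zero below return the right value \<open>0\<close>.\<close>

lemma psd_decomposition:
  fixes M :: "'a \<Rightarrow> 'a \<Rightarrow> complex"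
  assumes "finite E" and "\<And>c. 0 \<le> (\<Sum>e\<in>E. \<Sum>e'\<in>E. c e * cnj (c e') * M e e')"
  shows "\<exists>w :: 'a \<Rightarrow> 'a \<Rightarrow> complex. \<forall>e\<in>E. \<forall>e'\<in>E. M e e' = (\<Sum>k\<in>E. w k e * cnj (w k e'))"
  using assms
proof (induction E arbitrary: M)
  case (insert a F)
  note fin = insert.hyps(1) and aF = insert.hyps(2)
  have exp: "(\<Sum>e\<in>insert a F. \<Sum>e'\<in>insert a F. c e * cnj (c e') * M e e') =
      c a * cnj (c a) * M a a + c a * (\<Sum>e\<in>F. cnj (c e) * M a e) + cnj (c a) * (\<Sum>e\<in>F. c e * M e a)
      + (\<Sum>e\<in>F. \<Sum>e'\<in>F. c e * cnj (c e') * M e e')" for c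
    using fin aF by (simp add: sum.distrib sum_distrib_left algebra_simps)
  \<comment> \<open>Evaluates the form at the vector with entries x at a and y at e only. Special
    values of x and y below extract reality, hermitian symmetry and the vanishing row.\<close>
  have two: "0 \<le> x * cnj x * M a a + x * cnj y * M a e + cnj x * y * M e a + y * cnj y * M e e"
    if e: "e \<in> F" for x y e
  proof -
    let ?c = "\<lambda>i. if i = a then x else if i = e then y else 0"
    have ne: "i \<noteq> a" if "i \<in> F" for i using that aF by auto
    have 1: "(\<Sum>i\<in>F. cnj (?c i) * M a i) = cnj y * M a e"
    proof -
      have "(\<Sum>i\<in>F. cnj (?c i) * M a i) = (\<Sum>i\<in>F. if i = e then cnj y * M a i else 0)"
        by (rule sum.cong) (use ne in auto)
      then show ?thesis using fin e by simp
    qed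
    have 2: "(\<Sum>i\<in>F. ?c i * M i a) = y * M e a"
    proof -
      have "(\<Sum>i\<in>F. ?c i * M i a) = (\<Sum>i\<in>F. if i = e then y * M i a else 0)"
        by (rule sum.cong) (use ne in auto)
      then show ?thesis using fin e by simp
    qed
    have 3: "(\<Sum>i\<in>F. \<Sum>j\<in>F. ?c i * cnj (?c j) * M i j) = y * cnj y * M e e"
    proof -
      have "(\<Sum>i\<in>F. \<Sum>j\<in>F. ?c i * cnj (?c j) * M i j) =
          (\<Sum>i\<in>F. if i = e then \<Sum>j\<in>F. if j = e then y * cnj y * M i j else 0 else 0)"
        by (rule sum.cong[OF refl]) (use ne in \<open>auto intro!: sum.cong sum.neutral\<close>)
      then show ?thesis using fin e by simp
    qed
    have "0 \<le> (\<Sum>i\<in>insert a F. \<Sum>j\<in>insert a F. ?c i * cnj (?c j) * M i j)" by (rule insert.prems)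
    then show ?thesis unfolding exp 1 2 3 by (simp add: algebra_simps)
  qed
  have aa: "0 \<le> M a a"
  proof -
    let ?c = "\<lambda>i. if i = a then 1 else 0 :: complex"
    have ne: "i \<noteq> a" if "i \<in> F" for i using that aF by auto
    have "0 \<le> (\<Sum>i\<in>insert a F. \<Sum>j\<in>insert a F. ?c i * cnj (?c j) * M i j)" by (rule insert.prems)
    moreover have "(\<Sum>i\<in>F. cnj (?c i) * M a i) = 0" "(\<Sum>i\<in>F. ?c i * M i a) = 0"
      "(\<Sum>i\<in>F. \<Sum>j\<in>F. ?c i * cnj (?c j) * M i j) = 0"
      using ne by (auto intro!: sum.neutral)
    ultimately show ?thesis unfolding exp by simp
  qed
  then have ra: "Im (M a a) = 0" "Re (M a a) \<ge> 0" by (simp_all add: complex_nonneg_iff)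
  have ee: "Im (M e e) = 0" if "e \<in> F" for e
    using two[OF that, of 0 1] by (simp add: complex_nonneg_iff)
  have herm: "M e a = cnj (M a e)" if e: "e \<in> F" for e
  proof -
    \<comment> \<open>The vectors (1, 1) and (\<i>, 1) give the imaginary and the real part of
      hermitian symmetry.\<close>
    have "Im (M a e) + Im (M e a) = 0" using two[OF e, of 1 1] ra ee[OF e] by (simp add: complex_nonneg_iff)
    moreover have "Re (M a e) - Re (M e a) = 0" using two[OF e, of \<i> 1] ra ee[OF e] by (simp add: complex_nonneg_iff)
    ultimately show ?thesis by (simp add: complex_eq_iff)
  qed
  have row: "M a e = 0" if e: "e \<in> F" and 0: "M a a = 0" for e
  proof (rule ccontr)
    assume n: "M a e \<noteq> 0"
    define q where "q = (cmod (M a e))\<^sup>2"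
    have q: "q > 0" unfolding q_def using n by simp
    have qe: "M a e * cnj (M a e) = complex_of_real q" unfolding q_def by (rule complex_norm_square[symmetric])
    \<comment> \<open>Makes the form at (-s cnj (M a e), 1) equal to -1, against positivity.\<close>
    define s where "s = (Re (M e e) + 1) / (2 * q)"
    have "0 \<le> - complex_of_real s * cnj (M a e) * M a e + cnj (- complex_of_real s * cnj (M a e)) * M e a + M e e"
      using two[OF e, of "- complex_of_real s * cnj (M a e)" 1] 0 by simp
    also have "\<dots> = complex_of_real (- 2 * s * q) + M e e"
      using qe by (simp add: herm[OF e] algebra_simps)
    finally have "0 \<le> - 2 * s * q + Re (M e e)" by (simp add: complex_nonneg_iff)
    moreover have "s * q = (Re (M e e) + 1) / 2" using q unfolding s_def by simp
    ultimately show False by simp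
  qed
  \<comment> \<open>The Schur complement of the pivot.\<close>
  define M' where "M' e e' = M e e' - M e a * M a e' / M a a" for e e'
  have "0 \<le> (\<Sum>e\<in>F. \<Sum>e'\<in>F. c e * cnj (c e') * M' e e')" for c
  proof -
    define S where "S = (\<Sum>e\<in>F. c e * M e a)"
    have cS: "(\<Sum>e\<in>F. cnj (c e) * M a e) = cnj S"
      unfolding S_def cnj_sum by (rule sum.cong) (use herm in auto)
    have S0: "S = 0" if "M a a = 0" unfolding S_def using row herm that by (intro sum.neutral) auto
    \<comment> \<open>For fixed \<open>c\<close>, this entry at a minimises the form of M, and the
      minimum is the form of \<open>M'\<close> at \<open>c\<close>.\<close>
    define d where "d i = (if i = a then - S / M a a else c i)" for i
    have dF: "d i = c i" if "i \<in> F" for i using that aF unfolding d_def by auto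
    have ca: "cnj (M a a) = M a a" using ra by (simp add: complex_eq_iff)
    let ?Q = "\<Sum>e\<in>F. \<Sum>e'\<in>F. c e * cnj (c e') * M e e'"
    have "0 \<le> (\<Sum>i\<in>insert a F. \<Sum>j\<in>insert a F. d i * cnj (d j) * M i j)" by (rule insert.prems)
    moreover have "(\<Sum>i\<in>insert a F. \<Sum>j\<in>insert a F. d i * cnj (d j) * M i j) =
        d a * cnj (d a) * M a a + d a * cnj S + cnj (d a) * S + ?Q"
      unfolding exp cS[symmetric] unfolding S_def using dF by simp
    moreover have "d a * cnj (d a) * M a a + d a * cnj S + cnj (d a) * S = - (S * cnj S / M a a)"
    proof (cases "M a a = 0")
      case True
      then show ?thesis using S0 by (simp add: d_def)
    next
      case False
      then show ?thesis by (simp add: d_def ca)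
    qed
    moreover have "S * cnj S / M a a = (\<Sum>e\<in>F. \<Sum>e'\<in>F. c e * cnj (c e') * (M e a * M a e' / M a a))"
    proof -
      have "S * cnj S = (\<Sum>e\<in>F. \<Sum>e'\<in>F. (c e * M e a) * (cnj (c e') * M a e'))"
        unfolding cS[symmetric] unfolding S_def sum_product ..
      then show ?thesis unfolding sum_divide_distrib by (simp add: sum_divide_distrib mult_ac)
    qed
    moreover have "(\<Sum>e\<in>F. \<Sum>e'\<in>F. c e * cnj (c e') * M' e e') =
        ?Q - (\<Sum>e\<in>F. \<Sum>e'\<in>F. c e * cnj (c e') * (M e a * M a e' / M a a))"
      unfolding M'_def by (simp add: right_diff_distrib sum_subtractf)
    ultimately show ?thesis by simp
  qed
  from insert.IH[OF this] obtain w :: "'a \<Rightarrow> 'a \<Rightarrow> complex"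
    where w: "\<forall>e\<in>F. \<forall>e'\<in>F. M' e e' = (\<Sum>k\<in>F. w k e * cnj (w k e'))" by blast
  define r where "r = complex_of_real (sqrt (Re (M a a)))"
  have rr: "r * r = M a a" "cnj r = r" unfolding r_def using ra
    by (simp_all add: complex_eq_iff flip: of_real_mult)
  \<comment> \<open>The new index a carries column a divided by the root of the pivot; the vectors
    found for the Schur complement are extended by 0 at a.\<close>
  define v where "v k e = (if k = a then M e a / r else if e = a then 0 else w k e)" for k e
  have "M e e' = (\<Sum>k\<in>insert a F. v k e * cnj (v k e'))" if e: "e \<in> insert a F" "e' \<in> insert a F" for e e'
  proof -
    have caa: "cnj (M a a) = M a a" using ra by (simp add: complex_eq_iff)
    have va: "v a e * cnj (v a e') = M e a * cnj (M e' a) / M a a"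
      unfolding v_def using rr by simp
    have "(\<Sum>k\<in>F. v k e * cnj (v k e')) = (\<Sum>k\<in>F. if e = a \<or> e' = a then 0 else w k e * cnj (w k e'))"
      by (rule sum.cong) (use aF in \<open>auto simp: v_def\<close>)
    also have "\<dots> = (if e = a \<or> e' = a then 0 else M' e e')" using w e by auto
    finally have "(\<Sum>k\<in>insert a F. v k e * cnj (v k e')) =
        M e a * cnj (M e' a) / M a a + (if e = a \<or> e' = a then 0 else M' e e')"
      using fin aF va by simp
    also have "\<dots> = M e e'"
    proof -
      have he: "cnj (M e' a) = M a e'" using herm[of e'] caa e(2) by auto
      have z: "M e a = 0" "M a e' = 0" if "M a a = 0"
        using row[OF _ that, of e'] herm[of e] row[OF _ that, of e] e that by auto
      show ?thesis unfolding he M'_def using z by (cases "M a a = 0"; cases "e = a"; cases "e' = a") simp_all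
    qed
    finally show ?thesis by simp
  qed
  then show ?case by (intro exI[of _ v]) simp
qed simp

text \<open>Factoring the matrix of \<open>R\<close> in the basis \<open>E\<close> writes
  \<open>R\<close> as the sum of the operators |v_k><v_k|.\<close>

lemma pos_op_decomposition:
  assumes A: "fd_hilbert A" and E: "onb A E" and R: "pos_op A R"
  obtains v where "\<forall>k\<in>E. v k \<in> carrier A"
    "\<And>x y. x \<in> carrier A \<Longrightarrow> y \<in> carrier A \<Longrightarrow> ip A (R x) y = (\<Sum>k\<in>E. ip A x (v k) * ip A (v k) y)"
proof -
  note Es = onb_simps[OF E]
  have RL: "R \<in> carrier (L A)" and pos: "\<And>x. x \<in> carrier A \<Longrightarrow> 0 \<le> ip A (R x) x"
    using R unfolding pos_op_def by auto
  note Rl = L_lin[OF RL]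
  have "0 \<le> (\<Sum>e\<in>E. \<Sum>e'\<in>E. c e * cnj (c e') * ip A (R e) e')" for c
  proof -
    define x where "x = finsum A (\<lambda>e. c e \<odot>\<^bsub>A\<^esub> e) E"
    have cE: "c e \<odot>\<^bsub>A\<^esub> e \<in> carrier A" if "e \<in> E" for e using A Es(2)[OF that] by simp
    have x: "x \<in> carrier A" unfolding x_def using A cE by simp
    have "R x = finsum A (\<lambda>e. R (c e \<odot>\<^bsub>A\<^esub> e)) E" unfolding x_def by (rule lin_finsum[OF A A Rl cE])
    then have "ip A (R x) x = (\<Sum>e\<in>E. ip A (R (c e \<odot>\<^bsub>A\<^esub> e)) x)"
      using A x cE lin_simps(1)[OF Rl] by simp
    also have "\<dots> = (\<Sum>e\<in>E. \<Sum>e'\<in>E. c e * cnj (c e') * ip A (R e) e')"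
      unfolding x_def by (intro sum.cong refl)
       (use A cE Es(2) lin_simps[OF Rl] in \<open>simp add: sum_distrib_left mult_ac\<close>)
    finally show ?thesis using pos[OF x] by simp
  qed
  from psd_decomposition[where M = "\<lambda>e e'. ip A (R e) e'", OF Es(1) this] obtain w :: "'a \<Rightarrow> 'a \<Rightarrow> complex"
    where w: "\<forall>e\<in>E. \<forall>e'\<in>E. ip A (R e) e' = (\<Sum>k\<in>E. w k e * cnj (w k e'))" by blast
  \<comment> \<open>Conjugated because \<open>ip\<close> is antilinear in its second argument: the
    outcome is <e, v_k> = w k e.\<close>
  define v where "v k = finsum A (\<lambda>e. cnj (w k e) \<odot>\<^bsub>A\<^esub> e) E" for k
  have v: "v k \<in> carrier A" for k unfolding v_def using A Es(2) by simp
  have ev: "ip A (v k) e = cnj (w k e)" if e: "e \<in> E" for k e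
  proof -
    have "ip A (v k) e = (\<Sum>e'\<in>E. if e = e' then cnj (w k e') else 0)"
      unfolding v_def using A Es(2) e by (auto simp: Es(3) intro!: sum.cong)
    then show ?thesis using Es(1) e by simp
  qed
  have ve: "ip A e (v k) = w k e" if e: "e \<in> E" for k e
    using ip_cnj[OF A v Es(2)[OF e], of k] ev[OF e, of k] by simp
  have "ip A (R x) y = (\<Sum>k\<in>E. ip A x (v k) * ip A (v k) y)" if x: "x \<in> carrier A" and y: "y \<in> carrier A" for x y
  proof -
    have "ip A (R x) y = (\<Sum>e\<in>E. ip A x e * (\<Sum>e'\<in>E. ip A (R e) e' * ip A e' y))"
      unfolding lin_onb[OF A A Rl E x y]
      by (intro sum.cong refl, subst onb_ip[OF A E _ y]) (use lin_simps(1)[OF Rl] Es(2) in simp_all)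
    also have "\<dots> = (\<Sum>e\<in>E. \<Sum>e'\<in>E. \<Sum>k\<in>E. (ip A x e * ip A e (v k)) * (ip A (v k) e' * ip A e' y))"
      by (intro sum.cong refl) (simp add: w ev ve sum_distrib_left sum_distrib_right mult_ac)
    also have "\<dots> = (\<Sum>e\<in>E. \<Sum>k\<in>E. \<Sum>e'\<in>E. (ip A x e * ip A e (v k)) * (ip A (v k) e' * ip A e' y))"
      by (rule sum.cong[OF refl], rule sum.swap)
    also have "\<dots> = (\<Sum>k\<in>E. \<Sum>e\<in>E. \<Sum>e'\<in>E. (ip A x e * ip A e (v k)) * (ip A (v k) e' * ip A e' y))"
      by (rule sum.swap)
    also have "\<dots> = (\<Sum>k\<in>E. ip A x (v k) * ip A (v k) y)"
      by (simp only: onb_ip[OF A E x v] onb_ip[OF A E v y] sum_product)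
    finally show ?thesis .
  qed
  then show ?thesis using that v by blast
qed

lemma ip_square_nonneg:
  assumes "fd_hilbert A" "x \<in> carrier A" "y \<in> carrier A"
  shows "0 \<le> ip A x y * ip A y x"
  by (simp add: ip_cnj[OF assms, symmetric] complex_nonneg_iff)

text \<open>A summand |v><v| of \<open>R\<close> goes to the sum of the |K_i v><K_i v|, so the
  quadratic form is a sum of squares |<z, K_i v>|^2.\<close>

lemma kmap_pos:
  assumes A: "fd_hilbert A" and B: "fd_hilbert B" and K: "\<forall>i\<in>I. K i \<in> lin A B" and R: "pos_op A R"
  shows "pos_op B (kmap A B I K R)"
proof -
  define E where "E = some_onb A"
  have E: "onb A E" unfolding E_def by (rule some_onb[OF A])
  obtain v where v: "\<forall>k\<in>E. v k \<in> carrier A"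
    and Rv: "\<And>x y. x \<in> carrier A \<Longrightarrow> y \<in> carrier A \<Longrightarrow> ip A (R x) y = (\<Sum>k\<in>E. ip A x (v k) * ip A (v k) y)"
    using pos_op_decomposition[OF A E R] by blast
  have RL: "R \<in> carrier (L A)" using R unfolding pos_op_def by simp
  have kc: "\<forall>k\<in>E. ketbra A (v k) (v k) \<in> carrier (L A)" using A v by simp
  have "R = opsum A E (\<lambda>_. 1) (\<lambda>k. ketbra A (v k) (v k))"
    by (rule op_eqI[OF A RL opsum_closed[OF A kc]]) (use A v kc in \<open>simp add: Rv\<close>)
  then have kR: "kmap A B I K R = opsum B E (\<lambda>_. 1) (\<lambda>k. kmap A B I K (ketbra A (v k) (v k)))"
    using superops_opsum[OF A B kmap_superop[OF A B K] onb_simps(1)[OF E] kc] by simp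
  have kk: "\<forall>k\<in>E. kmap A B I K (ketbra A (v k) (v k)) \<in> carrier (L B)"
    using kmap_form(1)[OF A B K] kc by simp
  have "0 \<le> ip B (kmap A B I K R z) z" if z: "z \<in> carrier B" for z
  proof -
    have "ip B (kmap A B I K R z) z = (\<Sum>k\<in>E. \<Sum>i\<in>I. ip B z (K i (v k)) * ip B (K i (v k)) z)"
      unfolding kR opsum_ip[OF B kk z z] using kmap_ketbra[OF A B K _ _ z z] v by simp
    also have "\<dots> \<ge> 0"
      by (intro sum_nonneg ip_square_nonneg[OF B z]) (rule lin_simps(1)[OF bspec[OF K] bspec[OF v]])
    finally show ?thesis .
  qed
  then show ?thesis unfolding pos_op_def using kmap_form(1)[OF A B K RL] by simp
qed

lemma hobjsD: "A \<in> hobjs \<Longrightarrow> fd_hilbert A"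
  unfolding hobjs_def by simp

text \<open>Tensoring with the identity only replaces K_i by K_i \<otimes> 1, so complete positivity
  is positivity of another Kraus map.\<close>

lemma kmap_cp:
  assumes A: "fd_hilbert A" and B: "fd_hilbert B" and K: "\<forall>i\<in>I. K i \<in> lin A B"
  shows "completely_positive A B (kmap A B I K)"
  unfolding completely_positive_def
proof (intro conjI ballI allI impI)
  show "kmap A B I K \<in> superops A B" by (rule kmap_superop[OF A B K])
  fix E R assume E': "E \<in> hobjs" and R: "pos_op (tspace A E) R"
  have E: "fd_hilbert E" using E' by (rule hobjsD)
  have id: "\<forall>i\<in>{()}. (\<lambda>x. x) \<in> lin E E" using lin_id by simp
  show "pos_op (tspace B E) (tensor_super A B E E (kmap A B I K) (super_id E) R)"
    unfolding super_id_kmap(1)[OF E] tensor_super_kmap[OF A B E E K id]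
    by (rule kmap_pos[OF _ _ _ R]) (use A B E K id tmap(1)[OF A E B E] in auto)
qed

lemma kmap_reindex:
  assumes A: "fd_hilbert A" and B: "fd_hilbert B" and K: "\<forall>i\<in>I. K i \<in> lin A B" and h: "bij_betw h J I"
  shows "kmap A B I K = kmap A B J (\<lambda>j. K (h j))"
proof -
  have K': "\<forall>j\<in>J. K (h j) \<in> lin A B" using K bij_betwE[OF h] by simp
  show ?thesis
    by (rule kmap_eqI[OF A B K K'])
      (simp add: sum.reindex_bij_betw[OF h, of "\<lambda>i. ip B _ (K i _) * ip B (K i _) _", symmetric])
qed

text \<open>Zero operators pad the family to the length \<open>n\<close>. This freedom supplies the
  cardinality hypothesis of \<open>kraus_freedom\<close>.\<close>

lemma kmap_nat:
  assumes A: "fd_hilbert A" and B: "fd_hilbert B" and K: "\<forall>i\<in>I. K i \<in> lin A B" and I: "finite I"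
    and n: "card I \<le> n"
  obtains M where "\<forall>i\<in>{..<n::nat}. M i \<in> lin A B" "kmap A B I K = kmap A B {..<n} M"
proof -
  obtain h where h: "bij_betw h {..<card I} I"
    using ex_bij_betw_nat_finite[OF I] unfolding atLeast0LessThan by blast
  define M where "M j = (if j < card I then K (h j) else (\<lambda>_. \<zero>\<^bsub>B\<^esub>))" for j
  have zero: "(\<lambda>_. \<zero>\<^bsub>B\<^esub>) \<in> lin A B" by (rule linI_ip[OF A B]) (use B in simp_all)
  have K': "\<forall>j\<in>{..<card I}. K (h j) \<in> lin A B" using K bij_betwE[OF h] by simp
  have M: "\<forall>i\<in>{..<n}. M i \<in> lin A B" unfolding M_def using K' zero by simp
  have "kmap A B I K = kmap A B {..<card I} (\<lambda>j. K (h j))" by (rule kmap_reindex[OF A B K h])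
  also have "\<dots> = kmap A B {..<n} M"
  proof (rule kmap_eqI[OF A B K' M])
    fix x y z w assume z: "z \<in> carrier B" "w \<in> carrier B"
    have "(\<Sum>j<n. ip B z (M j y) * ip B (M j x) w) = (\<Sum>j<card I. ip B z (M j y) * ip B (M j x) w)"
      by (rule sum.mono_neutral_right) (use n B z in \<open>auto simp: M_def\<close>)
    also have "\<dots> = (\<Sum>j<card I. ip B z (K (h j) y) * ip B (K (h j) x) w)"
      by (rule sum.cong) (auto simp: M_def)
    finally show "(\<Sum>j<card I. ip B z (K (h j) y) * ip B (K (h j) x) w) =
      (\<Sum>j<n. ip B z (M j y) * ip B (M j x) w)" by simp
  qed
  finally show ?thesis using that M by blast
qed

text \<open>Choi's theorem. The Kraus operators are read off the vectors of a decomposition of the Choi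
  operator: \<open>\<langle>K\<^sub>k x, c\<rangle> = \<langle>v\<^sub>k, c \<otimes> x\<rangle>\<close> for basis vectors \<open>x\<close>.\<close>

lemma cp_kraus:
  assumes A': "A \<in> hobjs" and B: "fd_hilbert B" and cp: "completely_positive A B f"
  obtains K n where "\<forall>i\<in>{..<n::nat}. K i \<in> lin A B" "f = kmap A B {..<n} K"
proof -
  have A: "fd_hilbert A" using A' by (rule hobjsD)
  have f: "f \<in> superops A B" using cp unfolding completely_positive_def by simp
  define E where "E = some_onb A"
  have E: "onb A E" unfolding E_def by (rule some_onb[OF A])
  note Es = onb_simps[OF E]
  let ?T = "tspace A A" and ?U = "tspace B A"
  have T: "fd_hilbert ?T" and U: "fd_hilbert ?U" using A B by simp_all
  \<comment> \<open>The unnormalised maximally entangled vector. Its rank one operator is the sum of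
    all |e><e'| \<otimes> |e><e'|, so f \<otimes> id sends it to the Choi operator
    \<open>?D\<close>.\<close>
  define \<Omega> where "\<Omega> = finsum ?T (\<lambda>e. tvec A A e e) E"
  have tc: "tvec A A e e \<in> carrier ?T" if "e \<in> E" for e using A Es(2)[OF that] by simp
  have \<Omega>: "\<Omega> \<in> carrier ?T" unfolding \<Omega>_def using T tc by simp
  have kc: "ketbra A (fst p) (snd p) \<in> carrier (L A)" if "p \<in> E \<times> E" for p using A Es(2) that by auto
  define W where "W p = tensor_op A A (ketbra A (fst p) (snd p)) (ketbra A (fst p) (snd p))" for p
  have W: "W p = ketbra ?T (tvec A A (fst p) (fst p)) (tvec A A (snd p) (snd p))" if "p \<in> E \<times> E" for p
    unfolding W_def by (rule tensor_op_ketbra[OF A A]) (use that Es in auto)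
  have Wc: "\<forall>p\<in>E\<times>E. W p \<in> carrier (L ?T)" unfolding W_def using tensor_op(1)[OF A A kc kc] by blast
  let ?R = "ketbra ?T \<Omega> \<Omega>"
  have R: "pos_op ?T ?R" unfolding pos_op_def using T \<Omega> ip_square_nonneg[OF T] by simp
  have Re: "?R = opsum ?T (E \<times> E) (\<lambda>_. 1) W"
  proof (rule op_eqI[OF T _ opsum_closed[OF T Wc]])
    show "?R \<in> carrier (L ?T)" using T \<Omega> by simp
    fix x y assume xy: "x \<in> carrier ?T" "y \<in> carrier ?T"
    have "ip ?T (?R x) y = (\<Sum>e\<in>E. ip ?T x (tvec A A e e)) * (\<Sum>e\<in>E. ip ?T (tvec A A e e) y)"
      using T \<Omega> xy tc by (simp add: \<Omega>_def)
    also have "\<dots> = (\<Sum>e'\<in>E. \<Sum>e\<in>E. ip ?T x (tvec A A e e) * ip ?T (tvec A A e' e') y)"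
      unfolding sum_product by (rule sum.swap)
    also have "\<dots> = (\<Sum>p\<in>E\<times>E. ip ?T x (tvec A A (snd p) (snd p)) * ip ?T (tvec A A (fst p) (fst p)) y)"
      by (simp add: sum.cartesian_product split_beta)
    also have "\<dots> = (\<Sum>p\<in>E\<times>E. ip ?T (W p x) y)"
      by (rule sum.cong) (use W T xy tc in auto)
    finally show "ip ?T (?R x) y = ip ?T (opsum ?T (E \<times> E) (\<lambda>_. 1) W x) y"
      using opsum_ip[OF T Wc xy] by simp
  qed
  let ?h = "tensor_super A B A A f (super_id A)"
  let ?D = "?h ?R"
  note h = tensor_super[OF A B A A f super_id_kmap(2)[OF A]]
  have D: "pos_op ?U ?D" using cp A' R unfolding completely_positive_def by blast
  have De: "?D = opsum ?U (E \<times> E) (\<lambda>_. 1) (\<lambda>p. ?h (W p))"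
    unfolding Re by (rule superops_opsum[OF T U h(1) _ Wc]) (use Es in simp)
  have hW: "?h (W p) = tensor_op B A (f (ketbra A (fst p) (snd p))) (ketbra A (fst p) (snd p))" if "p \<in> E \<times> E" for p
    unfolding W_def h(2)[OF kc[OF that] kc[OF that]] using kc[OF that] by (simp add: super_id_def)
  have hWc: "\<forall>p\<in>E\<times>E. ?h (W p) \<in> carrier (L ?U)" using superops_simps(1)[OF h(1)] Wc by simp
  \<comment> \<open>Only the term e = x, e' = y of the Choi operator survives: y is fed to |e><e'|,
    and x is what its image is paired with.\<close>
  have Dform: "ip ?U (?D (tvec B A b y)) (tvec B A c x) = ip B (f (ketbra A x y) b) c"
    if xy: "x \<in> E" "y \<in> E" and bc: "b \<in> carrier B" "c \<in> carrier B" for x y b c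
  proof -
    have t: "tvec B A b y \<in> carrier ?U" "tvec B A c x \<in> carrier ?U" using A B Es(2) xy bc by simp_all
    have "ip ?U (?D (tvec B A b y)) (tvec B A c x) =
       (\<Sum>p\<in>E\<times>E. ip ?U (?h (W p) (tvec B A b y)) (tvec B A c x))"
      unfolding De opsum_ip[OF U hWc t] by simp
    also have "\<dots> = (\<Sum>p\<in>E\<times>E. if (x, y) = p then ip B (f (ketbra A (fst p) (snd p)) b) c else 0)"
    proof (rule sum.cong[OF refl])
      fix p assume p: "p \<in> E \<times> E"
      have pE: "fst p \<in> E" "snd p \<in> E" using p by auto
      note fk = superops_simps(1)[OF f kc[OF p]]
      have "ip ?U (?h (W p) (tvec B A b y)) (tvec B A c x) =
         ip B (f (ketbra A (fst p) (snd p)) b) c * (ip A y (snd p) * ip A (fst p) x)"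
        unfolding hW[OF p] tensor_op(2)[OF B A fk kc[OF p] bc(1) Es(2)[OF xy(2)]]
        using A B fk kc[OF p] bc Es(2) xy pE by simp
      also have "\<dots> = (if (x, y) = p then ip B (f (ketbra A (fst p) (snd p)) b) c else 0)"
        using xy pE by (cases p) (auto simp: Es(3))
      finally show "ip ?U (?h (W p) (tvec B A b y)) (tvec B A c x) = \<dots>" .
    qed
    also have "\<dots> = ip B (f (ketbra A x y) b) c" using xy Es(1) by simp
    finally show ?thesis .
  qed
  define G where "G = some_onb ?U"
  have G: "onb ?U G" unfolding G_def by (rule some_onb[OF U])
  obtain v where v: "\<forall>k\<in>G. v k \<in> carrier ?U"
    and Dv: "\<And>x y. x \<in> carrier ?U \<Longrightarrow> y \<in> carrier ?U \<Longrightarrow> ip ?U (?D x) y = (\<Sum>k\<in>G. ip ?U x (v k) * ip ?U (v k) y)"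
    using pos_op_decomposition[OF U G D] by blast
  define F where "F = some_onb B"
  have F: "onb B F" unfolding F_def by (rule some_onb[OF B])
  note Fs = onb_simps[OF F]
  \<comment> \<open>The Riesz vector of c |-> <v_k, c \<otimes> x>, written out in the basis
    \<open>F\<close>.\<close>
  define q where "q k x = finsum B (\<lambda>f. ip ?U (v k) (tvec B A f x) \<odot>\<^bsub>B\<^esub> f) F" for k x
  have qc: "q k x \<in> carrier B" for k x unfolding q_def using B Fs by simp
  have qip: "ip B (q k x) c = ip ?U (v k) (tvec B A c x)"
    if k: "k \<in> G" and x: "x \<in> E" and c: "c \<in> carrier B" for k x c
  proof -
    have l: "(\<lambda>c. tvec B A c x) \<in> lin B ?U" using A B Es(2)[OF x] by simp
    show ?thesis unfolding lin_onb_right[OF B U l F c bspec[OF v k]]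
      unfolding q_def using B Fs(2) c by (simp add: mult.commute)
  qed
  have qip': "ip B c (q k x) = ip ?U (tvec B A c x) (v k)"
    if k: "k \<in> G" and x: "x \<in> E" and c: "c \<in> carrier B" for k x c
    using arg_cong[OF qip[OF that], of cnj] ip_cnj[OF B qc c, of k x] ip_cnj[OF U, of "v k" "tvec B A c x"]
      v k A B Es(2)[OF x] c by simp
  \<comment> \<open>As a function of its vector \<open>q k\<close> is conjugate-linear, hence not
    itself a Kraus operator; its values on the basis \<open>E\<close> are extended linearly
    instead.\<close>
  define K where "K k = lext A E B (q k)" for k
  have K: "\<forall>k\<in>G. K k \<in> lin A B" "\<And>k x. x \<in> E \<Longrightarrow> K k x = q k x"
    unfolding K_def using lext[OF A B E] qc by auto
  have "f = kmap A B G K"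
  proof (rule eq_kmapI[OF A B K(1) f E])
    fix x y z w assume xy: "x \<in> E" "y \<in> E" and zw: "z \<in> carrier B" "w \<in> carrier B"
    have t: "tvec B A z y \<in> carrier ?U" "tvec B A w x \<in> carrier ?U" using A B Es(2) xy zw by simp_all
    show "ip B (f (ketbra A x y) z) w = (\<Sum>k\<in>G. ip B z (K k y) * ip B (K k x) w)"
      unfolding Dform[OF xy zw, symmetric] Dv[OF t] using K(2) xy zw by (simp add: qip qip')
  qed
  moreover obtain M where "\<forall>i\<in>{..<card G}. M i \<in> lin A B" "kmap A B G K = kmap A B {..<card G} M"
    using kmap_nat[OF A B K(1) onb_simps(1)[OF G]] by blast
  ultimately show ?thesis using that by simp
qed

subsection \<open>Unitary freedom of Kraus families\<close>

text \<open>In the induction step the isometry is corrected by the complex Householder reflection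
  \<open>1 - d d\<^sup>* / \<tau>\<close> with \<open>d = J \<alpha>\<^sub>p - \<beta>\<^sub>p\<close> and \<open>\<tau> = d\<^sup>* J \<alpha>\<^sub>p\<close>: it sends \<open>J \<alpha>\<^sub>p\<close> to \<open>\<beta>\<^sub>p\<close>, fixes the earlier
  \<open>\<beta>\<close>'s, which are orthogonal to \<open>d\<close>, and is unitary because \<open>\<tau> + cnj \<tau> = |d|\<^sup>2\<close>.\<close>

lemma gram_isometry:
  fixes \<alpha> \<beta> :: "'p \<Rightarrow> 'q \<Rightarrow> complex"
  assumes P: "finite P" and Q: "finite Q"
    and gram: "\<And>p p'. p \<in> P \<Longrightarrow> p' \<in> P \<Longrightarrow>
      (\<Sum>q\<in>Q. \<alpha> p q * cnj (\<alpha> p' q)) = (\<Sum>q\<in>Q. \<beta> p q * cnj (\<beta> p' q))"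
  shows "\<exists>J :: 'q \<Rightarrow> 'q \<Rightarrow> complex. (\<forall>p\<in>P. \<forall>q\<in>Q. \<beta> p q = (\<Sum>r\<in>Q. J q r * \<alpha> p r)) \<and>
    (\<forall>r\<in>Q. \<forall>s\<in>Q. (\<Sum>q\<in>Q. J q r * cnj (J q s)) = (if r = s then 1 else 0))"
  using P gram
proof (induction P)
  case empty
  have "(\<Sum>q\<in>Q. (if q = r then 1 else 0) * cnj (if q = s then 1 else 0)) = (if r = s then 1 else 0 :: complex)"
    if "r \<in> Q" "s \<in> Q" for r s
  proof -
    have "(\<Sum>q\<in>Q. (if q = r then 1 else 0) * cnj (if q = s then 1 else 0)) =
        (\<Sum>q\<in>Q. if q = r then if r = s then 1 else 0 else 0 :: complex)"
      by (rule sum.cong) auto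
    then show ?thesis using Q that by simp
  qed
  then show ?case by (intro exI[of _ "\<lambda>q r. if q = r then 1 else 0"]) simp
next
  case (insert p P)
  from insert.IH[OF insert.prems] obtain J :: "'q \<Rightarrow> 'q \<Rightarrow> complex"
    where J: "\<And>p q. p \<in> P \<Longrightarrow> q \<in> Q \<Longrightarrow> \<beta> p q = (\<Sum>r\<in>Q. J q r * \<alpha> p r)"
      and iso: "\<And>r s. r \<in> Q \<Longrightarrow> s \<in> Q \<Longrightarrow> (\<Sum>q\<in>Q. J q r * cnj (J q s)) = (if r = s then 1 else 0)"
    by auto
  define H where "H u v = (\<Sum>q\<in>Q. u q * cnj (v q))" for u v :: "'q \<Rightarrow> complex"
  define ap where "ap u q = (\<Sum>r\<in>Q. J q r * u r)" for u q
  have H_iso: "H (ap u) (ap v) = H u v" for u v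
  proof -
    have "H (ap u) (ap v) = (\<Sum>q\<in>Q. \<Sum>r\<in>Q. \<Sum>s\<in>Q. (J q r * cnj (J q s)) * (u r * cnj (v s)))"
      unfolding H_def ap_def cnj_sum sum_product by (intro sum.cong) (auto simp: mult_ac)
    also have "\<dots> = (\<Sum>r\<in>Q. \<Sum>s\<in>Q. (\<Sum>q\<in>Q. J q r * cnj (J q s)) * (u r * cnj (v s)))"
      by (subst sum.swap, rule sum.cong[OF refl], subst sum.swap) (simp add: sum_distrib_right)
    also have "\<dots> = (\<Sum>r\<in>Q. \<Sum>s\<in>Q. if r = s then u r * cnj (v s) else 0)"
      by (intro sum.cong) (auto simp: iso)
    also have "\<dots> = H u v" unfolding H_def using Q by simp
    finally show ?thesis .
  qed
  have H_diff: "H u (\<lambda>q. v q - w q) = H u v - H u w" "H (\<lambda>q. v q - w q) u = H v u - H w u" for u v w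
    unfolding H_def by (simp_all add: algebra_simps sum_subtractf)
  have H_cnj: "cnj (H u v) = H v u" for u v unfolding H_def by (simp add: mult.commute)
  have H_cong: "H u v = H u' v'" if "\<And>q. q \<in> Q \<Longrightarrow> u q = u' q" "\<And>q. q \<in> Q \<Longrightarrow> v q = v' q" for u v u' v'
    unfolding H_def using that by simp
  define d where "d q = ap (\<alpha> p) q - \<beta> p q" for q
  define \<tau> where "\<tau> = H (ap (\<alpha> p)) d"
  have Hp: "H (\<beta> p) (\<beta> p) = H (\<alpha> p) (\<alpha> p)" unfolding H_def using insert.prems[of p p] by simp
  \<comment> \<open>Since J \<alpha>_p and \<beta>_p have equal norms, |d|^2 = 2 |J \<alpha>_p|^2 -
    2 Re <J \<alpha>_p, \<beta>_p> = 2 Re \<tau>.\<close>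
  have dd: "H d d = \<tau> + cnj \<tau>"
    unfolding \<tau>_def H_cnj unfolding d_def H_diff H_iso using Hp by simp
  have old: "H (\<beta> p') d = 0" if p': "p' \<in> P" for p'
  proof -
    have "H (\<beta> p') d = H (ap (\<alpha> p')) (ap (\<alpha> p)) - H (\<beta> p') (\<beta> p)"
      unfolding d_def H_diff using J[OF p'] by (subst H_cong[of "\<beta> p'" "ap (\<alpha> p')"]) (auto simp: ap_def)
    also have "\<dots> = 0" unfolding H_iso using insert.prems[of p' p] p' unfolding H_def by simp
    finally show ?thesis .
  qed
  show ?case
  proof (cases "\<forall>q\<in>Q. d q = 0")
    case True
    then show ?thesis using J iso unfolding d_def ap_def by (intro exI[of _ J]) auto
  next
    case False
    have \<tau>: "\<tau> \<noteq> 0"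
    proof
      assume "\<tau> = 0"
      then have "complex_of_real (\<Sum>q\<in>Q. (cmod (d q))\<^sup>2) = 0"
        using dd unfolding H_def by (simp add: complex_norm_square del: of_real_power)
      then have "(\<Sum>q\<in>Q. (cmod (d q))\<^sup>2) = 0" by (simp only: of_real_eq_0_iff)
      then show False using False Q by (simp add: sum_nonneg_eq_0_iff)
    qed
    \<comment> \<open>The row d^* J, so that J' = J - d x / \<tau> is the reflection applied to
      J.\<close>
    define x where "x r = (\<Sum>q\<in>Q. J q r * cnj (d q))" for r
    define J' where "J' q r = J q r - d q * x r / \<tau>" for q r
    have apJ': "(\<Sum>r\<in>Q. J' q r * u r) = ap u q - d q * H (ap u) d / \<tau>" for u q
    proof -
      have "(\<Sum>r\<in>Q. x r * u r) = H (ap u) d"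
        unfolding x_def H_def ap_def sum_distrib_right by (subst sum.swap) (simp add: mult_ac)
      moreover have "(\<Sum>r\<in>Q. J' q r * u r) = ap u q - d q * (\<Sum>r\<in>Q. x r * u r) / \<tau>"
        unfolding J'_def ap_def left_diff_distrib sum_subtractf sum_distrib_left sum_divide_distrib by (simp add: mult_ac)
      ultimately show ?thesis by simp
    qed
    have "\<beta> p' q = (\<Sum>r\<in>Q. J' q r * \<alpha> p' r)" if p': "p' \<in> insert p P" and q: "q \<in> Q" for p' q
    proof (cases "p' = p")
      case True
      then show ?thesis unfolding apJ' \<tau>_def[symmetric] using \<tau> by (simp add: True \<tau>_def[symmetric] d_def)
    next
      case False
      then have p': "p' \<in> P" using p' by simp
      have "H (ap (\<alpha> p')) d = H (\<beta> p') d" by (rule H_cong) (use J[OF p'] in \<open>auto simp: ap_def\<close>)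
      then show ?thesis unfolding apJ' using old[OF p'] J[OF p' q] by (simp add: ap_def)
    qed
    moreover have "(\<Sum>q\<in>Q. J' q r * cnj (J' q s)) = (if r = s then 1 else 0)" if rs: "r \<in> Q" "s \<in> Q" for r s
    proof -
      have cx: "(\<Sum>q\<in>Q. d q * cnj (J q s)) = cnj (x s)" unfolding x_def by (simp add: mult.commute)
      have "(\<Sum>q\<in>Q. J' q r * cnj (J' q s)) = (\<Sum>q\<in>Q. J q r * cnj (J q s)) - (\<Sum>q\<in>Q. J q r * cnj (d q)) * (cnj (x s) / cnj \<tau>)
         - (\<Sum>q\<in>Q. d q * cnj (J q s)) * (x r / \<tau>) + (\<Sum>q\<in>Q. d q * cnj (d q)) * (x r * cnj (x s) / (\<tau> * cnj \<tau>))"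
        unfolding J'_def sum_distrib_right sum_subtractf[symmetric] sum.distrib[symmetric]
        by (rule sum.cong) (use \<tau> in \<open>auto simp: field_simps\<close>)
      also have "\<dots> = (if r = s then 1 else 0) - x r * cnj (x s) / cnj \<tau> - cnj (x s) * x r / \<tau>
          + H d d * (x r * cnj (x s) / (\<tau> * cnj \<tau>))"
        unfolding cx using iso[OF rs] by (simp add: x_def H_def)
      also have "\<dots> = (if r = s then 1 else 0)"
        unfolding dd using \<tau> by (simp add: field_simps)
      finally show ?thesis .
    qed
    ultimately show ?thesis by (intro exI[of _ J']) simp
  qed
qed

text \<open>Take the entries <U_r e, f> with (e, f) as vector label and r as coordinate. Their Gram
  matrix consists of entries of the common map on the operators |e><e'|, so it is the same for W.
  \<open>gram_isometry\<close> applies once the shorter family is placed into \<open>Q\<close> along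
  an injection, with zeros elsewhere.\<close>

lemma kraus_freedom:
  assumes A: "fd_hilbert A" and B: "fd_hilbert B" and R: "finite R" and Q: "finite Q" and card: "card R \<le> card Q"
    and U: "\<forall>r\<in>R. U r \<in> lin A B" and W: "\<forall>q\<in>Q. W q \<in> lin A B" and eq: "kmap A B R U = kmap A B Q W"
  obtains J :: "'q \<Rightarrow> 'r \<Rightarrow> complex" where
    "\<And>q x. q \<in> Q \<Longrightarrow> x \<in> carrier A \<Longrightarrow> W q x = finsum B (\<lambda>r. J q r \<odot>\<^bsub>B\<^esub> U r x) R"
    "\<And>r s. r \<in> R \<Longrightarrow> s \<in> R \<Longrightarrow> (\<Sum>q\<in>Q. J q r * cnj (J q s)) = (if r = s then 1 else 0)"
proof -
  obtain \<phi> where \<phi>: "inj_on \<phi> R" "\<phi> ` R \<subseteq> Q" using card_le_inj[OF R Q card] by blast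
  define E F where "E = some_onb A" and "F = some_onb B"
  have E: "onb A E" and F: "onb B F"
    unfolding E_def F_def using some_onb A B by auto
  note Es = onb_simps[OF E] and Fs = onb_simps[OF F]
  define \<alpha> where "\<alpha> p q = (if q \<in> \<phi> ` R then ip B (U (inv_into R \<phi> q) (fst p)) (snd p) else 0)"
    for p :: "'a \<times> 'a" and q
  define \<beta> where "\<beta> p q = ip B (W q (fst p)) (snd p)" for p :: "'a \<times> 'a" and q
  have sub: "(\<Sum>q\<in>Q. if q \<in> \<phi> ` R then g (inv_into R \<phi> q) else 0) = (\<Sum>r\<in>R. g r)" for g :: "'r \<Rightarrow> complex"
  proof -
    have "(\<Sum>q\<in>Q. if q \<in> \<phi> ` R then g (inv_into R \<phi> q) else 0) = (\<Sum>q\<in>\<phi> ` R. g (inv_into R \<phi> q))"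
      using \<phi>(2) Q by (simp add: sum.If_cases Int_absorb1)
    also have "\<dots> = (\<Sum>r\<in>R. g r)" using \<phi>(1) by (simp add: sum.reindex)
    finally show ?thesis .
  qed
  have "(\<Sum>q\<in>Q. \<alpha> p q * cnj (\<alpha> p' q)) = (\<Sum>q\<in>Q. \<beta> p q * cnj (\<beta> p' q))"
    if p: "p \<in> E \<times> F" "p' \<in> E \<times> F" for p p'
  proof -
    have c: "fst p \<in> carrier A" "fst p' \<in> carrier A" "snd p \<in> carrier B" "snd p' \<in> carrier B"
      using p Es Fs by auto
    have Uc: "U r (fst p') \<in> carrier B" if "r \<in> R" for r using lin_simps(1)[OF bspec[OF U that] c(2)] .
    have Wc: "W q (fst p') \<in> carrier B" if "q \<in> Q" for q using lin_simps(1)[OF bspec[OF W that] c(2)] .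
    have "(\<Sum>q\<in>Q. \<alpha> p q * cnj (\<alpha> p' q)) =
        (\<Sum>q\<in>Q. if q \<in> \<phi> ` R then ip B (U (inv_into R \<phi> q) (fst p)) (snd p) *
          cnj (ip B (U (inv_into R \<phi> q) (fst p')) (snd p')) else 0)"
      by (rule sum.cong) (auto simp: \<alpha>_def)
    also have "\<dots> = (\<Sum>r\<in>R. ip B (U r (fst p)) (snd p) * cnj (ip B (U r (fst p')) (snd p')))" by (rule sub)
    also have "\<dots> = (\<Sum>r\<in>R. ip B (snd p') (U r (fst p')) * ip B (U r (fst p)) (snd p))"
      by (rule sum.cong) (simp_all add: ip_cnj[OF B Uc c(4)] mult.commute)
    also have "\<dots> = ip B (kmap A B Q W (ketbra A (fst p) (fst p')) (snd p')) (snd p)"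
      unfolding eq[symmetric] by (rule kmap_ketbra[OF A B U c(1,2,4,3), symmetric])
    also have "\<dots> = (\<Sum>q\<in>Q. ip B (snd p') (W q (fst p')) * ip B (W q (fst p)) (snd p))"
      by (rule kmap_ketbra[OF A B W c(1,2,4,3)])
    also have "\<dots> = (\<Sum>q\<in>Q. \<beta> p q * cnj (\<beta> p' q))"
      unfolding \<beta>_def by (rule sum.cong) (simp_all add: ip_cnj[OF B Wc c(4)] mult.commute)
    finally show ?thesis .
  qed
  then obtain J :: "'q \<Rightarrow> 'q \<Rightarrow> complex" where J: "\<forall>p\<in>E\<times>F. \<forall>q\<in>Q. \<beta> p q = (\<Sum>r\<in>Q. J q r * \<alpha> p r)"
    and iso: "\<forall>r\<in>Q. \<forall>s\<in>Q. (\<Sum>q\<in>Q. J q r * cnj (J q s)) = (if r = s then 1 else 0)"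
    using gram_isometry[of "E \<times> F" Q \<alpha> \<beta>] Es(1) Fs(1) Q by blast
  \<comment> \<open>Only the columns in the image of \<open>\<phi>\<close> meet nonzero entries of
    \<open>\<alpha>\<close>; those columns are still orthonormal.\<close>
  define J' where "J' q r = J q (\<phi> r)" for q r
  have Jb: "ip B (W q e) f = (\<Sum>r\<in>R. J' q r * ip B (U r e) f)" if "q \<in> Q" "e \<in> E" "f \<in> F" for q e f
  proof -
    have "ip B (W q e) f = (\<Sum>r\<in>Q. J q r * \<alpha> (e, f) r)" using J that unfolding \<beta>_def by fastforce
    also have "\<dots> = (\<Sum>r\<in>Q. if r \<in> \<phi> ` R then J' q (inv_into R \<phi> r) * ip B (U (inv_into R \<phi> r) e) f else 0)"
      by (rule sum.cong) (auto simp: \<alpha>_def J'_def \<phi>(1))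
    finally show ?thesis using sub[of "\<lambda>r. J' q r * ip B (U r e) f"] by simp
  qed
  have "W q x = finsum B (\<lambda>r. J' q r \<odot>\<^bsub>B\<^esub> U r x) R" if q: "q \<in> Q" and x: "x \<in> carrier A" for q x
  proof (rule lin_eqI[OF A B bspec[OF W q] lin_lincomb[OF A B] E _ x])
    fix e assume e: "e \<in> E"
    have Ue: "U r e \<in> carrier B" if "r \<in> R" for r using lin_simps(1)[OF bspec[OF U that] Es(2)[OF e]] .
    have We: "W q e \<in> carrier B" by (rule lin_simps(1)[OF bspec[OF W q] Es(2)[OF e]])
    show "W q e = finsum B (\<lambda>r. J' q r \<odot>\<^bsub>B\<^esub> U r e) R"
    proof (rule ip_eqI[OF B We])
      show fc: "finsum B (\<lambda>r. J' q r \<odot>\<^bsub>B\<^esub> U r e) R \<in> carrier B" using B Ue by simp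
      fix z assume z: "z \<in> carrier B"
      show "ip B (W q e) z = ip B (finsum B (\<lambda>r. J' q r \<odot>\<^bsub>B\<^esub> U r e) R) z"
        unfolding onb_ip[OF B F We z] onb_ip[OF B F fc z]
        by (rule sum.cong[OF refl]) (use B Ue Fs(2) in \<open>simp add: Jb[OF q e]\<close>)
    qed
  qed (use U in auto)
  moreover have "(\<Sum>q\<in>Q. J' q r * cnj (J' q s)) = (if r = s then 1 else 0)" if "r \<in> R" "s \<in> R" for r s
  proof -
    have "\<phi> r \<in> Q" "\<phi> s \<in> Q" using \<phi>(2) that by auto
    moreover have "\<phi> r = \<phi> s \<longleftrightarrow> r = s" using \<phi>(1) that by (auto simp: inj_on_def)
    ultimately show ?thesis unfolding J'_def using iso by simp
  qed
  ultimately show ?thesis using that by blast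
qed

text \<open>Converse of \<open>kraus_freedom\<close>: orthonormal columns cancel all cross terms.
  The relation between the families is assumed only under \<open>ip\<close>, the form in which the
  lifts provide it.\<close>

lemma kmap_isometry:
  assumes A: "fd_hilbert A" and B: "fd_hilbert B" and R: "finite R"
    and U: "\<forall>r\<in>R. U r \<in> lin A B" and W: "\<forall>q\<in>Q. W q \<in> lin A B"
    and J: "\<And>q x z. q \<in> Q \<Longrightarrow> x \<in> carrier A \<Longrightarrow> z \<in> carrier B \<Longrightarrow> ip B (W q x) z = (\<Sum>r\<in>R. J q r * ip B (U r x) z)"
    and iso: "\<And>r s. r \<in> R \<Longrightarrow> s \<in> R \<Longrightarrow> (\<Sum>q\<in>Q. J q r * cnj (J q s)) = (if r = s then 1 else 0)"
  shows "kmap A B Q W = kmap A B R U"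
proof (rule kmap_eqI[OF A B W U])
  fix x y z w assume xy: "x \<in> carrier A" "y \<in> carrier A" and zw: "z \<in> carrier B" "w \<in> carrier B"
  have cW: "ip B z (W q y) = (\<Sum>s\<in>R. cnj (J q s) * ip B z (U s y))" if q: "q \<in> Q" for q
  proof -
    have "ip B z (W q y) = cnj (ip B (W q y) z)"
      using ip_cnj[OF B lin_simps(1)[OF bspec[OF W q] xy(2)] zw(1)] by simp
    also have "\<dots> = (\<Sum>s\<in>R. cnj (J q s) * ip B z (U s y))"
      unfolding J[OF q xy(2) zw(1)] cnj_sum
      by (rule sum.cong) (simp_all add: ip_cnj[OF B lin_simps(1)[OF bspec[OF U] xy(2)] zw(1)])
    finally show ?thesis .
  qed
  have "(\<Sum>q\<in>Q. ip B z (W q y) * ip B (W q x) w) =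
      (\<Sum>q\<in>Q. \<Sum>s\<in>R. \<Sum>r\<in>R. (J q r * cnj (J q s)) * (ip B z (U s y) * ip B (U r x) w))"
    by (rule sum.cong[OF refl], simp only: cW J[OF _ xy(1) zw(2)] sum_product) (simp only: mult_ac)
  also have "\<dots> = (\<Sum>s\<in>R. \<Sum>r\<in>R. (\<Sum>q\<in>Q. J q r * cnj (J q s)) * (ip B z (U s y) * ip B (U r x) w))"
    by (subst sum.swap, rule sum.cong[OF refl], subst sum.swap) (simp add: sum_distrib_right)
  also have "\<dots> = (\<Sum>s\<in>R. \<Sum>r\<in>R. if s = r then ip B z (U s y) * ip B (U r x) w else 0)"
    by (intro sum.cong) (auto simp: iso)
  also have "\<dots> = (\<Sum>r\<in>R. ip B z (U r y) * ip B (U r x) w)" using R by simp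
  finally show "(\<Sum>q\<in>Q. ip B z (W q y) * ip B (W q x) w) = \<dots>" .
qed

lemma lin_zero:
  assumes A: "fd_hilbert A" and B: "fd_hilbert B" and K: "K \<in> lin A B"
  shows "K \<zero>\<^bsub>A\<^esub> = \<zero>\<^bsub>B\<^esub>"
proof -
  obtain E where E: "onb A E" using onb_exists[OF A] .
  have 0: "\<zero>\<^bsub>A\<^esub> \<in> carrier A" using A by simp
  show ?thesis
  proof (rule ip_eqI[OF B lin_simps(1)[OF K 0]])
    show "ip B (K \<zero>\<^bsub>A\<^esub>) z = ip B \<zero>\<^bsub>B\<^esub> z" if z: "z \<in> carrier B" for z
      unfolding lin_onb[OF A B K E 0 z] using A B z onb_simps(2)[OF E] by simp
  qed (use B in simp)
qed

lemma kmap_comp_single_left: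
  assumes A: "fd_hilbert A" and B: "fd_hilbert B" and C: "fd_hilbert C"
    and K: "\<forall>i\<in>I. K i \<in> lin A B" and M: "M \<in> lin B C" and fin: "finite I"
  shows "compose (carrier (L A)) (kmap B C {()} (\<lambda>_. M)) (kmap A B I K) = kmap A C I (\<lambda>i x. M (K i x))"
proof -
  have M': "\<forall>j\<in>{()}. M \<in> lin B C" using M by simp
  have MK: "\<forall>i\<in>I. (\<lambda>x. M (K i x)) \<in> lin A C" using lin_comp[OF _ M] K by blast
  have "bij_betw (\<lambda>i. ((), i)) I ({()} \<times> I)" by (auto simp: bij_betw_def inj_on_def)
  from kmap_reindex[OF A C _ this, of "\<lambda>p x. M (K (snd p) x)"] show ?thesis
    unfolding kmap_comp[OF A B C K M' fin] using MK by simp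
qed

lemma kmap_comp_single_right:
  assumes A: "fd_hilbert A" and B: "fd_hilbert B" and C: "fd_hilbert C"
    and K: "K \<in> lin A B" and M: "\<forall>j\<in>J. M j \<in> lin B C"
  shows "compose (carrier (L A)) (kmap B C J M) (kmap A B {()} (\<lambda>_. K)) = kmap A C J (\<lambda>j x. M j (K x))"
proof -
  have K': "\<forall>i\<in>{()}. K \<in> lin A B" using K by simp
  have MK: "\<forall>j\<in>J. (\<lambda>x. M j (K x)) \<in> lin A C" using lin_comp[OF K] M by blast
  have "bij_betw (\<lambda>j. (j, ())) J (J \<times> {()})" by (auto simp: bij_betw_def inj_on_def)
  from kmap_reindex[OF A C _ this, of "\<lambda>p x. M (fst p) (K x)"] show ?thesis
    unfolding kmap_comp[OF A B C K' M finite.intros(2)[OF finite.intros(1)]] using MK by simp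
qed

subsection \<open>Lifting along partial isometries\<close>

text \<open>The maps \<open>\<iota> f\<close> and \<open>\<pi> f\<close> present \<open>Z\<close> as a direct sum of copies of \<open>Y\<close>. For \<open>Z = X \<otimes> A'\<close> and
  \<open>Y = \<complex> \<otimes> A'\<close>, tensoring with the mixed state of \<open>X\<close> has the Kraus family \<open>\<iota>\<close>, and tensoring with the
  discarding effect has the Kraus family \<open>\<pi>\<close>.\<close>

locale direct_sum =
  fixes Y Z :: "'a hilb" and F :: "'f set" and \<iota> \<pi> :: "'f \<Rightarrow> 'a \<Rightarrow> 'a"
  assumes Y: "fd_hilbert Y" and Z: "fd_hilbert Z" and fin: "finite F" and ne: "F \<noteq> {}"
    and \<iota>: "\<forall>f\<in>F. \<iota> f \<in> lin Y Z" and \<pi>: "\<forall>f\<in>F. \<pi> f \<in> lin Z Y"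
    and \<pi>\<iota>: "\<And>f g x. f \<in> F \<Longrightarrow> g \<in> F \<Longrightarrow> x \<in> carrier Y \<Longrightarrow> \<pi> g (\<iota> f x) = (if f = g then x else \<zero>\<^bsub>Y\<^esub>)"
    and \<iota>\<pi>: "\<And>z. z \<in> carrier Z \<Longrightarrow> finsum Z (\<lambda>f. \<iota> f (\<pi> f z)) F = z"
begin

lemma \<iota>\<pi>_closed: "f \<in> F \<Longrightarrow> y \<in> carrier Y \<Longrightarrow> \<iota> f y \<in> carrier Z" "f \<in> F \<Longrightarrow> z \<in> carrier Z \<Longrightarrow> \<pi> f z \<in> carrier Y"
  using lin_simps(1)[OF bspec[OF \<iota>]] lin_simps(1)[OF bspec[OF \<pi>]] by auto

text \<open>The cardinality condition of \<open>kraus_freedom\<close>. For empty \<open>F\<close>,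
  the case of the mixed state of the zero space, it would fail.\<close>

lemma card_le: "n \<le> m \<Longrightarrow> n \<le> m * card F"
  using fin ne by (metis card_gt_0_iff mult_le_mono1 mult_le_mono2 nat_mult_1_right le_trans Suc_leI One_nat_def)

text \<open>With W_j \<iota>_f = \<Sum>_r J((j,f),r) V U_r, take H_j = \<Sum>_(r,f) J((j,f),r) U_r
  \<pi>_f. Then H_j \<iota>_f = \<Sum>_r J((j,f),r) U_r is an isometric mixture of the U_r, and V
  H_j = \<Sum>_f W_j \<iota>_f \<pi>_f = W_j. So \<open>U\<close> is matched only as a map,
  \<open>W\<close> operator by operator.\<close>

lemma lift_pure:
  fixes n m :: nat
  assumes C: "fd_hilbert C" and D: "fd_hilbert D" and V: "V \<in> lin C D"
    and U: "\<forall>i\<in>{..<n}. U i \<in> lin Y C" and W: "\<forall>j\<in>{..<m}. W j \<in> lin Z D" and nm: "n \<le> m"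
    and eq: "compose (carrier (L Y)) (kmap C D {()} (\<lambda>_. V)) (kmap Y C {..<n} U) =
      compose (carrier (L Y)) (kmap Z D {..<m} W) (kmap Y Z F \<iota>)"
  shows "\<exists>H. (\<forall>j\<in>{..<m}. H j \<in> lin Z C) \<and>
    compose (carrier (L Y)) (kmap Z C {..<m} H) (kmap Y Z F \<iota>) = kmap Y C {..<n} U \<and>
    compose (carrier (L Z)) (kmap C D {()} (\<lambda>_. V)) (kmap Z C {..<m} H) = kmap Z D {..<m} W"
proof -
  let ?Q = "{..<m} \<times> F"
  have VU: "\<forall>r\<in>{..<n}. (\<lambda>x. V (U r x)) \<in> lin Y D" using lin_comp[OF _ V] U by blast
  have W\<iota>: "\<forall>q\<in>?Q. (\<lambda>x. W (fst q) (\<iota> (snd q) x)) \<in> lin Y D"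
  proof
    fix q assume "q \<in> ?Q"
    then show "(\<lambda>x. W (fst q) (\<iota> (snd q) x)) \<in> lin Y D"
      using lin_comp[of "\<iota> (snd q)" Y Z "W (fst q)" D] W \<iota> by auto
  qed
  have "kmap Y D {..<n} (\<lambda>r x. V (U r x)) = kmap Y D ?Q (\<lambda>q x. W (fst q) (\<iota> (snd q) x))"
    using eq unfolding kmap_comp_single_left[OF Y C D U V finite_lessThan] kmap_comp[OF Y Z D \<iota> W fin] .
  then obtain J :: "nat \<times> 'f \<Rightarrow> nat \<Rightarrow> complex" where
    J: "\<And>q x. q \<in> ?Q \<Longrightarrow> x \<in> carrier Y \<Longrightarrow> W (fst q) (\<iota> (snd q) x) = finsum D (\<lambda>r. J q r \<odot>\<^bsub>D\<^esub> V (U r x)) {..<n}"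
    and iso: "\<And>r s. r \<in> {..<n} \<Longrightarrow> s \<in> {..<n} \<Longrightarrow> (\<Sum>q\<in>?Q. J q r * cnj (J q s)) = (if r = s then 1 else 0)"
    using kraus_freedom[OF Y D _ _ _ VU W\<iota>] fin card_le[OF nm] by (auto simp: card_cartesian_product)
  define H where "H j z = finsum C (\<lambda>p. J (j, snd p) (fst p) \<odot>\<^bsub>C\<^esub> U (fst p) (\<pi> (snd p) z)) ({..<n} \<times> F)" for j z
  have U\<pi>: "(\<lambda>z. U (fst p) (\<pi> (snd p) z)) \<in> lin Z C" if "p \<in> {..<n} \<times> F" for p
    using lin_comp[of "\<pi> (snd p)" Z Y "U (fst p)" C] U \<pi> that by auto
  have H: "\<forall>j\<in>{..<m}. H j \<in> lin Z C" unfolding H_def by (intro ballI lin_lincomb[OF Z C U\<pi>])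
  have Hip: "ip C (H j z) w = (\<Sum>r<n. \<Sum>f\<in>F. J (j, f) r * ip C (U r (\<pi> f z)) w)"
    if "z \<in> carrier Z" "w \<in> carrier C" for j z w
    unfolding H_def using C that lin_simps(1)[OF U\<pi>] by (simp add: sum.cartesian_product split_beta)
  have "compose (carrier (L Y)) (kmap Z C {..<m} H) (kmap Y Z F \<iota>) =
      kmap Y C ?Q (\<lambda>q x. H (fst q) (\<iota> (snd q) x))"
    by (rule kmap_comp[OF Y Z C \<iota> H fin])
  also have "\<dots> = kmap Y C {..<n} U"
  proof (rule kmap_isometry[where J = J, OF Y C finite_lessThan U _ _ iso])
    show "\<forall>q\<in>?Q. (\<lambda>x. H (fst q) (\<iota> (snd q) x)) \<in> lin Y C"
    proof
      fix q assume "q \<in> ?Q"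
      then show "(\<lambda>x. H (fst q) (\<iota> (snd q) x)) \<in> lin Y C"
        using lin_comp[of "\<iota> (snd q)" Y Z "H (fst q)" C] H \<iota> by auto
    qed
    fix q x z assume q: "q \<in> ?Q" and x: "x \<in> carrier Y" and z: "z \<in> carrier C"
    obtain j f where jf: "q = (j, f)" "f \<in> F" using q by auto
    have "ip C (H j (\<iota> f x)) z = (\<Sum>r<n. \<Sum>g\<in>F. J (j, g) r * ip C (U r (\<pi> g (\<iota> f x))) z)"
      by (rule Hip[OF \<iota>\<pi>_closed(1)[OF jf(2) x] z])
    also have "\<dots> = (\<Sum>r<n. \<Sum>g\<in>F. if f = g then J (j, g) r * ip C (U r x) z else 0)"
      by (intro sum.cong refl) (use \<pi>\<iota>[OF jf(2) _ x] lin_zero[OF Y C bspec[OF U]] C z in auto)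
    also have "\<dots> = (\<Sum>r<n. J (j, f) r * ip C (U r x) z)" using fin jf by simp
    finally show "ip C (H (fst q) (\<iota> (snd q) x)) z = (\<Sum>r<n. J q r * ip C (U r x) z)" using jf by simp
  qed
  finally have 1: "compose (carrier (L Y)) (kmap Z C {..<m} H) (kmap Y Z F \<iota>) = kmap Y C {..<n} U" .
  have VH: "V (H j z) = W j z" if j: "j \<in> {..<m}" and z: "z \<in> carrier Z" for j z
  proof (rule ip_eqI[OF D])
    have Hc: "H j z \<in> carrier C" and Wl: "W j \<in> lin Z D" using lin_simps(1)[OF bspec[OF H j] z] W j by auto
    show "V (H j z) \<in> carrier D" "W j z \<in> carrier D" using lin_simps(1)[OF V Hc] lin_simps(1)[OF Wl z] by auto
    fix w assume w: "w \<in> carrier D"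
    have "V (H j z) = finsum D (\<lambda>p. V (J (j, snd p) (fst p) \<odot>\<^bsub>C\<^esub> U (fst p) (\<pi> (snd p) z))) ({..<n} \<times> F)"
      unfolding H_def by (rule lin_finsum[OF C D V]) (use C lin_simps(1)[OF U\<pi> z] in simp)
    also have "\<dots> = finsum D (\<lambda>p. J (j, snd p) (fst p) \<odot>\<^bsub>D\<^esub> V (U (fst p) (\<pi> (snd p) z))) ({..<n} \<times> F)"
      by (rule ip_eqI[OF D]) (use C D lin_simps(1)[OF U\<pi> z] lin_simps[OF V] in simp_all)
    finally have "ip D (V (H j z)) w = (\<Sum>r<n. \<Sum>f\<in>F. J (j, f) r * ip D (V (U r (\<pi> f z))) w)"
      using D w lin_simps(1)[OF U\<pi> z] lin_simps(1)[OF V] by (simp add: sum.cartesian_product split_beta)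
    also have "\<dots> = (\<Sum>f\<in>F. \<Sum>r<n. J (j, f) r * ip D (V (U r (\<pi> f z))) w)" by (rule sum.swap)
    also have "\<dots> = (\<Sum>f\<in>F. ip D (W j (\<iota> f (\<pi> f z))) w)"
    proof (rule sum.cong[OF refl])
      fix f assume f: "f \<in> F"
      have c: "V (U r (\<pi> f z)) \<in> carrier D" if "r \<in> {..<n}" for r
        using lin_simps(1)[OF bspec[OF VU that] \<iota>\<pi>_closed(2)[OF f z]] .
      have c': "J (j, f) r \<odot>\<^bsub>D\<^esub> V (U r (\<pi> f z)) \<in> carrier D" if "r \<in> {..<n}" for r
        using D c[OF that] by simp
      have "W j (\<iota> f (\<pi> f z)) = finsum D (\<lambda>r. J (j, f) r \<odot>\<^bsub>D\<^esub> V (U r (\<pi> f z))) {..<n}"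
        using J[of "(j, f)" "\<pi> f z"] f j \<iota>\<pi>_closed(2)[OF f z] by simp
      then have "ip D (W j (\<iota> f (\<pi> f z))) w = (\<Sum>r<n. ip D (J (j, f) r \<odot>\<^bsub>D\<^esub> V (U r (\<pi> f z))) w)"
        by (simp only:) (rule ip_finsum(1)[OF D c' w])
      also have "\<dots> = (\<Sum>r<n. J (j, f) r * ip D (V (U r (\<pi> f z))) w)"
        by (rule sum.cong[OF refl]) (use D c w in simp)
      finally show "(\<Sum>r<n. J (j, f) r * ip D (V (U r (\<pi> f z))) w) = ip D (W j (\<iota> f (\<pi> f z))) w" by simp
    qed
    also have "\<dots> = ip D (W j (finsum Z (\<lambda>f. \<iota> f (\<pi> f z)) F)) w"
      using lin_finsum[OF Z D Wl, of F "\<lambda>f. \<iota> f (\<pi> f z)"] D w \<iota>\<pi>_closed z lin_simps(1)[OF Wl] by simp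
    also have "\<dots> = ip D (W j z) w" unfolding \<iota>\<pi>[OF z] ..
    finally show "ip D (V (H j z)) w = ip D (W j z) w" .
  qed
  have VH': "\<forall>j\<in>{..<m}. (\<lambda>z. V (H j z)) \<in> lin Z D" using lin_comp[OF _ V] H by blast
  have "compose (carrier (L Z)) (kmap C D {()} (\<lambda>_. V)) (kmap Z C {..<m} H) = kmap Z D {..<m} W"
    unfolding kmap_comp_single_left[OF Z C D H V finite_lessThan] by (rule kmap_cong[OF Z D VH' W VH])
  with H 1 show ?thesis by blast
qed

text \<open>Dual computation with \<pi>_f U_k = \<Sum>_r J((f,k),r) W_r V and H_k = \<Sum>_(r,f)
  J((f,k),r) \<iota>_f W_r. Now H_k V = \<Sum>_f \<iota>_f \<pi>_f U_k = U_k holds operator by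
  operator, and the isometry serves for \<pi>_f H_k. The family \<open>U\<close> must be the longer
  one here, hence m \<le> n.\<close>

lemma lift_copure:
  fixes n m :: nat
  assumes A: "fd_hilbert A" and B: "fd_hilbert B" and V: "V \<in> lin A B"
    and U: "\<forall>i\<in>{..<n}. U i \<in> lin A Z" and W: "\<forall>j\<in>{..<m}. W j \<in> lin B Y" and mn: "m \<le> n"
    and eq: "compose (carrier (L A)) (kmap Z Y F \<pi>) (kmap A Z {..<n} U) =
      compose (carrier (L A)) (kmap B Y {..<m} W) (kmap A B {()} (\<lambda>_. V))"
  shows "\<exists>H. (\<forall>j\<in>{..<n}. H j \<in> lin B Z) \<and>
    compose (carrier (L A)) (kmap B Z {..<n} H) (kmap A B {()} (\<lambda>_. V)) = kmap A Z {..<n} U \<and>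
    compose (carrier (L B)) (kmap Z Y F \<pi>) (kmap B Z {..<n} H) = kmap B Y {..<m} W"
proof -
  let ?Q = "F \<times> {..<n}"
  have WV: "\<forall>r\<in>{..<m}. (\<lambda>x. W r (V x)) \<in> lin A Y" using lin_comp[OF V] W by blast
  have \<pi>U: "\<forall>q\<in>?Q. (\<lambda>x. \<pi> (fst q) (U (snd q) x)) \<in> lin A Y"
  proof
    fix q assume "q \<in> ?Q"
    then show "(\<lambda>x. \<pi> (fst q) (U (snd q) x)) \<in> lin A Y"
      using lin_comp[of "U (snd q)" A Z "\<pi> (fst q)" Y] U \<pi> by auto
  qed
  have "kmap A Y {..<m} (\<lambda>r x. W r (V x)) = kmap A Y ?Q (\<lambda>q x. \<pi> (fst q) (U (snd q) x))"
    using eq unfolding kmap_comp_single_right[OF A B Y V W] kmap_comp[OF A Z Y U \<pi> finite_lessThan] by simp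
  then obtain J :: "'f \<times> nat \<Rightarrow> nat \<Rightarrow> complex" where
    J: "\<And>q x. q \<in> ?Q \<Longrightarrow> x \<in> carrier A \<Longrightarrow> \<pi> (fst q) (U (snd q) x) = finsum Y (\<lambda>r. J q r \<odot>\<^bsub>Y\<^esub> W r (V x)) {..<m}"
    and iso: "\<And>r s. r \<in> {..<m} \<Longrightarrow> s \<in> {..<m} \<Longrightarrow> (\<Sum>q\<in>?Q. J q r * cnj (J q s)) = (if r = s then 1 else 0)"
    using kraus_freedom[OF A Y _ _ _ WV \<pi>U] fin card_le[OF mn] by (auto simp: card_cartesian_product mult.commute)
  define H where "H k z = finsum Z (\<lambda>p. J (snd p, k) (fst p) \<odot>\<^bsub>Z\<^esub> \<iota> (snd p) (W (fst p) z)) ({..<m} \<times> F)" for k z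
  have \<iota>W: "(\<lambda>z. \<iota> (snd p) (W (fst p) z)) \<in> lin B Z" if "p \<in> {..<m} \<times> F" for p
    using lin_comp[of "W (fst p)" B Y "\<iota> (snd p)" Z] W \<iota> that by auto
  have H: "\<forall>j\<in>{..<n}. H j \<in> lin B Z" unfolding H_def by (intro ballI lin_lincomb[OF B Z \<iota>W])
  have HV: "H k (V x) = U k x" if k: "k \<in> {..<n}" and x: "x \<in> carrier A" for k x
  proof (rule ip_eqI[OF Z])
    have Vx: "V x \<in> carrier B" and Uc: "U k x \<in> carrier Z" using lin_simps(1)[OF V x] lin_simps(1)[OF bspec[OF U k] x] by auto
    show "H k (V x) \<in> carrier Z" "U k x \<in> carrier Z" using lin_simps(1)[OF bspec[OF H k] Vx] Uc by auto
    fix w assume w: "w \<in> carrier Z"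
    have "ip Z (H k (V x)) w = (\<Sum>r<m. \<Sum>f\<in>F. J (f, k) r * ip Z (\<iota> f (W r (V x))) w)"
      unfolding H_def using Z w lin_simps(1)[OF \<iota>W Vx] by (simp add: sum.cartesian_product split_beta)
    also have "\<dots> = (\<Sum>f\<in>F. \<Sum>r<m. J (f, k) r * ip Z (\<iota> f (W r (V x))) w)" by (rule sum.swap)
    also have "\<dots> = (\<Sum>f\<in>F. ip Z (\<iota> f (\<pi> f (U k x))) w)"
    proof (rule sum.cong[OF refl])
      fix f assume f: "f \<in> F"
      have c: "W r (V x) \<in> carrier Y" if "r \<in> {..<m}" for r using lin_simps(1)[OF bspec[OF WV that] x] .
      have "\<iota> f (\<pi> f (U k x)) = \<iota> f (finsum Y (\<lambda>r. J (f, k) r \<odot>\<^bsub>Y\<^esub> W r (V x)) {..<m})"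
        using J[of "(f, k)" x] f k x by simp
      also have "\<dots> = finsum Z (\<lambda>r. \<iota> f (J (f, k) r \<odot>\<^bsub>Y\<^esub> W r (V x))) {..<m}"
        by (rule lin_finsum[OF Y Z bspec[OF \<iota> f]]) (use Y c in simp)
      finally have e: "\<iota> f (\<pi> f (U k x)) = \<dots>" .
      have c': "\<iota> f (J (f, k) r \<odot>\<^bsub>Y\<^esub> W r (V x)) \<in> carrier Z" if "r \<in> {..<m}" for r
        by (rule lin_simps(1)[OF bspec[OF \<iota> f]]) (use Y c[OF that] in simp)
      have "ip Z (\<iota> f (\<pi> f (U k x))) w = (\<Sum>r<m. ip Z (\<iota> f (J (f, k) r \<odot>\<^bsub>Y\<^esub> W r (V x))) w)"
        unfolding e by (rule ip_finsum(1)[OF Z c' w])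
      also have "\<dots> = (\<Sum>r<m. J (f, k) r * ip Z (\<iota> f (W r (V x))) w)"
        by (rule sum.cong[OF refl]) (use Z c w lin_simps[OF bspec[OF \<iota> f]] in simp)
      finally show "(\<Sum>r<m. J (f, k) r * ip Z (\<iota> f (W r (V x))) w) = ip Z (\<iota> f (\<pi> f (U k x))) w" by simp
    qed
    also have "\<dots> = ip Z (finsum Z (\<lambda>f. \<iota> f (\<pi> f (U k x))) F) w"
      using Z w \<iota>\<pi>_closed Uc by simp
    also have "\<dots> = ip Z (U k x) w" unfolding \<iota>\<pi>[OF Uc] ..
    finally show "ip Z (H k (V x)) w = ip Z (U k x) w" .
  qed
  have HV': "\<forall>j\<in>{..<n}. (\<lambda>x. H j (V x)) \<in> lin A Z" using lin_comp[OF V] H by blast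
  have 1: "compose (carrier (L A)) (kmap B Z {..<n} H) (kmap A B {()} (\<lambda>_. V)) = kmap A Z {..<n} U"
    unfolding kmap_comp_single_right[OF A B Z V H] by (rule kmap_cong[OF A Z HV' U HV])
  have "compose (carrier (L B)) (kmap Z Y F \<pi>) (kmap B Z {..<n} H) =
      kmap B Y ?Q (\<lambda>q z. \<pi> (fst q) (H (snd q) z))"
    by (rule kmap_comp[OF B Z Y H \<pi> finite_lessThan])
  also have "\<dots> = kmap B Y {..<m} W"
  proof (rule kmap_isometry[where J = J, OF B Y finite_lessThan W _ _ iso])
    show "\<forall>q\<in>?Q. (\<lambda>z. \<pi> (fst q) (H (snd q) z)) \<in> lin B Y"
    proof
      fix q assume "q \<in> ?Q"
      then show "(\<lambda>z. \<pi> (fst q) (H (snd q) z)) \<in> lin B Y"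
        using lin_comp[of "H (snd q)" B Z "\<pi> (fst q)" Y] H \<pi> by auto
    qed
    fix q x z assume q: "q \<in> ?Q" and x: "x \<in> carrier B" and z: "z \<in> carrier Y"
    obtain g k where gk: "q = (g, k)" "g \<in> F" using q by auto
    note \<pi>l = lin_simps[OF bspec[OF \<pi> gk(2)]]
    have Wc: "W r x \<in> carrier Y" if "r \<in> {..<m}" for r using lin_simps(1)[OF bspec[OF W that] x] .
    have \<iota>Wc: "\<iota> (snd p) (W (fst p) x) \<in> carrier Z" if "p \<in> {..<m} \<times> F" for p using lin_simps(1)[OF \<iota>W[OF that] x] .
    have "\<pi> g (H k x) = finsum Y (\<lambda>p. \<pi> g (J (snd p, k) (fst p) \<odot>\<^bsub>Z\<^esub> \<iota> (snd p) (W (fst p) x))) ({..<m} \<times> F)"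
      unfolding H_def by (rule lin_finsum[OF Z Y bspec[OF \<pi> gk(2)]]) (use Z \<iota>Wc in simp)
    then have "ip Y (\<pi> g (H k x)) z = (\<Sum>p\<in>{..<m} \<times> F. J (snd p, k) (fst p) * ip Y (\<pi> g (\<iota> (snd p) (W (fst p) x))) z)"
      using Y Z z \<iota>Wc \<pi>l by simp
    also have "\<dots> = (\<Sum>r<m. \<Sum>f\<in>F. J (f, k) r * ip Y (\<pi> g (\<iota> f (W r x))) z)"
      by (simp add: sum.cartesian_product split_beta)
    also have "\<dots> = (\<Sum>r<m. \<Sum>f\<in>F. if f = g then J (f, k) r * ip Y (W r x) z else 0)"
      by (intro sum.cong refl) (use \<pi>\<iota>[OF _ gk(2) Wc] Y z in auto)
    also have "\<dots> = (\<Sum>r<m. J (g, k) r * ip Y (W r x) z)" using fin gk by simp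
    finally show "ip Y (\<pi> (fst q) (H (snd q) x)) z = (\<Sum>r<m. J q r * ip Y (W r x) z)" using gk by simp
  qed
  finally show ?thesis using H 1 by blast
qed

end

subsection \<open>The unit object, mixed states and discarding effects\<close>

definition uvec :: "complex vec" where "uvec = unit_vec 1 0"

lemma hunit_cspace: "hunit = cspace 1"
  unfolding hunit_def cspace_def ..

lemma hunit_hilbert [simp]: "fd_hilbert hunit"
  unfolding hunit_cspace by (rule cspace_hilbert)

lemma hunit_onb: "onb hunit {uvec}"
proof -
  have "unit_vec 1 ` {..<1::nat} = {uvec}" unfolding uvec_def by auto
  then show ?thesis unfolding hunit_cspace using cspace_onb[of 1] by simp
qed

lemma uvec_simps [simp]: "uvec \<in> carrier hunit" "ip hunit uvec uvec = 1"
  using onb_simps(2)[OF hunit_onb, of uvec] onb_simps(3)[OF hunit_onb, of uvec uvec] by simp_all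

lemma hunit_ip:
  assumes "x \<in> carrier hunit" "y \<in> carrier hunit"
  shows "ip hunit x y = ip hunit x uvec * ip hunit uvec y"
  using onb_ip[OF hunit_hilbert hunit_onb assms] by simp

text \<open>The ket |f> as a map from C to \<open>A\<close>; \<open>proj_vec\<close> is the bra
  <f|.\<close>

definition inj_vec :: "hsp \<Rightarrow> complex vec \<Rightarrow> complex vec \<Rightarrow> complex vec" where
  "inj_vec A f = (\<lambda>z. ip hunit z uvec \<odot>\<^bsub>A\<^esub> f)"

definition proj_vec :: "hsp \<Rightarrow> complex vec \<Rightarrow> complex vec \<Rightarrow> complex vec" where
  "proj_vec A f = (\<lambda>x. ip A x f \<odot>\<^bsub>hunit\<^esub> uvec)"

lemma inj_vec_lin: "fd_hilbert A \<Longrightarrow> f \<in> carrier A \<Longrightarrow> inj_vec A f \<in> lin hunit A"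
  unfolding inj_vec_def by (rule linI_ip) (simp_all add: algebra_simps)

lemma proj_vec_lin: "fd_hilbert A \<Longrightarrow> f \<in> carrier A \<Longrightarrow> proj_vec A f \<in> lin A hunit"
  unfolding proj_vec_def by (rule linI_ip) (simp_all add: algebra_simps)

lemma inj_vec_uvec: "fd_hilbert A \<Longrightarrow> f \<in> carrier A \<Longrightarrow> inj_vec A f uvec = f"
  by (rule ip_eqI) (auto simp: inj_vec_def)

lemma proj_vec_onb:
  assumes "fd_hilbert A" "onb A F" "f \<in> F" "g \<in> F"
  shows "proj_vec A g f = (if f = g then uvec else \<zero>\<^bsub>hunit\<^esub>)"
  by (rule ip_eqI[of hunit]) (use assms in \<open>auto simp: proj_vec_def onb_simps\<close>)

text \<open>In dimension one the identity has rank one, so \<open>kmap_ketbra\<close> evaluates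
  Kraus maps on it.\<close>

lemma one_hunit_ketbra: "one (L hunit) = ketbra hunit uvec uvec"
proof (rule op_eqI[of hunit])
  fix x y assume xy: "x \<in> carrier hunit" "y \<in> carrier hunit"
  show "ip hunit (one (L hunit) x) y = ip hunit (ketbra hunit uvec uvec x) y"
    using xy hunit_ip[OF xy] by simp
qed simp_all

text \<open>L(C) is spanned by its identity; this settles uniqueness in the description of
  \<open>mixed_state\<close>.\<close>

lemma unit_superop_eqI:
  assumes A: "fd_hilbert A" and f: "f \<in> superops hunit A" and g: "g \<in> superops hunit A"
    and eq: "f (one (L hunit)) = g (one (L hunit))"
  shows "f = g"
  by (rule superop_eqI[OF hunit_hilbert A f g hunit_onb]) (use eq one_hunit_ketbra in simp)

text \<open>The resolution of the identity into operators |f><f|. Any basis \<open>F\<close> will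
  do, so the one that indexes a given Kraus family can be taken.\<close>

lemma mixed_state_kmap:
  assumes A: "fd_hilbert A" and F: "onb A F"
  shows "mixed_state A = QArr hunit (kmap hunit A F (inj_vec A)) A"
proof -
  note Fs = onb_simps[OF F]
  have l: "\<forall>f\<in>F. inj_vec A f \<in> lin hunit A" using inj_vec_lin[OF A] Fs by simp
  note k = kmap_superop[OF hunit_hilbert A l]
  have one: "one (L hunit) \<in> carrier (L hunit)" by simp
  have e: "kmap hunit A F (inj_vec A) (one (L hunit)) = one (L A)"
  proof (rule op_eqI[OF A superops_simps(1)[OF k one]])
    fix x y assume xy: "x \<in> carrier A" "y \<in> carrier A"
    have "ip A (kmap hunit A F (inj_vec A) (one (L hunit)) x) y = (\<Sum>f\<in>F. ip A x f * ip A f y)"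
      unfolding one_hunit_ketbra using kmap_ketbra[OF hunit_hilbert A l uvec_simps(1) uvec_simps(1) xy]
      by (simp add: inj_vec_uvec[OF A] Fs)
    also have "\<dots> = ip A (one (L A) x) y" using onb_ip[OF A F xy] xy by simp
    finally show "ip A (kmap hunit A F (inj_vec A) (one (L hunit)) x) y = ip A (one (L A) x) y" .
  qed (use A in simp)
  have "(THE m. m \<in> superops hunit A \<and> m (one (L hunit)) = one (L A)) = kmap hunit A F (inj_vec A)"
  proof (rule the_equality)
    show "kmap hunit A F (inj_vec A) \<in> superops hunit A \<and> kmap hunit A F (inj_vec A) (one (L hunit)) = one (L A)"
      using k e by blast
    fix m assume m: "m \<in> superops hunit A \<and> m (one (L hunit)) = one (L A)"
    show "m = kmap hunit A F (inj_vec A)"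
      by (rule unit_superop_eqI[OF A _ k]) (use m e in auto)
  qed
  then show ?thesis unfolding mixed_state_def by simp
qed

text \<open>Basis independence follows by expanding each \<open>f\<close> in \<open>E\<close> and
  exchanging the sums; it makes the description in \<open>op_trace\<close> meaningful.\<close>

lemma op_trace:
  assumes A: "fd_hilbert A" and E: "onb A E" and T: "T \<in> carrier (L A)"
  shows "op_trace A T = (\<Sum>e\<in>E. ip A (T e) e)"
  unfolding op_trace_def
proof (rule the_equality)
  note Es = onb_simps[OF E]
  have "(\<Sum>e\<in>E. ip A (T e) e) = (\<Sum>f\<in>F. ip A (T f) f)" if F: "onb A F" for F
  proof -
    note Fs = onb_simps[OF F]
    have "(\<Sum>f\<in>F. ip A (T f) f) = (\<Sum>f\<in>F. \<Sum>e\<in>E. ip A f e * ip A (T e) f)"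
      by (rule sum.cong[OF refl]) (simp add: lin_onb[OF A A L_lin[OF T] E] Fs)
    also have "\<dots> = (\<Sum>e\<in>E. \<Sum>f\<in>F. ip A (T e) f * ip A f e)"
      by (subst sum.swap) (simp add: mult.commute)
    also have "\<dots> = (\<Sum>e\<in>E. ip A (T e) e)"
      by (rule sum.cong[OF refl], rule onb_ip[OF A F, symmetric]) (use T Es in simp_all)
    finally show ?thesis by simp
  qed
  then show "\<forall>F. onb A F \<longrightarrow> (\<Sum>e\<in>E. ip A (T e) e) = (\<Sum>f\<in>F. ip A (T f) f)" by blast
  show "t = (\<Sum>e\<in>E. ip A (T e) e)" if "\<forall>E. onb A E \<longrightarrow> t = (\<Sum>e\<in>E. ip A (T e) e)" for t
    using that E by blast
qed

text \<open>The trace is the sum of <f| R |f> over the basis, and \<open>hunit_ip\<close> splits the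
  inner product of C into one factor for each of the two bras.\<close>

lemma discard_kmap:
  assumes A: "fd_hilbert A" and F: "onb A F"
  shows "discard A = QArr A (kmap A hunit F (proj_vec A)) hunit"
proof -
  note Fs = onb_simps[OF F]
  have l: "\<forall>f\<in>F. proj_vec A f \<in> lin A hunit" using proj_vec_lin[OF A] Fs by simp
  define d where "d = (\<lambda>R \<in> carrier (L A). op_trace A R \<odot>\<^bsub>L hunit\<^esub> \<one>\<^bsub>L hunit\<^esub>)"
  have one: "one (L hunit) \<in> carrier (L hunit)" by simp
  have dc: "d R = (\<lambda>x \<in> carrier hunit. op_trace A R \<odot>\<^bsub>hunit\<^esub> one (L hunit) x)" if "R \<in> carrier (L A)" for R
    unfolding d_def using that by simp
  have dip: "ip hunit (d R b) c = (\<Sum>f\<in>F. ip A (R f) f) * ip hunit b c"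
    if "R \<in> carrier (L A)" "b \<in> carrier hunit" "c \<in> carrier hunit" for R b c
    using that by (simp add: dc op_trace[OF A F])
  have d: "d \<in> superops A hunit"
  proof (rule superopsI[OF A hunit_hilbert])
    show "d T \<in> carrier (L hunit)" if "T \<in> carrier (L A)" for T
      unfolding dc[OF that] by (rule L_ops_closed(2)[OF hunit_hilbert one])
    show "d \<in> extensional (carrier (L A))" unfolding d_def by simp
    fix S T b c assume S: "S \<in> carrier (L A)" and T: "T \<in> carrier (L A)" and b: "b \<in> carrier hunit" "c \<in> carrier hunit"
    show "ip hunit (d (\<lambda>x \<in> carrier A. S x \<oplus>\<^bsub>A\<^esub> T x) b) c = ip hunit (d S b) c + ip hunit (d T b) c"
      unfolding dip[OF S b] dip[OF T b] dip[OF L_ops_closed(1)[OF A S T] b]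
      using A S T Fs by (simp add: sum.distrib algebra_simps)
  next
    fix r T b c assume T: "T \<in> carrier (L A)" and b: "b \<in> carrier hunit" "c \<in> carrier hunit"
    show "ip hunit (d (\<lambda>x \<in> carrier A. r \<odot>\<^bsub>A\<^esub> T x) b) c = r * ip hunit (d T b) c"
      unfolding dip[OF T b] dip[OF L_ops_closed(2)[OF A T] b]
      using A T Fs by (simp add: sum_distrib_left mult.assoc)
  qed
  have "d = kmap A hunit F (proj_vec A)"
  proof (rule eq_kmapI[OF A hunit_hilbert l d some_onb[OF A]])
    fix x y z w assume "x \<in> some_onb A" "y \<in> some_onb A" and zw: "z \<in> carrier hunit" "w \<in> carrier hunit"
    then have xy: "x \<in> carrier A" "y \<in> carrier A" using onb_simps(2)[OF some_onb[OF A]] by auto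
    have zwe: "ip hunit z w = ip hunit z uvec * ip hunit uvec w" by (rule hunit_ip[OF zw])
    have "ip hunit (d (ketbra A x y) z) w = (\<Sum>f\<in>F. ip A f y * ip A x f) * ip hunit z w"
      using dip[OF _ zw, of "ketbra A x y"] A xy Fs by simp
    also have "\<dots> = (\<Sum>f\<in>F. ip hunit z (proj_vec A f y) * ip hunit (proj_vec A f x) w)"
      unfolding zwe sum_distrib_right
      by (rule sum.cong) (use A xy zw Fs ip_cnj[OF A xy(2)] in \<open>auto simp: proj_vec_def\<close>)
    finally show "ip hunit (d (ketbra A x y) z) w = \<dots>" .
  qed
  then show ?thesis unfolding discard_def d_def by simp
qed

text \<open>The maps are |f> \<otimes> 1 and <f| \<otimes> 1. The two laws of
  \<open>direct_sum\<close> are orthonormality and completeness of \<open>F\<close>, checked on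
  product bases.\<close>

lemma tensor_direct_sum:
  assumes A: "fd_hilbert A" and B: "fd_hilbert B" and F: "onb A F" and ne: "F \<noteq> {}"
  shows "direct_sum (tspace hunit B) (tspace A B) F
    (\<lambda>f. tmap hunit B A B (inj_vec A f) (\<lambda>x. x)) (\<lambda>f. tmap A B hunit B (proj_vec A f) (\<lambda>x. x))"
proof -
  note Fs = onb_simps[OF F]
  let ?Y = "tspace hunit B" and ?Z = "tspace A B"
  have Y: "fd_hilbert ?Y" and Z: "fd_hilbert ?Z" using A B by simp_all
  let ?i = "\<lambda>f. tmap hunit B A B (inj_vec A f) (\<lambda>x. x)" and ?p = "\<lambda>f. tmap A B hunit B (proj_vec A f) (\<lambda>x. x)"
  have i: "?i f \<in> lin ?Y ?Z" and iv: "\<And>a b. a \<in> carrier hunit \<Longrightarrow> b \<in> carrier B \<Longrightarrow> ?i f (tvec hunit B a b) = tvec A B (inj_vec A f a) b"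
    if "f \<in> F" for f
    using tmap[OF hunit_hilbert B A B inj_vec_lin[OF A] lin_id] Fs(2)[OF that] by blast+
  have p: "?p f \<in> lin ?Z ?Y" and pv: "\<And>a b. a \<in> carrier A \<Longrightarrow> b \<in> carrier B \<Longrightarrow> ?p f (tvec A B a b) = tvec hunit B (proj_vec A f a) b"
    if "f \<in> F" for f
    using tmap[OF A B hunit_hilbert B proj_vec_lin[OF A] lin_id] Fs(2)[OF that] by blast+
  show ?thesis
  proof (unfold_locales)
    show "fd_hilbert ?Y" "fd_hilbert ?Z" "finite F" "F \<noteq> {}" using Y Z Fs ne by auto
    show "\<forall>f\<in>F. ?i f \<in> lin ?Y ?Z" "\<forall>f\<in>F. ?p f \<in> lin ?Z ?Y" using i p by auto
    fix f g x assume f: "f \<in> F" and g: "g \<in> F" and x: "x \<in> carrier ?Y"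
    have ic: "inj_vec A f uvec = f" using inj_vec_uvec[OF A Fs(2)[OF f]] .
    \<comment> \<open>The right hand side is written as a one-term linear combination, so that
      \<open>lin_lincomb\<close> gives its linearity in both cases at once.\<close>
    have "?p g (?i f x) = (\<lambda>x. finsum ?Y (\<lambda>_. (if f = g then 1 else 0) \<odot>\<^bsub>?Y\<^esub> x) {()}) x"
    proof (rule lin_eqI[OF Y Y lin_comp[OF i[OF f] p[OF g]] lin_lincomb[OF Y Y] tbasis_onb[OF hunit_hilbert B hunit_onb some_onb[OF B]] _ x])
      show "(\<lambda>x. x) \<in> lin ?Y ?Y" by (rule lin_id)
      fix e assume "e \<in> tbasis hunit B {uvec} (some_onb B)"
      then obtain b where e: "e = tvec hunit B uvec b" and b: "b \<in> carrier B"
        unfolding tbasis_def using onb_simps(2)[OF some_onb[OF B]] by auto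
      have ec: "e \<in> carrier ?Y" unfolding e using B b by simp
      have l: "(\<lambda>a. tvec hunit B a b) \<in> lin hunit ?Y" using B b by simp
      have "?p g (?i f e) = tvec hunit B (if f = g then uvec else \<zero>\<^bsub>hunit\<^esub>) b"
        unfolding e using iv[OF f _ b] pv[OF g Fs(2)[OF f] b] ic proj_vec_onb[OF A F f g] by simp
      also have "\<dots> = finsum ?Y (\<lambda>_. (if f = g then 1 else 0) \<odot>\<^bsub>?Y\<^esub> e) {()}"
        by (rule ip_eqI[OF Y]) (use Y B b ec lin_zero[OF hunit_hilbert Y l] in \<open>auto simp: e\<close>)
      finally show "?p g (?i f e) = finsum ?Y (\<lambda>_. (if f = g then 1 else 0) \<odot>\<^bsub>?Y\<^esub> e) {()}" .
    qed
    also have "\<dots> = (if f = g then x else \<zero>\<^bsub>?Y\<^esub>)"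
      by (rule ip_eqI[OF Y]) (use Y x in auto)
    finally show "?p g (?i f x) = (if f = g then x else \<zero>\<^bsub>?Y\<^esub>)" .
  next
    fix z assume z: "z \<in> carrier ?Z"
    have ip: "(\<lambda>z. ?i f (?p f z)) \<in> lin ?Z ?Z" if "f \<in> F" for f using lin_comp[OF p[OF that] i[OF that]] .
    have "finsum ?Z (\<lambda>f. 1 \<odot>\<^bsub>?Z\<^esub> ?i f (?p f z)) F = z"
    proof (rule lin_eqI[OF Z Z lin_lincomb[OF Z Z ip] lin_id tbasis_onb[OF A B F some_onb[OF B]] _ z])
      fix e assume "e \<in> tbasis A B F (some_onb B)"
      then obtain h b where e: "e = tvec A B h b" and h: "h \<in> F" and b: "b \<in> carrier B"
        unfolding tbasis_def using onb_simps(2)[OF some_onb[OF B]] by auto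
      have ec: "e \<in> carrier ?Z" unfolding e using A B b Fs(2)[OF h] by simp
      have l: "(\<lambda>a. tvec A B a b) \<in> lin A ?Z" using A B b by simp
      have ie: "?i f (?p f e) = (if h = f then e else \<zero>\<^bsub>?Z\<^esub>)" if f: "f \<in> F" for f
      proof -
        have "?i f (?p f e) = tvec A B (inj_vec A f (if h = f then uvec else \<zero>\<^bsub>hunit\<^esub>)) b"
          unfolding e pv[OF f Fs(2)[OF h] b] proj_vec_onb[OF A F h f] by (rule iv[OF f _ b]) simp
        then show ?thesis
          using inj_vec_uvec[OF A Fs(2)[OF f]] lin_zero[OF hunit_hilbert A inj_vec_lin[OF A Fs(2)[OF f]]]
            lin_zero[OF A Z l] by (simp add: e)
      qed
      show "finsum ?Z (\<lambda>f. 1 \<odot>\<^bsub>?Z\<^esub> ?i f (?p f e)) F = e"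
      proof (rule ip_eqI[OF Z _ ec])
        have c: "1 \<odot>\<^bsub>?Z\<^esub> ?i f (?p f e) \<in> carrier ?Z" if "f \<in> F" for f using Z lin_simps(1)[OF ip[OF that] ec] by simp
        show "finsum ?Z (\<lambda>f. 1 \<odot>\<^bsub>?Z\<^esub> ?i f (?p f e)) F \<in> carrier ?Z" using Z c by simp
        fix y assume y: "y \<in> carrier ?Z"
        have "ip ?Z (finsum ?Z (\<lambda>f. 1 \<odot>\<^bsub>?Z\<^esub> ?i f (?p f e)) F) y = (\<Sum>f\<in>F. ip ?Z (1 \<odot>\<^bsub>?Z\<^esub> ?i f (?p f e)) y)"
          by (rule ip_finsum(1)[OF Z c y])
        also have "\<dots> = (\<Sum>f\<in>F. if h = f then ip ?Z e y else 0)"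
          by (rule sum.cong) (use Z ie ec y in auto)
        finally show "ip ?Z (finsum ?Z (\<lambda>f. 1 \<odot>\<^bsub>?Z\<^esub> ?i f (?p f e)) F) y = ip ?Z e y" using Fs(1) h by simp
      qed
    qed
    moreover have "finsum ?Z (\<lambda>f. 1 \<odot>\<^bsub>?Z\<^esub> ?i f (?p f z)) F = finsum ?Z (\<lambda>f. ?i f (?p f z)) F"
      by (rule ip_eqI[OF Z]) (use Z lin_simps(1)[OF ip z] in simp_all)
    ultimately show "finsum ?Z (\<lambda>f. ?i f (?p f z)) F = z" by simp
  qed
qed

section \<open>Unitors as Kraus maps with a single operator\<close>

lemma lin_tbasis_eqI:
  assumes A: "fd_hilbert A" and B: "fd_hilbert B" and C: "fd_hilbert C"
    and K: "K \<in> lin (tspace A B) C" and M: "M \<in> lin (tspace A B) C"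
    and E: "onb A E" and F: "onb B F"
    and eq: "\<And>a b. a \<in> E \<Longrightarrow> b \<in> F \<Longrightarrow> K (tvec A B a b) = M (tvec A B a b)"
    and x: "x \<in> carrier (tspace A B)"
  shows "K x = M x"
  by (rule lin_eqI[OF _ C K M tbasis_onb[OF A B E F] _ x]) (use A B eq in \<open>auto simp: tbasis_def\<close>)

lemma opsum_cong:
  assumes A: "fd_hilbert A" and T: "\<forall>i\<in>I. T i \<in> carrier (L A)" and eq: "\<forall>i\<in>I. S i = T i"
  shows "opsum A I c S = opsum A I c T"
proof -
  have S: "\<forall>i\<in>I. S i \<in> carrier (L A)" using T eq by simp
  show ?thesis
    by (rule op_eqI[OF A opsum_closed[OF A S] opsum_closed[OF A T]])
      (auto simp: opsum_ip[OF A S] opsum_ip[OF A T] eq intro!: sum.cong)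
qed

text \<open>The linear map \<open>g\<close> takes a basis bijectively to a basis, hence is
  invertible. It will be a |-> u \<otimes> a or a |-> a \<otimes> u.\<close>

lemma unitor:
  assumes A: "fd_hilbert A" and T: "fd_hilbert T" and g: "g \<in> lin A T"
    and F: "onb A F" and gF: "inj_on g F" "onb T (g ` F)"
  obtains S where "S \<in> lin T A" "\<And>a. a \<in> carrier A \<Longrightarrow> S (g a) = a" "\<And>x. x \<in> carrier T \<Longrightarrow> g (S x) = x"
proof -
  have id: "inj_on (\<lambda>x. x) F" "onb A ((\<lambda>x. x) ` F)" using F by auto
  obtain S where S: "S \<in> lin T A" and Sg: "\<And>i. i \<in> F \<Longrightarrow> S (g i) = i"
    using basis_bijection[of T A g F "\<lambda>x. x" thesis, OF T A gF id] by blast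
  have "S (g a) = a" if "a \<in> carrier A" for a
    by (rule lin_eqI[OF A A lin_comp[OF g S] lin_id F Sg that])
  moreover have "g (S x) = x" if "x \<in> carrier T" for x
    by (rule lin_eqI[OF T T lin_comp[OF S g] lin_id gF(2) _ that]) (use Sg in auto)
  ultimately show ?thesis using that S by blast
qed

lemma left_unitor:
  assumes A: "fd_hilbert A"
  obtains S where "S \<in> lin (tspace hunit A) A"
    "\<And>a. a \<in> carrier A \<Longrightarrow> S (tvec hunit A uvec a) = a"
    "\<And>x. x \<in> carrier (tspace hunit A) \<Longrightarrow> tvec hunit A uvec (S x) = x"
proof -
  note F = some_onb[OF A]
  have "tbasis hunit A {uvec} (some_onb A) = tvec hunit A uvec ` some_onb A"
    unfolding tbasis_def by (auto simp: image_iff)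
  then have "inj_on (tvec hunit A uvec) (some_onb A)" "onb (tspace hunit A) (tvec hunit A uvec ` some_onb A)"
    using tbasis_inj[OF hunit_hilbert A hunit_onb F] tbasis_onb[OF hunit_hilbert A hunit_onb F]
    by (auto simp: inj_on_def)
  then show ?thesis using unitor[OF A _ _ F, of "tspace hunit A" "tvec hunit A uvec" thesis] A that by simp
qed

lemma right_unitor:
  assumes A: "fd_hilbert A"
  obtains S where "S \<in> lin (tspace A hunit) A"
    "\<And>a. a \<in> carrier A \<Longrightarrow> S (tvec A hunit a uvec) = a"
    "\<And>x. x \<in> carrier (tspace A hunit) \<Longrightarrow> tvec A hunit (S x) uvec = x"
proof -
  note F = some_onb[OF A]
  let ?g = "\<lambda>a. tvec A hunit a uvec"
  have "tbasis A hunit (some_onb A) {uvec} = ?g ` some_onb A"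
    unfolding tbasis_def by (auto simp: image_iff)
  then have "inj_on ?g (some_onb A)" "onb (tspace A hunit) (?g ` some_onb A)"
    using tbasis_inj[OF A hunit_hilbert F hunit_onb] tbasis_onb[OF A hunit_hilbert F hunit_onb]
    by (auto simp: inj_on_def)
  then show ?thesis using unitor[OF A _ _ F, of "tspace A hunit" ?g thesis] A that by simp
qed

text \<open>Evaluates the descriptions of \<open>Lunit\<close> and \<open>Runit\<close> together:
  \<open>g\<close> stands for tensoring a vector with \<open>uvec\<close>, \<open>t\<close> for
  tensoring an operator with the identity of C. Then t R = g R S is conjugation by a unitary, undone
  by the Kraus map of \<open>S\<close>; and each |d><e| on \<open>T\<close> is t applied to |S d><S
  e|, which forces uniqueness.\<close>

lemma unitor_the:
  assumes A: "fd_hilbert A" and T: "fd_hilbert T" and S: "S \<in> lin T A"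
    and g: "\<And>a. a \<in> carrier A \<Longrightarrow> g a \<in> carrier T"
    and Sg: "\<And>x. x \<in> carrier T \<Longrightarrow> g (S x) = x" and gS: "\<And>a. a \<in> carrier A \<Longrightarrow> S (g a) = a"
    and iso: "\<And>a b. a \<in> carrier A \<Longrightarrow> b \<in> carrier A \<Longrightarrow> ip T (g a) (g b) = ip A a b"
    and t: "\<And>R. R \<in> carrier (L A) \<Longrightarrow> t R \<in> carrier (L T)"
    and tg: "\<And>R a. R \<in> carrier (L A) \<Longrightarrow> a \<in> carrier A \<Longrightarrow> t R (g a) = g (R a)"
  shows "(THE l. l \<in> superops T A \<and> (\<forall>R \<in> carrier (L A). l (t R) = R)) = kmap T A {()} (\<lambda>_. S)"
proof -
  have S': "\<forall>i\<in>{()}. S \<in> lin T A" using S by simp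
  let ?k = "kmap T A {()} (\<lambda>_. S)"
  note k = kmap_superop[OF T A S'] and Sc = lin_simps(1)[OF S]
  have Sip: "ip A (S x) a = ip T x (g a)" "ip A a (S x) = ip T (g a) x" if "x \<in> carrier T" "a \<in> carrier A" for x a
    using iso[OF Sc[OF that(1)] that(2)] iso[OF that(2) Sc[OF that(1)]] Sg[OF that(1)] by simp_all
  have tk: "t (ketbra A a b) = ketbra T (g a) (g b)" if ab: "a \<in> carrier A" "b \<in> carrier A" for a b
  proof (rule op_eqI[OF T])
    fix x y assume xy: "x \<in> carrier T" "y \<in> carrier T"
    have kc: "ketbra A a b \<in> carrier (L A)" using A ab by simp
    have "ip T (t (ketbra A a b) (g (S x))) y = ip T (g (ketbra A a b (S x))) (g (S y))"
      using tg[OF kc Sc[OF xy(1)]] Sg[OF xy(2)] by simp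
    also have "\<dots> = ip A (ketbra A a b (S x)) (S y)"
      by (rule iso) (use kc Sc xy in simp_all)
    also have "\<dots> = ip T (ketbra T (g a) (g b) x) y"
      using A T ab xy Sc g by (simp add: Sip)
    finally show "ip T (t (ketbra A a b) x) y = ip T (ketbra T (g a) (g b) x) y" unfolding Sg[OF xy(1)] .
  qed (use A T t g ab in simp_all)
  have kt: "?k (t R) = R" if R: "R \<in> carrier (L A)" for R
  proof -
    define E where "E = some_onb A"
    have E: "onb A E" unfolding E_def by (rule some_onb[OF A])
    note Es = onb_simps[OF E]
    let ?c = "\<lambda>p. ip A (R (fst p)) (snd p)"
    let ?X = "\<lambda>p. ketbra A (snd p) (fst p)" and ?X' = "\<lambda>p. ketbra T (g (snd p)) (g (fst p))"
    have pc: "fst p \<in> carrier A" "snd p \<in> carrier A" if "p \<in> E \<times> E" for p using that Es by auto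
    have X: "\<forall>p\<in>E\<times>E. ?X p \<in> carrier (L A)" "\<forall>p\<in>E\<times>E. ?X' p \<in> carrier (L T)" using A T pc g by simp_all
    have "t R = opsum T (E \<times> E) ?c ?X'"
    proof (rule op_eqI[OF T t[OF R] opsum_closed[OF T X(2)]])
      fix x y assume xy: "x \<in> carrier T" "y \<in> carrier T"
      have "ip T (t R (g (S x))) y = ip T (g (R (S x))) (g (S y))"
        using tg[OF R Sc[OF xy(1)]] Sg[OF xy(2)] by simp
      also have "\<dots> = ip A (R (S x)) (S y)"
        by (rule iso) (use R Sc xy in simp_all)
      also have "\<dots> = ip A (opsum A (E \<times> E) ?c ?X (S x)) (S y)"
        by (rule arg_cong[OF op_expand[OF A E R], of "\<lambda>T. ip A (T (S x)) (S y)"])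
      also have "\<dots> = (\<Sum>p\<in>E\<times>E. ?c p * ip A (?X p (S x)) (S y))"
        by (rule opsum_ip[OF A X(1) Sc[OF xy(1)] Sc[OF xy(2)]])
      also have "\<dots> = (\<Sum>p\<in>E\<times>E. ?c p * ip T (?X' p x) y)"
        by (rule sum.cong[OF refl]) (use A T xy Sc pc g in \<open>simp add: Sip\<close>)
      also have "\<dots> = ip T (opsum T (E \<times> E) ?c ?X' x) y"
        by (rule opsum_ip[OF T X(2) xy, symmetric])
      finally show "ip T (t R x) y = \<dots>" unfolding Sg[OF xy(1)] .
    qed
    then have "?k (t R) = opsum A (E \<times> E) ?c (\<lambda>p. ?k (?X' p))"
      using superops_opsum[OF T A k _ X(2)] Es(1) by simp
    also have "\<dots> = opsum A (E \<times> E) ?c ?X"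
    proof -
      have "?k (?X' p) = ?X p" if p: "p \<in> E \<times> E" for p
        by (rule op_eqI[OF A kmap_form(1)[OF T A S']])
          (use A T X p pc[OF p] g gS kmap_ketbra[OF T A S'] in simp_all)
      then show ?thesis by (intro opsum_cong[OF A X(1)]) blast
    qed
    also have "\<dots> = R" by (rule op_expand[OF A E R, symmetric])
    finally show ?thesis .
  qed
  show ?thesis
  proof (rule the_equality)
    show "?k \<in> superops T A \<and> (\<forall>R \<in> carrier (L A). ?k (t R) = R)" using k kt by blast
    fix l assume l: "l \<in> superops T A \<and> (\<forall>R \<in> carrier (L A). l (t R) = R)"
    show "l = ?k"
    proof (rule superop_eqI[OF T A _ k some_onb[OF T]])
      show "l \<in> superops T A" using l by blast
      fix d e b c assume "d \<in> some_onb T" "e \<in> some_onb T"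
      then have de: "d \<in> carrier T" "e \<in> carrier T" using onb_simps(2)[OF some_onb[OF T]] by auto
      have "ketbra T d e = t (ketbra A (S d) (S e))"
        using tk[OF Sc[OF de(1)] Sc[OF de(2)]] Sg de by simp
      then show "ip A (l (ketbra T d e) b) c = ip A (?k (ketbra T d e) b) c"
        using l kt A Sc de by simp
    qed
  qed
qed

lemma Lunit_kmap:
  assumes A: "fd_hilbert A" and S: "S \<in> lin (tspace hunit A) A"
    and Su: "\<And>a. a \<in> carrier A \<Longrightarrow> S (tvec hunit A uvec a) = a"
    and uS: "\<And>x. x \<in> carrier (tspace hunit A) \<Longrightarrow> tvec hunit A uvec (S x) = x"
  shows "Lunit Quant A = QArr (tspace hunit A) (kmap (tspace hunit A) A {()} (\<lambda>_. S)) A"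
proof -
  have one: "one (L hunit) \<in> carrier (L hunit)" by simp
  have "(THE l. l \<in> superops (tspace hunit A) A \<and> (\<forall>R \<in> carrier (L A). l (tensor_op hunit A (one (L hunit)) R) = R))
    = kmap (tspace hunit A) A {()} (\<lambda>_. S)"
    by (rule unitor_the[OF A _ S, of "tvec hunit A uvec"])
      (use A Su uS tensor_op[OF hunit_hilbert A one] in simp_all)
  then show ?thesis unfolding Quant_def by simp
qed

lemma Runit_kmap:
  assumes A: "fd_hilbert A" and S: "S \<in> lin (tspace A hunit) A"
    and Su: "\<And>a. a \<in> carrier A \<Longrightarrow> S (tvec A hunit a uvec) = a"
    and uS: "\<And>x. x \<in> carrier (tspace A hunit) \<Longrightarrow> tvec A hunit (S x) uvec = x"
  shows "Runit Quant A = QArr (tspace A hunit) (kmap (tspace A hunit) A {()} (\<lambda>_. S)) A"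
proof -
  have one: "one (L hunit) \<in> carrier (L hunit)" by simp
  have "(THE l. l \<in> superops (tspace A hunit) A \<and> (\<forall>R \<in> carrier (L A). l (tensor_op A hunit R (one (L hunit))) = R))
    = kmap (tspace A hunit) A {()} (\<lambda>_. S)"
    by (rule unitor_the[OF A _ S, of "\<lambda>a. tvec A hunit a uvec"])
      (use A Su uS tensor_op[OF A hunit_hilbert _ one] in simp_all)
  then show ?thesis unfolding Quant_def by simp
qed

subsection \<open>Objects and arrows\<close>

lemma hobjsI:
  assumes "fd_hilbert A" "e \<in> carrier A" "ip A e e \<noteq> 0"
  shows "A \<in> hobjs"
  using assms ip_zero(1)[OF assms(1,2)] unfolding hobjs_def by auto

lemma hobjs_onb_nonempty: "A \<in> hobjs \<Longrightarrow> onb A E \<Longrightarrow> E \<noteq> {}"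
  using onb_nonempty unfolding hobjs_def by blast

text \<open>A product of unit vectors has norm 1, so the tensor product is again nonzero.\<close>

lemma hobjs_tspace:
  assumes A: "A \<in> hobjs" and B: "B \<in> hobjs"
  shows "tspace A B \<in> hobjs"
proof -
  note AB = hobjsD[OF A] hobjsD[OF B]
  obtain e f where e: "e \<in> some_onb A" and f: "f \<in> some_onb B"
    using hobjs_onb_nonempty[OF A some_onb[OF AB(1)]] hobjs_onb_nonempty[OF B some_onb[OF AB(2)]] by blast
  note es = onb_simps(2,3)[OF some_onb[OF AB(1)]] and fs = onb_simps(2,3)[OF some_onb[OF AB(2)]]
  show ?thesis
    by (rule hobjsI[of _ "tvec A B e f"]) (use AB es(1)[OF e] fs(1)[OF f] es(2)[OF e e] fs(2)[OF f f] in simp_all)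
qed

lemma hobjs_hunit: "hunit \<in> hobjs"
  by (rule hobjsI[of _ uvec]) simp_all

lemma Quant_simps [simp]:
  "Obj Quant = hobjs" "Dom Quant = qdom" "Cod Quant = qcod"
  "Id Quant A = QArr A (super_id A) A" "TObj Quant A B = tspace A B"
  "Comp Quant (QArr B g C) (QArr A f B) = QArr A (compose (carrier (L A)) g f) C"
  "QArr A f B \<in> Arr Quant \<longleftrightarrow> A \<in> hobjs \<and> B \<in> hobjs \<and> completely_positive A B f"
  unfolding Quant_def by auto

abbreviation karr :: "hsp \<Rightarrow> hsp \<Rightarrow> 'i set \<Rightarrow> ('i \<Rightarrow> hop) \<Rightarrow> qarr" where
  "karr A B I K \<equiv> QArr A (kmap A B I K) B"

lemma Hom_iff: "x \<in> Hom Quant A B \<longleftrightarrow> A \<in> hobjs \<and> B \<in> hobjs \<and> (\<exists>f. x = QArr A f B \<and> completely_positive A B f)"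
  unfolding Hom_def by (cases x) auto

lemma Arr_Hom: "x \<in> Arr Quant \<Longrightarrow> x \<in> Hom Quant (qdom x) (qcod x)"
  unfolding Hom_def by simp

lemma HomD: "x \<in> Hom Quant A B \<Longrightarrow> qdom x = A \<and> qcod x = B \<and> A \<in> hobjs \<and> B \<in> hobjs \<and> x \<in> Arr Quant"
  unfolding Hom_iff by auto

lemma karr_Hom:
  assumes "A \<in> hobjs" "B \<in> hobjs" "\<forall>i\<in>I. K i \<in> lin A B"
  shows "karr A B I K \<in> Hom Quant A B"
  using assms kmap_cp hobjsD unfolding Hom_iff by blast

text \<open>The caller prescribes a lower bound \<open>m\<close> on the length of the family, met by
  padding.\<close>

lemma Hom_kraus:
  assumes x: "x \<in> Hom Quant A B"
  obtains n K where "m \<le> n" "\<forall>i\<in>{..<n::nat}. K i \<in> lin A B" "x = karr A B {..<n} K"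
proof -
  obtain f where A: "A \<in> hobjs" and B: "B \<in> hobjs" and x: "x = QArr A f B" and f: "completely_positive A B f"
    using x unfolding Hom_iff by blast
  note AB = hobjsD[OF A] hobjsD[OF B]
  obtain K n where K: "\<forall>i\<in>{..<n::nat}. K i \<in> lin A B" and fK: "f = kmap A B {..<n} K"
    using cp_kraus[OF A AB(2) f] by blast
  obtain M where "\<forall>i\<in>{..<max n m}. M i \<in> lin A B" "kmap A B {..<n} K = kmap A B {..<max n m} M"
    using kmap_nat[OF AB K finite_lessThan, of "max n m"] by auto
  then show ?thesis using that[of "max n m" M] x fK by simp
qed

lemma TArr_id_right:
  assumes A: "fd_hilbert A" and B: "fd_hilbert B" and C: "fd_hilbert C" and K: "\<forall>i\<in>I. K i \<in> lin A B"
  shows "TArr Quant (karr A B I K) (QArr C (super_id C) C) =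
    karr (tspace A C) (tspace B C) I (\<lambda>i. tmap A C B C (K i) (\<lambda>x. x))"
proof -
  have id: "\<forall>j\<in>{()}. (\<lambda>x. x) \<in> lin C C" using lin_id by simp
  have l: "\<forall>p\<in>I\<times>{()}. tmap A C B C (K (fst p)) (\<lambda>x. x) \<in> lin (tspace A C) (tspace B C)"
    using tmap(1)[OF A C B C _ lin_id] K by auto
  have "bij_betw (\<lambda>i. (i, ())) I (I \<times> {()})" by (auto simp: bij_betw_def inj_on_def)
  from kmap_reindex[OF _ _ l this] show ?thesis
    using A B C unfolding Quant_def super_id_kmap(1)[OF C]
    by (simp add: tensor_super_kmap[OF A B C C K id])
qed

lemma TArr_id_Hom:
  assumes p: "p \<in> Arr Quant" and C: "C \<in> hobjs"
  obtains P R where "TArr Quant p (QArr C (super_id C) C) \<in> Hom Quant P R"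
proof -
  obtain n K where K: "\<forall>i\<in>{..<n::nat}. K i \<in> lin (qdom p) (qcod p)" and pK: "p = karr (qdom p) (qcod p) {..<n} K"
    using Hom_kraus[OF Arr_Hom[OF p], of 0] by blast
  have o: "qdom p \<in> hobjs" "qcod p \<in> hobjs" using HomD[OF Arr_Hom[OF p]] by auto
  note h = o[THEN hobjsD] hobjsD[OF C]
  have "TArr Quant (karr (qdom p) (qcod p) {..<n} K) (QArr C (super_id C) C) \<in> Hom Quant (tspace (qdom p) C) (tspace (qcod p) C)"
    unfolding TArr_id_right[OF h K]
    by (rule karr_Hom[OF hobjs_tspace[OF o(1) C] hobjs_tspace[OF o(2) C]])
      (use tmap(1)[OF h(1,3,2,3) _ lin_id] K in blast)
  then show ?thesis using that pK by simp
qed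

lemma TArr_id_left:
  assumes A: "fd_hilbert A" and B: "fd_hilbert B" and C: "fd_hilbert C" and K: "\<forall>i\<in>I. K i \<in> lin A B"
  shows "TArr Quant (QArr C (super_id C) C) (karr A B I K) =
    karr (tspace C A) (tspace C B) I (\<lambda>i. tmap C A C B (\<lambda>x. x) (K i))"
proof -
  have id: "\<forall>j\<in>{()}. (\<lambda>x. x) \<in> lin C C" using lin_id by simp
  have l: "\<forall>p\<in>{()}\<times>I. tmap C A C B (\<lambda>x. x) (K (snd p)) \<in> lin (tspace C A) (tspace C B)"
    using tmap(1)[OF C A C B lin_id] K by auto
  have "bij_betw (\<lambda>i. ((), i)) I ({()} \<times> I)" by (auto simp: bij_betw_def inj_on_def)
  from kmap_reindex[OF _ _ l this] show ?thesis
    using A B C unfolding Quant_def super_id_kmap(1)[OF C]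
    by (simp add: tensor_super_kmap[OF C C A B id K])
qed

text \<open>Kraus families are used because the definition of complete positivity would call for
  functoriality of \<open>tensor_super\<close>.\<close>

lemma comp_Hom:
  assumes f: "f \<in> Hom Quant A B" and g: "g \<in> Hom Quant B C"
  shows "Comp Quant g f \<in> Hom Quant A C"
proof -
  have o: "A \<in> hobjs" "B \<in> hobjs" "C \<in> hobjs" using HomD[OF f] HomD[OF g] by auto
  note h = o[THEN hobjsD]
  obtain n K where K: "\<forall>i\<in>{..<n::nat}. K i \<in> lin A B" and fK: "f = karr A B {..<n} K"
    using Hom_kraus[OF f, of 0] by blast
  obtain m M where M: "\<forall>i\<in>{..<m::nat}. M i \<in> lin B C" and gM: "g = karr B C {..<m} M"
    using Hom_kraus[OF g, of 0] by blast
  have "\<forall>p\<in>{..<m}\<times>{..<n}. (\<lambda>x. M (fst p) (K (snd p) x)) \<in> lin A C"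
  proof
    fix p assume "p \<in> {..<m} \<times> {..<n}"
    then show "(\<lambda>x. M (fst p) (K (snd p) x)) \<in> lin A C"
      using lin_comp[of "K (snd p)" A B "M (fst p)" C] K M by auto
  qed
  then show ?thesis unfolding fK gM Quant_simps kmap_comp[OF h K M finite_lessThan] by (rule karr_Hom[OF o(1,3)])
qed

lemma Hom_map:
  assumes "x \<in> Hom Quant A B"
  obtains f where "x = QArr A f B" "f \<in> carrier (L A) \<rightarrow> carrier (L B)" "f \<in> extensional (carrier (L A))"
  using assms superops_simps unfolding Hom_iff completely_positive_def by blast

lemma comp_assoc:
  assumes f: "f \<in> Hom Quant A B" and g: "g \<in> Hom Quant B C" and h: "h \<in> Hom Quant C D"
  shows "Comp Quant h (Comp Quant g f) = Comp Quant (Comp Quant h g) f"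
proof -
  obtain f' where f': "f = QArr A f' B" "f' \<in> carrier (L A) \<rightarrow> carrier (L B)" using Hom_map[OF f] .
  obtain g' where g': "g = QArr B g' C" using Hom_map[OF g] .
  obtain h' where h': "h = QArr C h' D" using Hom_map[OF h] .
  show ?thesis unfolding f'(1) g' h' using compose_assoc[OF f'(2)] by simp
qed

lemma comp_id:
  assumes f: "f \<in> Hom Quant A B"
  shows "Comp Quant f (Id Quant A) = f" "Comp Quant (Id Quant B) f = f"
proof -
  obtain f' where f': "f = QArr A f' B" "f' \<in> carrier (L A) \<rightarrow> carrier (L B)" "f' \<in> extensional (carrier (L A))"
    using Hom_map[OF f] .
  show "Comp Quant f (Id Quant A) = f" "Comp Quant (Id Quant B) f = f"
    unfolding f'(1) super_id_def using compose_Id[OF f'(2,3)] Id_compose[OF f'(2,3)] by (simp_all add: super_id_def)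
qed

subsection \<open>Transport of lifting properties along isomorphisms\<close>

definition iso_pair :: "qarr \<Rightarrow> qarr \<Rightarrow> hsp \<Rightarrow> hsp \<Rightarrow> bool" where
  "iso_pair a a' A B \<longleftrightarrow> a \<in> Hom Quant A B \<and> a' \<in> Hom Quant B A \<and>
     Comp Quant a' a = Id Quant A \<and> Comp Quant a a' = Id Quant B"

lemma comp_cancel:
  assumes i: "iso_pair a a' A B" and g: "g \<in> Hom Quant A X"
  shows "Comp Quant (Comp Quant g a') a = g"
proof -
  have a: "a \<in> Hom Quant A B" "a' \<in> Hom Quant B A" "Comp Quant a' a = Id Quant A"
    using i unfolding iso_pair_def by auto
  show ?thesis
    unfolding comp_assoc[OF a(1,2) g, symmetric] a(3) by (rule comp_id(1)[OF g])
qed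

lemma iso_pair_sym: "iso_pair a a' A B \<Longrightarrow> iso_pair a' a B A"
  unfolding iso_pair_def by simp

lemma lifts_Hom:
  assumes "f \<in> Hom Quant S T" "g \<in> Hom Quant P R"
  shows "lifts Quant f g \<longleftrightarrow> (\<forall>u \<in> Hom Quant S P. \<forall>v \<in> Hom Quant T R.
    Comp Quant g u = Comp Quant v f \<longrightarrow> (\<exists>h \<in> Hom Quant T P. Comp Quant h f = u \<and> Comp Quant g h = v))"
  using HomD[OF assms(1)] HomD[OF assms(2)] unfolding lifts_def by simp

text \<open>\<open>m\<close> and \<open>l\<close> are isomorphic in the arrow category. A lifting
  problem for \<open>l\<close> is precomposed with \<open>a\<close> and \<open>s\<close>, solved for
  \<open>m\<close>, and the solution is precomposed with the inverse of \<open>s\<close>.\<close>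

lemma lifts_transport_left:
  assumes m: "m \<in> Hom Quant Y Z" and l: "l \<in> Hom Quant Y' Z'" and x: "x \<in> Hom Quant P R"
    and a: "iso_pair a a' Y Y'" and s: "iso_pair s s' Z Z'"
    and comm: "Comp Quant s m = Comp Quant l a" and lift: "lifts Quant m x"
  shows "lifts Quant l x"
  unfolding lifts_Hom[OF l x]
proof (intro ballI impI)
  fix u v assume u: "u \<in> Hom Quant Y' P" and v: "v \<in> Hom Quant Z' R" and uv: "Comp Quant x u = Comp Quant v l"
  have a1: "a \<in> Hom Quant Y Y'" "a' \<in> Hom Quant Y' Y" and s1: "s \<in> Hom Quant Z Z'" "s' \<in> Hom Quant Z' Z"
    using a s unfolding iso_pair_def by auto
  note a2 = iso_pair_sym[OF a] and s2 = iso_pair_sym[OF s]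
  have "Comp Quant x (Comp Quant u a) = Comp Quant (Comp Quant v s) m"
    using comp_assoc[OF a1(1) u x] comp_assoc[OF a1(1) l v] comp_assoc[OF m s1(1) v] uv comm by simp
  then obtain h where h: "h \<in> Hom Quant Z P" and hm: "Comp Quant h m = Comp Quant u a" and xh: "Comp Quant x h = Comp Quant v s"
    using lift comp_Hom[OF a1(1) u] comp_Hom[OF s1(1) v] unfolding lifts_Hom[OF m x] by blast
  let ?h = "Comp Quant h s'"
  have hH: "?h \<in> Hom Quant Z' P" by (rule comp_Hom[OF s1(2) h])
  have "Comp Quant (Comp Quant ?h l) a = Comp Quant ?h (Comp Quant s m)"
    unfolding comm by (rule comp_assoc[OF a1(1) l hH, symmetric])
  also have "\<dots> = Comp Quant h m"
    unfolding comp_assoc[OF comp_Hom[OF m s1(1)] s1(2) h, symmetric]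
    using comp_assoc[OF m s1] s unfolding iso_pair_def by (simp add: comp_id(2)[OF m, unfolded Quant_simps])
  finally have "Comp Quant (Comp Quant ?h l) a = Comp Quant u a" using hm by simp
  then have "Comp Quant (Comp Quant (Comp Quant ?h l) a) a' = Comp Quant (Comp Quant u a) a'" by simp
  then have 1: "Comp Quant ?h l = u"
    by (simp only: comp_cancel[OF a2 comp_Hom[OF l hH]] comp_cancel[OF a2 u])
  have "Comp Quant x ?h = Comp Quant (Comp Quant v s) s'"
    using comp_assoc[OF s1(2) h x] xh by simp
  also have "\<dots> = v" using comp_assoc[OF s1(2,1) v] s comp_id(1)[OF v] unfolding iso_pair_def by simp
  finally show "\<exists>h \<in> Hom Quant Z' P. Comp Quant h l = u \<and> Comp Quant x h = v" using hH 1 by blast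
qed

text \<open>The same on the other side: the problem is composed with \<open>b'\<close> and
  \<open>c'\<close>, and its solution for \<open>x\<close> is composed with
  \<open>b\<close>.\<close>

lemma lifts_transport_right:
  assumes f: "f \<in> Hom Quant S T" and x: "x \<in> Hom Quant P R" and y: "y \<in> Hom Quant P' R'"
    and b: "iso_pair b b' P P'" and c: "iso_pair c c' R R'"
    and comm: "Comp Quant c x = Comp Quant y b" and lift: "lifts Quant f x"
  shows "lifts Quant f y"
  unfolding lifts_Hom[OF f y]
proof (intro ballI impI)
  fix u v assume u: "u \<in> Hom Quant S P'" and v: "v \<in> Hom Quant T R'" and uv: "Comp Quant y u = Comp Quant v f"
  have b1: "b \<in> Hom Quant P P'" "b' \<in> Hom Quant P' P" and c1: "c \<in> Hom Quant R R'" "c' \<in> Hom Quant R' R"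
    using b c unfolding iso_pair_def by auto
  have bb: "Comp Quant b (Comp Quant b' u) = u"
    using comp_assoc[OF u b1(2,1)] b comp_id(2)[OF u] unfolding iso_pair_def by simp
  let ?u = "Comp Quant b' u"
  have uH: "?u \<in> Hom Quant S P" by (rule comp_Hom[OF u b1(2)])
  note xu = comp_Hom[OF uH x]
  have "Comp Quant c (Comp Quant x ?u) = Comp Quant v f"
    using comp_assoc[OF uH x c1(1)] comp_assoc[OF uH b1(1) y] comm bb uv by simp
  then have "Comp Quant x ?u = Comp Quant c' (Comp Quant v f)"
    using comp_assoc[OF xu c1] c comp_id(2)[OF xu] unfolding iso_pair_def by simp
  then have "Comp Quant x ?u = Comp Quant (Comp Quant c' v) f" using comp_assoc[OF f v c1(2)] by simp
  then obtain h where h: "h \<in> Hom Quant T P" and hf: "Comp Quant h f = ?u" and xh: "Comp Quant x h = Comp Quant c' v"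
    using lift uH comp_Hom[OF v c1(2)] unfolding lifts_Hom[OF f x] by blast
  have hH: "Comp Quant b h \<in> Hom Quant T P'" by (rule comp_Hom[OF h b1(1)])
  have "Comp Quant (Comp Quant b h) f = u" using comp_assoc[OF f h b1(1)] hf bb by simp
  moreover have "Comp Quant y (Comp Quant b h) = v"
    using comp_assoc[OF h b1(1) y] comp_assoc[OF h x c1(1)] comm xh comp_assoc[OF v c1(2,1)] c comp_id(2)[OF v]
    unfolding iso_pair_def by simp
  ultimately show "\<exists>h \<in> Hom Quant T P'. Comp Quant h f = u \<and> Comp Quant y h = v" using hH by blast
qed

lemma karr_iso_pair:
  assumes A: "A \<in> hobjs" and B: "B \<in> hobjs" and S: "S \<in> lin A B" and T: "T \<in> lin B A"
    and TS: "\<And>x. x \<in> carrier A \<Longrightarrow> T (S x) = x" and ST: "\<And>y. y \<in> carrier B \<Longrightarrow> S (T y) = y"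
  shows "iso_pair (karr A B {()} (\<lambda>_. S)) (karr B A {()} (\<lambda>_. T)) A B"
proof -
  note hA = hobjsD[OF A] and hB = hobjsD[OF B]
  have S': "\<forall>i\<in>{()}. S \<in> lin A B" and T': "\<forall>i\<in>{()}. T \<in> lin B A" using S T by simp_all
  have "kmap A A {()} (\<lambda>i x. T (S x)) = kmap A A {()} (\<lambda>_ x. x)"
    by (rule kmap_cong[OF hA hA]) (use lin_comp[OF S T] lin_id TS in simp_all)
  moreover have "kmap B B {()} (\<lambda>i x. S (T x)) = kmap B B {()} (\<lambda>_ x. x)"
    by (rule kmap_cong[OF hB hB]) (use lin_comp[OF T S] lin_id ST in simp_all)
  ultimately show ?thesis
    unfolding iso_pair_def using karr_Hom[OF A B S'] karr_Hom[OF B A T']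
      kmap_comp_single_left[OF hA hB hA S' T] kmap_comp_single_left[OF hB hA hB T' S]
    by (simp add: super_id_kmap(1)[OF hA] super_id_kmap(1)[OF hB])
qed

subsection \<open>Kraus rank one maps are pure and copure\<close>

lemma mixed_state_tensor:
  assumes X: "fd_hilbert X" and A: "fd_hilbert A" and F: "onb X F"
  shows "TArr Quant (mixed_state X) (QArr A (super_id A) A) =
    karr (tspace hunit A) (tspace X A) F (\<lambda>f. tmap hunit A X A (inj_vec X f) (\<lambda>x. x))"
  unfolding mixed_state_kmap[OF X F]
  by (rule TArr_id_right[OF hunit_hilbert X A]) (use inj_vec_lin[OF X] onb_simps(2)[OF F] in blast)

lemma discard_tensor:
  assumes X: "fd_hilbert X" and A: "fd_hilbert A" and F: "onb X F"
  shows "TArr Quant (discard X) (QArr A (super_id A) A) =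
    karr (tspace X A) (tspace hunit A) F (\<lambda>f. tmap X A hunit A (proj_vec X f) (\<lambda>x. x))"
  unfolding discard_kmap[OF X F]
  by (rule TArr_id_right[OF X hunit_hilbert A]) (use proj_vec_lin[OF X] onb_simps(2)[OF F] in blast)

lemma rank_one_tensor:
  assumes A: "fd_hilbert A" and B: "fd_hilbert B" and C: "fd_hilbert C" and V: "V \<in> lin A B"
  shows "TArr Quant (karr A B {()} (\<lambda>_. V)) (QArr C (super_id C) C) =
    karr (tspace A C) (tspace B C) {()} (\<lambda>_. tmap A C B C V (\<lambda>x. x))"
  using TArr_id_right[OF A B C, of "{()}" "\<lambda>_. V"] V by simp

lemma rank_one_pure:
  assumes C: "C \<in> hobjs" and D: "D \<in> hobjs" and V: "V \<in> lin C D"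
  shows "karr C D {()} (\<lambda>_. V) \<in> pure Quant mixed_state"
proof -
  note hC = hobjsD[OF C] and hD = hobjsD[OF D]
  have "lifts Quant (TArr Quant (mixed_state X) (Id Quant A)) (TArr Quant (karr C D {()} (\<lambda>_. V)) (Id Quant B))"
    if X: "X \<in> hobjs" and A: "A \<in> hobjs" and B: "B \<in> hobjs" for X A B
  proof -
    note hX = hobjsD[OF X] and hA = hobjsD[OF A] and hB = hobjsD[OF B]
    note F = some_onb[OF hX]
    let ?Y = "tspace hunit A" and ?Z = "tspace X A" and ?C = "tspace C B" and ?D = "tspace D B"
    let ?W = "tmap C B D B V (\<lambda>x. x)"
    interpret direct_sum ?Y ?Z "some_onb X" "\<lambda>f. tmap hunit A X A (inj_vec X f) (\<lambda>x. x)"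
      "\<lambda>f. tmap X A hunit A (proj_vec X f) (\<lambda>x. x)"
      by (rule tensor_direct_sum[OF hX hA F hobjs_onb_nonempty[OF X F]])
    have W: "?W \<in> lin ?C ?D" by (rule tmap(1)[OF hC hB hD hB V lin_id])
    have W': "\<forall>i\<in>{()}. ?W \<in> lin ?C ?D" using W by simp
    note o = hobjs_tspace[OF hobjs_hunit A] hobjs_tspace[OF X A] hobjs_tspace[OF C B] hobjs_tspace[OF D B]
    note ho = o[THEN hobjsD]
    note m = karr_Hom[OF o(1,2) \<iota>] and p = karr_Hom[OF o(3,4) W']
    show ?thesis
      unfolding Quant_simps mixed_state_tensor[OF hX hA F] rank_one_tensor[OF hC hD hB V] lifts_Hom[OF m p]
    proof (intro ballI impI)
      fix u v assume u: "u \<in> Hom Quant ?Y ?C" and v: "v \<in> Hom Quant ?Z ?D"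
        and eq: "Comp Quant (karr ?C ?D {()} (\<lambda>_. ?W)) u =
          Comp Quant v (karr ?Y ?Z (some_onb X) (\<lambda>f. tmap hunit A X A (inj_vec X f) (\<lambda>x. x)))"
      obtain n U where U: "\<forall>i\<in>{..<n::nat}. U i \<in> lin ?Y ?C" and uU: "u = karr ?Y ?C {..<n} U"
        using Hom_kraus[OF u, of 0] by blast
      \<comment> \<open>The family of \<open>v\<close> is taken at least as long as that of
        \<open>u\<close>, as \<open>lift_pure\<close> requires.\<close>
      obtain k K where nk: "n \<le> k" and K: "\<forall>i\<in>{..<k::nat}. K i \<in> lin ?Z ?D" and vK: "v = karr ?Z ?D {..<k} K"
        using Hom_kraus[OF v, of n] by blast
      obtain H where H: "\<forall>j\<in>{..<k}. H j \<in> lin ?Z ?C"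
        and 1: "compose (carrier (L ?Y)) (kmap ?Z ?C {..<k} H) (kmap ?Y ?Z (some_onb X) (\<lambda>f. tmap hunit A X A (inj_vec X f) (\<lambda>x. x))) = kmap ?Y ?C {..<n} U"
        and 2: "compose (carrier (L ?Z)) (kmap ?C ?D {()} (\<lambda>_. ?W)) (kmap ?Z ?C {..<k} H) = kmap ?Z ?D {..<k} K"
        using lift_pure[OF ho(3,4) W U K nk] eq unfolding uU vK by auto
      show "\<exists>h \<in> Hom Quant ?Z ?C.
        Comp Quant h (karr ?Y ?Z (some_onb X) (\<lambda>f. tmap hunit A X A (inj_vec X f) (\<lambda>x. x))) = u \<and>
        Comp Quant (karr ?C ?D {()} (\<lambda>_. ?W)) h = v"
        by (rule bexI[OF _ karr_Hom[OF o(2,3) H]]) (simp add: 1 2 uU vK)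
    qed
  qed
  then show ?thesis
    unfolding pure_def oslash_right_def oslash_def using C D kmap_cp[OF hC hD, of "{()}" "\<lambda>_. V"] V by simp
qed

lemma rank_one_copure:
  assumes A: "A \<in> hobjs" and B: "B \<in> hobjs" and V: "V \<in> lin A B"
  shows "karr A B {()} (\<lambda>_. V) \<in> copure Quant discard"
proof -
  note hA = hobjsD[OF A] and hB = hobjsD[OF B]
  have "lifts Quant (TArr Quant (karr A B {()} (\<lambda>_. V)) (Id Quant C)) (TArr Quant (discard X) (Id Quant D))"
    if X: "X \<in> hobjs" and C: "C \<in> hobjs" and D: "D \<in> hobjs" for X C D
  proof -
    note hX = hobjsD[OF X] and hC = hobjsD[OF C] and hD = hobjsD[OF D]
    note F = some_onb[OF hX]
    let ?Y = "tspace hunit D" and ?Z = "tspace X D" and ?A = "tspace A C" and ?B = "tspace B C"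
    let ?W = "tmap A C B C V (\<lambda>x. x)"
    interpret direct_sum ?Y ?Z "some_onb X" "\<lambda>f. tmap hunit D X D (inj_vec X f) (\<lambda>x. x)"
      "\<lambda>f. tmap X D hunit D (proj_vec X f) (\<lambda>x. x)"
      by (rule tensor_direct_sum[OF hX hD F hobjs_onb_nonempty[OF X F]])
    have W: "?W \<in> lin ?A ?B" by (rule tmap(1)[OF hA hC hB hC V lin_id])
    have W': "\<forall>i\<in>{()}. ?W \<in> lin ?A ?B" using W by simp
    note o = hobjs_tspace[OF hobjs_hunit D] hobjs_tspace[OF X D] hobjs_tspace[OF A C] hobjs_tspace[OF B C]
    note ho = o[THEN hobjsD]
    note e = karr_Hom[OF o(2,1) \<pi>] and p = karr_Hom[OF o(3,4) W']
    show ?thesis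
      unfolding Quant_simps discard_tensor[OF hX hD F] rank_one_tensor[OF hA hB hC V] lifts_Hom[OF p e]
    proof (intro ballI impI)
      fix u v assume u: "u \<in> Hom Quant ?A ?Z" and v: "v \<in> Hom Quant ?B ?Y"
        and eq: "Comp Quant (karr ?Z ?Y (some_onb X) (\<lambda>f. tmap X D hunit D (proj_vec X f) (\<lambda>x. x))) u =
          Comp Quant v (karr ?A ?B {()} (\<lambda>_. ?W))"
      obtain k K where K: "\<forall>i\<in>{..<k::nat}. K i \<in> lin ?B ?Y" and vK: "v = karr ?B ?Y {..<k} K"
        using Hom_kraus[OF v, of 0] by blast
      \<comment> \<open>For \<open>lift_copure\<close> it is \<open>u\<close> that receives the
        longer family.\<close>
      obtain n U where kn: "k \<le> n" and U: "\<forall>i\<in>{..<n::nat}. U i \<in> lin ?A ?Z" and uU: "u = karr ?A ?Z {..<n} U"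
        using Hom_kraus[OF u, of k] by blast
      obtain H where H: "\<forall>j\<in>{..<n}. H j \<in> lin ?B ?Z"
        and 1: "compose (carrier (L ?A)) (kmap ?B ?Z {..<n} H) (kmap ?A ?B {()} (\<lambda>_. ?W)) = kmap ?A ?Z {..<n} U"
        and 2: "compose (carrier (L ?B)) (kmap ?Z ?Y (some_onb X) (\<lambda>f. tmap X D hunit D (proj_vec X f) (\<lambda>x. x))) (kmap ?B ?Z {..<n} H) = kmap ?B ?Y {..<k} K"
        using lift_copure[OF ho(3,4) W U K kn] eq unfolding uU vK by auto
      show "\<exists>h \<in> Hom Quant ?B ?Z. Comp Quant h (karr ?A ?B {()} (\<lambda>_. ?W)) = u \<and>
        Comp Quant (karr ?Z ?Y (some_onb X) (\<lambda>f. tmap X D hunit D (proj_vec X f) (\<lambda>x. x))) h = v"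
        by (rule bexI[OF _ karr_Hom[OF o(4,2) H]]) (simp add: 1 2 uU vK)
    qed
  qed
  then show ?thesis
    unfolding copure_def oslash_left_def oslash_def using A B kmap_cp[OF hA hB, of "{()}" "\<lambda>_. V"] V by simp
qed

subsection \<open>Purification and copurification\<close>

text \<open>The environment is C^n, whose standard basis indexes the n Kraus operators. Padding to n
  \<ge> 1 keeps it nonzero.\<close>

lemma kraus_object:
  assumes f: "f \<in> Hom Quant A B"
  obtains E G K where "E \<in> hobjs" "onb E G" "\<forall>g\<in>G. K g \<in> lin A B" "f = karr A B G K"
proof -
  note AB = HomD[OF f]
  have hA: "fd_hilbert A" and hB: "fd_hilbert B" using AB hobjsD by auto
  obtain n K where n: "1 \<le> n" and K: "\<forall>i\<in>{..<n::nat}. K i \<in> lin A B" and fK: "f = karr A B {..<n} K"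
    using Hom_kraus[OF f, of 1] by blast
  let ?u = "unit_vec n :: nat \<Rightarrow> complex vec"
  have inj: "inj_on ?u {..<n}"
    by (rule inj_onI) (metis index_unit_vec(1) lessThan_iff zero_neq_one)
  note G = cspace_onb[of n]
  have "cspace n \<in> hobjs"
    by (rule hobjsI[OF cspace_hilbert, of "?u 0"])
      (use n onb_simps(2)[OF G, of "?u 0"] onb_simps(3)[OF G, of "?u 0" "?u 0"] in auto)
  moreover have "bij_betw (inv_into {..<n} ?u) (?u ` {..<n}) {..<n}"
    by (rule bij_betw_inv_into[OF inj_on_imp_bij_betw[OF inj]])
  then have "\<forall>g\<in>?u ` {..<n}. K (inv_into {..<n} ?u g) \<in> lin A B"
    and "kmap A B {..<n} K = kmap A B (?u ` {..<n}) (\<lambda>g. K (inv_into {..<n} ?u g))"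
    using K kmap_reindex[OF hA hB K] bij_betwE by blast+
  ultimately show ?thesis using that[OF _ G] fK by simp
qed

text \<open>Stinespring dilation: the Kraus index becomes a basis vector of the environment, so that
  K_g = V (1 \<otimes> |g>). Linearity in the environment variable is built in by
  \<open>lext\<close>.\<close>

lemma purifier:
  assumes A: "fd_hilbert A" and B: "fd_hilbert B" and E: "fd_hilbert E" and G: "onb E G"
    and K: "\<forall>g\<in>G. K g \<in> lin A B"
  obtains V where "V \<in> lin (tspace A E) B" "\<And>a g. a \<in> carrier A \<Longrightarrow> g \<in> G \<Longrightarrow> V (tvec A E a g) = K g a"
proof -
  note Gs = onb_simps[OF G]
  define w where "w a z = lext E G B (\<lambda>g. K g a) z" for a z
  have Kc: "K g a \<in> carrier B" if "g \<in> G" "a \<in> carrier A" for g a using lin_simps(1)[OF bspec[OF K that(1)] that(2)] .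
  have "(\<lambda>a. w a z) \<in> lin A B" for z
    unfolding w_def lext_def by (rule lin_lincomb[OF A B]) (use K in blast)
  moreover have "w a \<in> lin E B" if "a \<in> carrier A" for a
    unfolding w_def by (rule lext(1)[OF E B G Kc[OF _ that]])
  ultimately obtain V where V: "V \<in> lin (tspace A E) B"
    and Vw: "\<And>a z. a \<in> carrier A \<Longrightarrow> z \<in> carrier E \<Longrightarrow> V (tvec A E a z) = w a z"
    using tensor_lift[OF A E B, of w] by blast
  have "V (tvec A E a g) = K g a" if "a \<in> carrier A" "g \<in> G" for a g
    unfolding Vw[OF that(1) Gs(2)[OF that(2)]] w_def by (rule lext(2)[OF E B G Kc[OF _ that(1)] that(2)])
  then show ?thesis using that V by blast
qed

text \<open>The direct sum used as a product: V is the sum of the \<iota>_f M_f. The scalar 1 in its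
  definition fits the form of \<open>lin_lincomb\<close>.\<close>

lemma (in direct_sum) combine:
  assumes A: "fd_hilbert A" and M: "\<forall>f\<in>F. M f \<in> lin A Y"
  obtains V where "V \<in> lin A Z" "\<And>f a. f \<in> F \<Longrightarrow> a \<in> carrier A \<Longrightarrow> \<pi> f (V a) = M f a"
proof -
  define V where "V a = finsum Z (\<lambda>f. 1 \<odot>\<^bsub>Z\<^esub> \<iota> f (M f a)) F" for a
  have \<iota>M: "(\<lambda>a. \<iota> f (M f a)) \<in> lin A Z" if "f \<in> F" for f
    by (rule lin_comp[OF bspec[OF M that] bspec[OF \<iota> that]])
  have V: "V \<in> lin A Z" unfolding V_def by (rule lin_lincomb[OF A Z \<iota>M])
  have "\<pi> g (V a) = M g a" if g: "g \<in> F" and a: "a \<in> carrier A" for g a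
  proof (rule ip_eqI[OF Y])
    have Mc: "M f a \<in> carrier Y" if "f \<in> F" for f using lin_simps(1)[OF bspec[OF M that] a] .
    show "\<pi> g (V a) \<in> carrier Y" "M g a \<in> carrier Y"
      using \<iota>\<pi>_closed(2)[OF g lin_simps(1)[OF V a]] Mc[OF g] .
    fix y assume y: "y \<in> carrier Y"
    note \<pi>l = lin_simps[OF bspec[OF \<pi> g]]
    have c: "1 \<odot>\<^bsub>Z\<^esub> \<iota> f (M f a) \<in> carrier Z" if "f \<in> F" for f
      using Z lin_simps(1)[OF \<iota>M[OF that] a] by simp
    have c': "\<pi> g (1 \<odot>\<^bsub>Z\<^esub> \<iota> f (M f a)) \<in> carrier Y" if "f \<in> F" for f
      by (rule \<pi>l(1)[OF c[OF that]])
    have "\<pi> g (V a) = finsum Y (\<lambda>f. \<pi> g (1 \<odot>\<^bsub>Z\<^esub> \<iota> f (M f a))) F"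
      unfolding V_def by (rule lin_finsum[OF Z Y bspec[OF \<pi> g] c])
    then have "ip Y (\<pi> g (V a)) y = (\<Sum>f\<in>F. ip Y (\<pi> g (1 \<odot>\<^bsub>Z\<^esub> \<iota> f (M f a))) y)"
      by (simp only:) (rule ip_finsum(1)[OF Y c' y])
    also have "\<dots> = (\<Sum>f\<in>F. if f = g then ip Y (M f a) y else 0)"
      by (rule sum.cong[OF refl])
        (use \<pi>\<iota>[OF _ g Mc] \<pi>l(3) lin_simps(1)[OF \<iota>M a] Y y Mc[OF g] in auto)
    also have "\<dots> = ip Y (M g a) y" using fin g by simp
    finally show "ip Y (\<pi> g (V a)) y = ip Y (M g a) y" .
  qed
  then show ?thesis using that V by blast
qed

text \<open>With the mixed state of the environment written in the basis \<open>G\<close>, both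
  sides have Kraus families indexed by \<open>G\<close>; these agree operator by operator on the
  vectors a \<otimes> u.\<close>

lemma Quant_purification: "has_purification Quant mixed_state"
  unfolding has_purification_def Quant_simps
proof (intro ballI)
  fix A B f assume A: "A \<in> hobjs" and B: "B \<in> hobjs" and f: "f \<in> Hom Quant A B"
  note hA = hobjsD[OF A] and hB = hobjsD[OF B]
  obtain E G K where E: "E \<in> hobjs" and G: "onb E G" and K: "\<forall>g\<in>G. K g \<in> lin A B" and fK: "f = karr A B G K"
    using kraus_object[OF f] by blast
  note hE = hobjsD[OF E] and Gs = onb_simps[OF G]
  obtain V where V: "V \<in> lin (tspace A E) B" and VK: "\<And>a g. a \<in> carrier A \<Longrightarrow> g \<in> G \<Longrightarrow> V (tvec A E a g) = K g a"
    using purifier[OF hA hB hE G K] by blast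
  obtain S where S: "S \<in> lin (tspace A hunit) A"
    and Su: "\<And>a. a \<in> carrier A \<Longrightarrow> S (tvec A hunit a uvec) = a"
    and uS: "\<And>x. x \<in> carrier (tspace A hunit) \<Longrightarrow> tvec A hunit (S x) uvec = x"
    using right_unitor[OF hA] by blast
  let ?I = "tspace A hunit" and ?E = "tspace A E"
  let ?i = "\<lambda>g. tmap A hunit A E (\<lambda>x. x) (inj_vec E g)"
  have hI: "fd_hilbert ?I" and hAE: "fd_hilbert ?E" using hA hE by simp_all
  have il: "\<forall>g\<in>G. inj_vec E g \<in> lin hunit E" using inj_vec_lin[OF hE] Gs by blast
  have ml: "\<forall>g\<in>G. ?i g \<in> lin ?I ?E" using tmap(1)[OF hA hunit_hilbert hA hE lin_id] il by blast
  have m: "TArr Quant (QArr A (super_id A) A) (mixed_state E) = karr ?I ?E G ?i"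
    unfolding mixed_state_kmap[OF hE G] by (rule TArr_id_left[OF hunit_hilbert hE hA il])
  have r: "Runit Quant A = karr ?I A {()} (\<lambda>_. S)" by (rule Runit_kmap[OF hA S Su uS])
  let ?p = "karr ?E B {()} (\<lambda>_. V)"
  have V': "\<forall>i\<in>{()}. V \<in> lin ?E B" using V by simp
  have "kmap ?I B G (\<lambda>g x. K g (S x)) = kmap ?I B G (\<lambda>g x. V (?i g x))"
  proof (rule kmap_cong[OF hI hB])
    show KS: "\<forall>g\<in>G. (\<lambda>x. K g (S x)) \<in> lin ?I B" using lin_comp[OF S] K by blast
    show Vi: "\<forall>g\<in>G. (\<lambda>x. V (?i g x)) \<in> lin ?I B" using lin_comp[OF _ V] ml by blast
    fix g x assume g: "g \<in> G" and x: "x \<in> carrier ?I"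
    show "K g (S x) = V (?i g x)"
    proof (rule lin_tbasis_eqI[OF hA hunit_hilbert hB bspec[OF KS g] bspec[OF Vi g] some_onb[OF hA] hunit_onb _ x])
      fix a b assume "a \<in> some_onb A" and b: "b \<in> {uvec}"
      then have a: "a \<in> carrier A" using onb_simps(2)[OF some_onb[OF hA]] by simp
      have "?i g (tvec A hunit a uvec) = tvec A E a (inj_vec E g uvec)"
        by (rule tmap(2)[OF hA hunit_hilbert hA hE lin_id bspec[OF il g] a]) simp
      then show "K g (S (tvec A hunit a b)) = V (?i g (tvec A hunit a b))"
        using b Su[OF a] VK[OF a g] inj_vec_uvec[OF hE Gs(2)[OF g]] by simp
    qed
  qed
  then have "Comp Quant f (Runit Quant A) = Comp Quant ?p (TArr Quant (QArr A (super_id A) A) (mixed_state E))"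
    unfolding fK m r Quant_simps kmap_comp_single_right[OF hI hA hB S K] kmap_comp_single_left[OF hI hAE hB ml V Gs(1)]
    by simp
  moreover have "?p \<in> pure Quant mixed_state \<inter> Hom Quant ?E B"
    using rank_one_pure[OF hobjs_tspace[OF A E] B V] karr_Hom[OF hobjs_tspace[OF A E] B V'] by simp
  ultimately show "\<exists>E\<in>hobjs. \<exists>p\<in>pure Quant mixed_state \<inter> Hom Quant (tspace A E) B.
      Comp Quant f (Runit Quant A) = Comp Quant p (TArr Quant (QArr A (super_id A) A) (mixed_state E))"
    using E by blast
qed

text \<open>The dual dilation V a = \<Sum>_g g \<otimes> K_g a. It comes from \<open>combine\<close>
  applied to the maps a |-> u \<otimes> K_g a, and \<open>S\<close> strips off the unit
  factor.\<close>

lemma copurifier: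
  assumes A: "A \<in> hobjs" and B: "B \<in> hobjs" and E: "E \<in> hobjs" and G: "onb E G"
    and K: "\<forall>g\<in>G. K g \<in> lin A B"
    and S: "S \<in> lin (tspace hunit B) B" and Su: "\<And>b. b \<in> carrier B \<Longrightarrow> S (tvec hunit B uvec b) = b"
  obtains V where "V \<in> lin A (tspace E B)"
    "\<And>g a. g \<in> G \<Longrightarrow> a \<in> carrier A \<Longrightarrow> S (tmap E B hunit B (proj_vec E g) (\<lambda>x. x) (V a)) = K g a"
proof -
  note hA = hobjsD[OF A] and hB = hobjsD[OF B] and hE = hobjsD[OF E]
  interpret direct_sum "tspace hunit B" "tspace E B" G "\<lambda>g. tmap hunit B E B (inj_vec E g) (\<lambda>x. x)"
    "\<lambda>g. tmap E B hunit B (proj_vec E g) (\<lambda>x. x)"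
    by (rule tensor_direct_sum[OF hE hB G hobjs_onb_nonempty[OF E G]])
  have "tvec hunit B uvec \<in> lin B (tspace hunit B)" using hB by simp
  then have "\<forall>g\<in>G. (\<lambda>a. tvec hunit B uvec (K g a)) \<in> lin A (tspace hunit B)" using lin_comp K by blast
  from combine[OF hA this] obtain V where V: "V \<in> lin A (tspace E B)"
    and VK: "\<And>g a. g \<in> G \<Longrightarrow> a \<in> carrier A \<Longrightarrow>
      tmap E B hunit B (proj_vec E g) (\<lambda>x. x) (V a) = tvec hunit B uvec (K g a)" by blast
  have "S (tmap E B hunit B (proj_vec E g) (\<lambda>x. x) (V a)) = K g a" if "g \<in> G" "a \<in> carrier A" for g a
    unfolding VK[OF that] by (rule Su[OF lin_simps(1)[OF bspec[OF K that(1)] that(2)]])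
  then show ?thesis using that V by blast
qed

lemma Quant_copurification: "has_copurification Quant discard"
  unfolding has_copurification_def Quant_simps
proof (intro ballI)
  fix A B f assume A: "A \<in> hobjs" and B: "B \<in> hobjs" and f: "f \<in> Hom Quant A B"
  note hA = hobjsD[OF A] and hB = hobjsD[OF B]
  obtain E G K where E: "E \<in> hobjs" and G: "onb E G" and K: "\<forall>g\<in>G. K g \<in> lin A B" and fK: "f = karr A B G K"
    using kraus_object[OF f] by blast
  note hE = hobjsD[OF E] and Gs = onb_simps[OF G]
  obtain S where S: "S \<in> lin (tspace hunit B) B"
    and Su: "\<And>a. a \<in> carrier B \<Longrightarrow> S (tvec hunit B uvec a) = a"
    and uS: "\<And>x. x \<in> carrier (tspace hunit B) \<Longrightarrow> tvec hunit B uvec (S x) = x"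
    using left_unitor[OF hB] by blast
  let ?I = "tspace hunit B" and ?E = "tspace E B"
  let ?p = "\<lambda>g. tmap E B hunit B (proj_vec E g) (\<lambda>x. x)"
  obtain V where V: "V \<in> lin A ?E" and VK: "\<And>g a. g \<in> G \<Longrightarrow> a \<in> carrier A \<Longrightarrow> S (?p g (V a)) = K g a"
    using copurifier[OF A B E G K S Su] by blast
  have hI: "fd_hilbert ?I" and hEB: "fd_hilbert ?E" using hB hE by simp_all
  have pl: "\<forall>g\<in>G. ?p g \<in> lin ?E ?I" using tmap(1)[OF hE hB hunit_hilbert hB _ lin_id] proj_vec_lin[OF hE] Gs by blast
  have d: "TArr Quant (discard E) (QArr B (super_id B) B) = karr ?E ?I G ?p" by (rule discard_tensor[OF hE hB G])
  have l: "Lunit Quant B = karr ?I B {()} (\<lambda>_. S)" by (rule Lunit_kmap[OF hB S Su uS])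
  let ?c = "karr A ?E {()} (\<lambda>_. V)"
  have V': "\<forall>i\<in>{()}. V \<in> lin A ?E" using V by simp
  have pV: "\<forall>g\<in>G. (\<lambda>x. ?p g (V x)) \<in> lin A ?I" using lin_comp[OF V] pl by blast
  have "\<forall>g\<in>G. (\<lambda>x. S (?p g (V x))) \<in> lin A B" using lin_comp[OF _ S] pV by blast
  then have "kmap A B G (\<lambda>g x. S (?p g (V x))) = kmap A B G K"
    by (rule kmap_cong[OF hA hB _ K VK])
  then have "f = Comp Quant (Lunit Quant B) (Comp Quant (TArr Quant (discard E) (QArr B (super_id B) B)) ?c)"
    unfolding fK d l Quant_simps kmap_comp_single_right[OF hA hEB hI V pl]
      kmap_comp_single_left[OF hA hI hB pV S Gs(1)] by simp
  moreover have "?c \<in> copure Quant discard \<inter> Hom Quant A ?E"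
    using rank_one_copure[OF A hobjs_tspace[OF E B] V] karr_Hom[OF A hobjs_tspace[OF E B] V'] by simp
  ultimately show "\<exists>E\<in>hobjs. \<exists>c\<in>copure Quant discard \<inter> Hom Quant A (tspace E B).
      f = Comp Quant (Lunit Quant B) (Comp Quant (TArr Quant (discard E) (QArr B (super_id B) B)) c)"
    using E by blast
qed

subsection \<open>Factorisations\<close>

lemma triple_basis:
  assumes A: "fd_hilbert A" and B: "fd_hilbert B" and C: "fd_hilbert C"
    and E: "onb A E" and F: "onb B F" and G: "onb C G"
  shows "inj_on (\<lambda>(a, b, c). tvec A (tspace B C) a (tvec B C b c)) (E \<times> F \<times> G)" (is "inj_on ?r _")
    and "onb (tspace A (tspace B C)) ((\<lambda>(a, b, c). tvec A (tspace B C) a (tvec B C b c)) ` (E \<times> F \<times> G))"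
    and "inj_on (\<lambda>(a, b, c). tvec (tspace A B) C (tvec A B a b) c) (E \<times> F \<times> G)" (is "inj_on ?l _")
    and "onb (tspace (tspace A B) C) ((\<lambda>(a, b, c). tvec (tspace A B) C (tvec A B a b) c) ` (E \<times> F \<times> G))"
proof -
  have BC: "fd_hilbert (tspace B C)" and AB: "fd_hilbert (tspace A B)" using A B C by simp_all
  note bc = tbasis_onb[OF B C F G] tbasis_inj[OF B C F G] and ab = tbasis_onb[OF A B E F] tbasis_inj[OF A B E F]
  have tb: "tvec B C b c \<in> tbasis B C F G" if "b \<in> F" "c \<in> G" for b c unfolding tbasis_def using that by auto
  have ta: "tvec A B a b \<in> tbasis A B E F" if "a \<in> E" "b \<in> F" for a b unfolding tbasis_def using that by auto
  show "inj_on ?r (E \<times> F \<times> G)"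
  proof (rule inj_onI)
    fix p q assume pq: "p \<in> E \<times> F \<times> G" "q \<in> E \<times> F \<times> G" and e: "?r p = ?r q"
    obtain a b c where p: "p = (a, b, c)" by (cases p)
    obtain a' b' c' where q: "q = (a', b', c')" by (cases q)
    have m: "a \<in> E" "b \<in> F" "c \<in> G" "a' \<in> E" "b' \<in> F" "c' \<in> G"
      and eq: "tvec A (tspace B C) a (tvec B C b c) = tvec A (tspace B C) a' (tvec B C b' c')"
      using pq e unfolding p q by simp_all
    have "(a, tvec B C b c) = (a', tvec B C b' c')"
      by (rule inj_onD[OF tbasis_inj[OF A BC E bc(1)]]) (use eq m tb in auto)
    moreover from this have "(b, c) = (b', c')" by (intro inj_onD[OF bc(2)]) (use m in auto)
    ultimately show "p = q" unfolding p q by simp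
  qed
  show "inj_on ?l (E \<times> F \<times> G)"
  proof (rule inj_onI)
    fix p q assume pq: "p \<in> E \<times> F \<times> G" "q \<in> E \<times> F \<times> G" and e: "?l p = ?l q"
    obtain a b c where p: "p = (a, b, c)" by (cases p)
    obtain a' b' c' where q: "q = (a', b', c')" by (cases q)
    have m: "a \<in> E" "b \<in> F" "c \<in> G" "a' \<in> E" "b' \<in> F" "c' \<in> G"
      and eq: "tvec (tspace A B) C (tvec A B a b) c = tvec (tspace A B) C (tvec A B a' b') c'"
      using pq e unfolding p q by simp_all
    have "(tvec A B a b, c) = (tvec A B a' b', c')"
      by (rule inj_onD[OF tbasis_inj[OF AB C ab(1) G]]) (use eq m ta in auto)
    moreover from this have "(a, b) = (a', b')" by (intro inj_onD[OF ab(2)]) (use m in auto)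
    ultimately show "p = q" unfolding p q by simp
  qed
  have "?r ` (E \<times> F \<times> G) = tbasis A (tspace B C) E (tbasis B C F G)"
    unfolding tbasis_def by (auto simp: image_iff; blast)
  then show "onb (tspace A (tspace B C)) (?r ` (E \<times> F \<times> G))"
    using tbasis_onb[OF A BC E bc(1)] by simp
  have "?l ` (E \<times> F \<times> G) = tbasis (tspace A B) C (tbasis A B E F) G"
    unfolding tbasis_def by (auto simp: image_iff; blast)
  then show "onb (tspace (tspace A B) C) (?l ` (E \<times> F \<times> G))"
    using tbasis_onb[OF AB C ab(1) G] by simp
qed

text \<open>\<open>moncat\<close> carries no associator, so an isomorphism is built from the two
  bases of product triples. Its values on basis triples are what the transport squares
  evaluate.\<close>

lemma associator:
  assumes A: "A \<in> hobjs" and B: "B \<in> hobjs" and C: "C \<in> hobjs"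
    and E: "onb A E" and F: "onb B F" and G: "onb C G"
  obtains S s' where "S \<in> lin (tspace A (tspace B C)) (tspace (tspace A B) C)"
    "\<And>a b c. a \<in> E \<Longrightarrow> b \<in> F \<Longrightarrow> c \<in> G \<Longrightarrow> S (tvec A (tspace B C) a (tvec B C b c)) = tvec (tspace A B) C (tvec A B a b) c"
    "iso_pair (karr (tspace A (tspace B C)) (tspace (tspace A B) C) {()} (\<lambda>_. S)) s' (tspace A (tspace B C)) (tspace (tspace A B) C)"
proof -
  note h = A[THEN hobjsD] B[THEN hobjsD] C[THEN hobjsD]
  note o = hobjs_tspace[OF A hobjs_tspace[OF B C]] hobjs_tspace[OF hobjs_tspace[OF A B] C]
  note t = triple_basis[OF h E F G]
  obtain S T where S: "S \<in> lin (tspace A (tspace B C)) (tspace (tspace A B) C)" and T: "T \<in> lin (tspace (tspace A B) C) (tspace A (tspace B C))"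
    and Sg: "\<And>i. i \<in> E \<times> F \<times> G \<Longrightarrow> S ((\<lambda>(a, b, c). tvec A (tspace B C) a (tvec B C b c)) i) = (\<lambda>(a, b, c). tvec (tspace A B) C (tvec A B a b) c) i"
    and TS: "\<And>x. x \<in> carrier (tspace A (tspace B C)) \<Longrightarrow> T (S x) = x"
      "\<And>y. y \<in> carrier (tspace (tspace A B) C) \<Longrightarrow> S (T y) = y"
    using basis_bijection[where ?thesis = thesis, OF o(1)[THEN hobjsD] o(2)[THEN hobjsD] t] by blast
  show ?thesis
  proof (rule that[OF S _ karr_iso_pair[OF o S T TS]])
    show "S (tvec A (tspace B C) a (tvec B C b c)) = tvec (tspace A B) C (tvec A B a b) c"
      if "a \<in> E" "b \<in> F" "c \<in> G" for a b c using Sg[of "(a, b, c)"] that by simp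
  qed
qed

text \<open>In \<open>adjoin_mixing\<close> the mixed object is the left factor of E \<otimes> (A
  \<otimes> C) but the middle one of (A \<otimes> E) \<otimes> C, so two factors must also be
  exchanged.\<close>

lemma associator_braided:
  assumes A: "A \<in> hobjs" and B: "B \<in> hobjs" and C: "C \<in> hobjs"
    and E: "onb A E" and F: "onb B F" and G: "onb C G"
  obtains S s' where "S \<in> lin (tspace B (tspace A C)) (tspace (tspace A B) C)"
    "\<And>a b c. a \<in> E \<Longrightarrow> b \<in> F \<Longrightarrow> c \<in> G \<Longrightarrow> S (tvec B (tspace A C) b (tvec A C a c)) = tvec (tspace A B) C (tvec A B a b) c"
    "iso_pair (karr (tspace B (tspace A C)) (tspace (tspace A B) C) {()} (\<lambda>_. S)) s' (tspace B (tspace A C)) (tspace (tspace A B) C)"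
proof -
  note h = A[THEN hobjsD] B[THEN hobjsD] C[THEN hobjsD]
  note o = hobjs_tspace[OF B hobjs_tspace[OF A C]] hobjs_tspace[OF hobjs_tspace[OF A B] C]
  note l = triple_basis(3,4)[OF h E F G] and r = triple_basis(1,2)[OF h(2,1,3) F E G]
  let ?g = "\<lambda>(a, b, c). tvec B (tspace A C) b (tvec A C a c)"
  have "inj_on ?g (E \<times> F \<times> G)"
  proof (rule inj_onI)
    fix p q assume pq: "p \<in> E \<times> F \<times> G" "q \<in> E \<times> F \<times> G" and e: "?g p = ?g q"
    obtain a b c where p: "p = (a, b, c)" by (cases p)
    obtain a' b' c' where q: "q = (a', b', c')" by (cases q)
    have m: "a \<in> E" "b \<in> F" "c \<in> G" "a' \<in> E" "b' \<in> F" "c' \<in> G"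
      and eq: "tvec B (tspace A C) b (tvec A C a c) = tvec B (tspace A C) b' (tvec A C a' c')"
      using pq e unfolding p q by simp_all
    have "(b, a, c) = (b', a', c')" by (rule inj_onD[OF r(1)]) (use eq m in auto)
    then show "p = q" unfolding p q by simp
  qed
  moreover have "?g ` (E \<times> F \<times> G) = (\<lambda>(b, a, c). tvec B (tspace A C) b (tvec A C a c)) ` (F \<times> E \<times> G)"
    by (auto simp: image_iff; blast)
  ultimately have g: "inj_on ?g (E \<times> F \<times> G)" "onb (tspace B (tspace A C)) (?g ` (E \<times> F \<times> G))"
    using r(2) by simp_all
  obtain S T where S: "S \<in> lin (tspace B (tspace A C)) (tspace (tspace A B) C)" and T: "T \<in> lin (tspace (tspace A B) C) (tspace B (tspace A C))"
    and Sg: "\<And>i. i \<in> E \<times> F \<times> G \<Longrightarrow> S (?g i) = (\<lambda>(a, b, c). tvec (tspace A B) C (tvec A B a b) c) i"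
    and TS: "\<And>x. x \<in> carrier (tspace B (tspace A C)) \<Longrightarrow> T (S x) = x"
      "\<And>y. y \<in> carrier (tspace (tspace A B) C) \<Longrightarrow> S (T y) = y"
    using basis_bijection[where ?thesis = thesis, OF o(1)[THEN hobjsD] o(2)[THEN hobjsD] g l] by blast
  show ?thesis
  proof (rule that[OF S _ karr_iso_pair[OF o S T TS]])
    show "S (tvec B (tspace A C) b (tvec A C a c)) = tvec (tspace A B) C (tvec A B a b) c"
      if "a \<in> E" "b \<in> F" "c \<in> G" for a b c using Sg[of "(a, b, c)"] that by simp
  qed
qed

lemma left_unitor_iso:
  assumes A: "A \<in> hobjs"
  obtains S s' where "S \<in> lin (tspace hunit A) A" "\<And>a. a \<in> carrier A \<Longrightarrow> S (tvec hunit A uvec a) = a"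
    "iso_pair (karr (tspace hunit A) A {()} (\<lambda>_. S)) s' (tspace hunit A) A"
proof -
  note hA = hobjsD[OF A]
  obtain S where S: "S \<in> lin (tspace hunit A) A"
    and Su: "\<And>a. a \<in> carrier A \<Longrightarrow> S (tvec hunit A uvec a) = a"
    and uS: "\<And>x. x \<in> carrier (tspace hunit A) \<Longrightarrow> tvec hunit A uvec (S x) = x"
    using left_unitor[OF hA] by blast
  have u: "tvec hunit A uvec \<in> lin A (tspace hunit A)" using hA by simp
  show ?thesis
    using that[OF S Su karr_iso_pair[OF hobjs_tspace[OF hobjs_hunit A] A S u uS Su]] by blast
qed

text \<open>The arrow is id_A \<otimes> \<mu>_E after the inverse right unitor. Tensored with C it
  is isomorphic, by a unitor and a braided associator, to \<mu>_E \<otimes> id on A \<otimes> C, and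
  that arrow lifts against p \<otimes> id because \<open>oslash\<close> quantifies over all tensor
  factors.\<close>

lemma adjoin_mixing:
  assumes A: "A \<in> hobjs" and E: "E \<in> hobjs" and G: "onb E G"
  shows "karr A (tspace A E) G (\<lambda>g a. tvec A E a g) \<in> mixing Quant mixed_state"
proof -
  note hA = hobjsD[OF A] and hE = hobjsD[OF E] and Gs = onb_simps[OF G]
  let ?E = "tspace A E"
  note oE = hobjs_tspace[OF A E] and hAE = hobjsD[OF hobjs_tspace[OF A E]]
  have tl: "\<forall>g\<in>G. (\<lambda>a. tvec A E a g) \<in> lin A ?E" using hA hE Gs by simp
  have "lifts Quant (TArr Quant (karr A ?E G (\<lambda>g a. tvec A E a g)) (Id Quant C)) (TArr Quant p (Id Quant B))"
    if p: "p \<in> pure Quant mixed_state" and C: "C \<in> hobjs" and B: "B \<in> hobjs" for p B C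
  proof -
    note hC = hobjsD[OF C]
    let ?AC = "tspace A C"
    note oAC = hobjs_tspace[OF A C] and hAC = hobjsD[OF hobjs_tspace[OF A C]]
    \<comment> \<open>Purity of \<open>p\<close> is applied with A \<otimes> C as the tensor factor
      of the mixed state.\<close>
    have lift: "lifts Quant (TArr Quant (mixed_state E) (Id Quant ?AC)) (TArr Quant p (Id Quant B))"
      using p E oAC B unfolding pure_def oslash_right_def oslash_def by simp
    obtain P R where x: "TArr Quant p (Id Quant B) \<in> Hom Quant P R"
      using TArr_id_Hom[of p B] p B unfolding pure_def oslash_right_def by auto
    let ?l = "\<lambda>g. tmap A C ?E C (\<lambda>a. tvec A E a g) (\<lambda>x. x)" and ?m = "\<lambda>g. tmap hunit ?AC E ?AC (inj_vec E g) (\<lambda>x. x)"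
    let ?Y = "tspace hunit ?AC" and ?Z = "tspace E ?AC" and ?Z' = "tspace ?E C"
    note oY = hobjs_tspace[OF hobjs_hunit oAC] and oZ = hobjs_tspace[OF E oAC] and oZ' = hobjs_tspace[OF oE C]
    note hY = hobjsD[OF oY] and hZ = hobjsD[OF oZ] and hZ' = hobjsD[OF oZ']
    note EA = some_onb[OF hA] and EC = some_onb[OF hC]
    have il: "\<forall>g\<in>G. inj_vec E g \<in> lin hunit E" using inj_vec_lin[OF hE] Gs by blast
    have ll: "\<forall>g\<in>G. ?l g \<in> lin ?AC ?Z'" using tmap(1)[OF hA hC hAE hC _ lin_id] tl by blast
    have ml: "\<forall>g\<in>G. ?m g \<in> lin ?Y ?Z" using tmap(1)[OF hunit_hilbert hAC hE hAC _ lin_id] il by blast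
    have l: "TArr Quant (karr A ?E G (\<lambda>g a. tvec A E a g)) (Id Quant C) = karr ?AC ?Z' G ?l"
      unfolding Quant_simps by (rule TArr_id_right[OF hA hAE hC tl])
    have m: "TArr Quant (mixed_state E) (Id Quant ?AC) = karr ?Y ?Z G ?m"
      unfolding Quant_simps by (rule mixed_state_tensor[OF hE hAC G])
    obtain S s' where S: "S \<in> lin ?Y ?AC" and Su: "\<And>a. a \<in> carrier ?AC \<Longrightarrow> S (tvec hunit ?AC uvec a) = a"
      and Si: "iso_pair (karr ?Y ?AC {()} (\<lambda>_. S)) s' ?Y ?AC"
      using left_unitor_iso[OF oAC] by blast
    obtain T t' where T: "T \<in> lin ?Z ?Z'"
      and Tb: "\<And>a g c. a \<in> some_onb A \<Longrightarrow> g \<in> G \<Longrightarrow> c \<in> some_onb C \<Longrightarrow>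
        T (tvec E ?AC g (tvec A C a c)) = tvec ?E C (tvec A E a g) c"
      and Ti: "iso_pair (karr ?Z ?Z' {()} (\<lambda>_. T)) t' ?Z ?Z'"
      using associator_braided[OF A E C EA G EC] by blast
    have "kmap ?Y ?Z' G (\<lambda>g x. T (?m g x)) = kmap ?Y ?Z' G (\<lambda>g x. ?l g (S x))"
    proof (rule kmap_cong[OF hY hZ'])
      show Tm: "\<forall>g\<in>G. (\<lambda>x. T (?m g x)) \<in> lin ?Y ?Z'" using lin_comp[OF _ T] ml by blast
      show lS: "\<forall>g\<in>G. (\<lambda>x. ?l g (S x)) \<in> lin ?Y ?Z'" using lin_comp[OF S] ll by blast
      fix g x assume g: "g \<in> G" and x: "x \<in> carrier ?Y"
      show "T (?m g x) = ?l g (S x)"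
      proof (rule lin_tbasis_eqI[OF hunit_hilbert hAC hZ' bspec[OF Tm g] bspec[OF lS g] hunit_onb tbasis_onb[OF hA hC EA EC] _ x])
        fix u b assume u: "u \<in> {uvec}" and "b \<in> tbasis A C (some_onb A) (some_onb C)"
        then obtain a c where b: "b = tvec A C a c" and a: "a \<in> some_onb A" and c: "c \<in> some_onb C"
          unfolding tbasis_def by auto
        note ac = onb_simps(2)[OF EA a] onb_simps(2)[OF EC c]
        have bc: "b \<in> carrier ?AC" unfolding b using hA hC ac by simp
        have "?m g (tvec hunit ?AC uvec b) = tvec E ?AC (inj_vec E g uvec) b"
          by (rule tmap(2)[OF hunit_hilbert hAC hE hAC bspec[OF il g] lin_id _ bc]) simp
        then have "T (?m g (tvec hunit ?AC uvec b)) = tvec ?E C (tvec A E a g) c"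
          using inj_vec_uvec[OF hE Gs(2)[OF g]] Tb[OF a g c] b by simp
        also have "\<dots> = ?l g b"
          unfolding b by (rule tmap(2)[OF hA hC hAE hC bspec[OF tl g] lin_id ac, symmetric])
        finally show "T (?m g (tvec hunit ?AC u b)) = ?l g (S (tvec hunit ?AC u b))" using u Su[OF bc] by simp
      qed
    qed
    then have "Comp Quant (karr ?Z ?Z' {()} (\<lambda>_. T)) (karr ?Y ?Z G ?m) = Comp Quant (karr ?AC ?Z' G ?l) (karr ?Y ?AC {()} (\<lambda>_. S))"
      unfolding Quant_simps kmap_comp_single_left[OF hY hZ hZ' ml T Gs(1)] kmap_comp_single_right[OF hY hAC hZ' S ll] by simp
    from lifts_transport_left[OF karr_Hom[OF oY oZ ml] karr_Hom[OF oAC oZ' ll] x Si Ti this] lift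
    show ?thesis unfolding l m .
  qed
  then show ?thesis
    unfolding mixing_def oslash_left_def oslash_def using HomD[OF karr_Hom[OF A oE tl]] by simp
qed

text \<open>The arrow is the left unitor after \<epsilon>_E \<otimes> id_B. Tensoring with C and
  reassociating turns it into \<epsilon>_E \<otimes> id on B \<otimes> C, against which copure maps
  lift by definition. The discarded factor already stands on the left, so the plain associator
  suffices.\<close>

lemma discard_discarding:
  assumes B: "B \<in> hobjs" and E: "E \<in> hobjs" and G: "onb E G"
    and S: "S \<in> lin (tspace hunit B) B" and Su: "\<And>b. b \<in> carrier B \<Longrightarrow> S (tvec hunit B uvec b) = b"
  shows "karr (tspace E B) B G (\<lambda>g x. S (tmap E B hunit B (proj_vec E g) (\<lambda>x. x) x)) \<in> discarding Quant discard"
proof -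
  note hB = hobjsD[OF B] and hE = hobjsD[OF E] and Gs = onb_simps[OF G]
  let ?E = "tspace E B" and ?R = "\<lambda>g x. S (tmap E B hunit B (proj_vec E g) (\<lambda>x. x) x)"
  note oE = hobjs_tspace[OF E B] and hEB = hobjsD[OF hobjs_tspace[OF E B]]
  have prl: "\<forall>g\<in>G. proj_vec E g \<in> lin E hunit" using proj_vec_lin[OF hE] Gs by blast
  have Rl: "\<forall>g\<in>G. ?R g \<in> lin ?E B" using lin_comp[OF tmap(1)[OF hE hB hunit_hilbert hB _ lin_id] S] prl by blast
  have "lifts Quant (TArr Quant c (Id Quant A)) (TArr Quant (karr ?E B G ?R) (Id Quant C))"
    if c: "c \<in> copure Quant discard" and A: "A \<in> hobjs" and C: "C \<in> hobjs" for c A C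
  proof -
    note hC = hobjsD[OF C]
    let ?BC = "tspace B C"
    note oBC = hobjs_tspace[OF B C] and hBC = hobjsD[OF hobjs_tspace[OF B C]]
    have lift: "lifts Quant (TArr Quant c (Id Quant A)) (TArr Quant (discard E) (Id Quant ?BC))"
      using c E oBC A unfolding copure_def oslash_left_def oslash_def by simp
    obtain P Q where f: "TArr Quant c (Id Quant A) \<in> Hom Quant P Q"
      using TArr_id_Hom[of c A] c A unfolding copure_def oslash_left_def by auto
    let ?d = "\<lambda>g. tmap E ?BC hunit ?BC (proj_vec E g) (\<lambda>x. x)" and ?r = "\<lambda>g. tmap ?E C B C (?R g) (\<lambda>x. x)"
    let ?Y = "tspace hunit ?BC" and ?Z = "tspace E ?BC" and ?Z' = "tspace ?E C"
    note oY = hobjs_tspace[OF hobjs_hunit oBC] and oZ = hobjs_tspace[OF E oBC] and oZ' = hobjs_tspace[OF oE C]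
    note hY = hobjsD[OF oY] and hZ = hobjsD[OF oZ] and hZ' = hobjsD[OF oZ']
    note EB = some_onb[OF hB] and EC = some_onb[OF hC]
    have dl: "\<forall>g\<in>G. ?d g \<in> lin ?Z ?Y" using tmap(1)[OF hE hBC hunit_hilbert hBC _ lin_id] prl by blast
    have rl: "\<forall>g\<in>G. ?r g \<in> lin ?Z' ?BC" using tmap(1)[OF hEB hC hB hC _ lin_id] Rl by blast
    have r: "TArr Quant (karr ?E B G ?R) (Id Quant C) = karr ?Z' ?BC G ?r"
      unfolding Quant_simps by (rule TArr_id_right[OF hEB hB hC Rl])
    have d: "TArr Quant (discard E) (Id Quant ?BC) = karr ?Z ?Y G ?d"
      unfolding Quant_simps by (rule discard_tensor[OF hE hBC G])
    obtain U u' where U: "U \<in> lin ?Y ?BC" and Uu: "\<And>a. a \<in> carrier ?BC \<Longrightarrow> U (tvec hunit ?BC uvec a) = a"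
      and Ui: "iso_pair (karr ?Y ?BC {()} (\<lambda>_. U)) u' ?Y ?BC"
      using left_unitor_iso[OF oBC] by blast
    obtain T t' where T: "T \<in> lin ?Z ?Z'"
      and Tb: "\<And>g b c. g \<in> G \<Longrightarrow> b \<in> some_onb B \<Longrightarrow> c \<in> some_onb C \<Longrightarrow>
        T (tvec E ?BC g (tvec B C b c)) = tvec ?E C (tvec E B g b) c"
      and Ti: "iso_pair (karr ?Z ?Z' {()} (\<lambda>_. T)) t' ?Z ?Z'"
      using associator[OF E B C G EB EC] by blast
    have "kmap ?Z ?BC G (\<lambda>g x. U (?d g x)) = kmap ?Z ?BC G (\<lambda>g x. ?r g (T x))"
    proof (rule kmap_cong[OF hZ hBC])
      show Ud: "\<forall>g\<in>G. (\<lambda>x. U (?d g x)) \<in> lin ?Z ?BC" using lin_comp[OF _ U] dl by blast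
      show rT: "\<forall>g\<in>G. (\<lambda>x. ?r g (T x)) \<in> lin ?Z ?BC" using lin_comp[OF T] rl by blast
      fix g x assume g: "g \<in> G" and x: "x \<in> carrier ?Z"
      show "U (?d g x) = ?r g (T x)"
      proof (rule lin_tbasis_eqI[OF hE hBC hBC bspec[OF Ud g] bspec[OF rT g] G tbasis_onb[OF hB hC EB EC] _ x])
        fix k y assume k: "k \<in> G" and "y \<in> tbasis B C (some_onb B) (some_onb C)"
        then obtain b c where y: "y = tvec B C b c" and b: "b \<in> some_onb B" and c: "c \<in> some_onb C"
          unfolding tbasis_def by auto
        note bc = onb_simps(2)[OF EB b] onb_simps(2)[OF EC c]
        have yc: "y \<in> carrier ?BC" unfolding y using hB hC bc by simp
        have kb: "tvec E B k b \<in> carrier ?E" using hE hB Gs(2)[OF k] bc by simp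
        \<comment> \<open>The bra <g| applied to the basis vector k; for k \<noteq> g both sides of
          the square vanish.\<close>
        let ?v = "if k = g then uvec else \<zero>\<^bsub>hunit\<^esub>"
        have "?d g (tvec E ?BC k y) = tvec hunit ?BC ?v y"
          unfolding proj_vec_onb[OF hE G k g, symmetric]
          by (rule tmap(2)[OF hE hBC hunit_hilbert hBC bspec[OF prl g] lin_id Gs(2)[OF k] yc])
        then have 1: "U (?d g (tvec E ?BC k y)) = U (tvec hunit ?BC ?v y)" by simp
        have 2: "tmap E B hunit B (proj_vec E g) (\<lambda>x. x) (tvec E B k b) = tvec hunit B ?v b"
          unfolding proj_vec_onb[OF hE G k g, symmetric]
          by (rule tmap(2)[OF hE hB hunit_hilbert hB bspec[OF prl g] lin_id Gs(2)[OF k] bc(1)])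
        have 3: "?r g (T (tvec E ?BC k y)) = tvec B C (S (tvec hunit B ?v b)) c"
          unfolding y Tb[OF k b c] 2[symmetric]
          by (rule tmap(2)[OF hEB hC hB hC bspec[OF Rl g] lin_id kb bc(2)])
        have z: "tvec hunit ?BC \<zero>\<^bsub>hunit\<^esub> y = \<zero>\<^bsub>?Y\<^esub>" "tvec hunit B \<zero>\<^bsub>hunit\<^esub> b = \<zero>\<^bsub>tspace hunit B\<^esub>"
          "tvec B C \<zero>\<^bsub>B\<^esub> c = \<zero>\<^bsub>?BC\<^esub>"
          using lin_zero[OF hunit_hilbert hY tspace_simps(2)[OF hunit_hilbert hBC yc]]
            lin_zero[OF hunit_hilbert _ tspace_simps(2)[OF hunit_hilbert hB bc(1)]]
            lin_zero[OF hB hBC tspace_simps(2)[OF hB hC bc(2)]] hB by simp_all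
        show "U (?d g (tvec E ?BC k y)) = ?r g (T (tvec E ?BC k y))"
          unfolding 1 3 using Uu[OF yc] Su[OF bc(1)] y z lin_zero[OF hY hBC U] lin_zero[OF _ hB S] hB by simp
      qed
    qed
    then have "Comp Quant (karr ?Y ?BC {()} (\<lambda>_. U)) (karr ?Z ?Y G ?d) = Comp Quant (karr ?Z' ?BC G ?r) (karr ?Z ?Z' {()} (\<lambda>_. T))"
      unfolding Quant_simps kmap_comp_single_left[OF hZ hY hBC dl U Gs(1)] kmap_comp_single_right[OF hZ hZ' hBC T rl] by simp
    from lifts_transport_right[OF f karr_Hom[OF oZ oY dl] karr_Hom[OF oZ' oBC rl] Ti Ui this] lift
    show ?thesis unfolding r d .
  qed
  then show ?thesis
    unfolding discarding_def oslash_right_def oslash_def using HomD[OF karr_Hom[OF oE B Rl]] by simp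
qed

section \<open>The two weak factorisation systems\<close>

lemma Quant_mixing_pure: "sm_wfs Quant (mixing Quant mixed_state) (pure Quant mixed_state)"
  unfolding sm_wfs_def
proof (intro conjI ballI)
  show "mixing Quant mixed_state \<subseteq> Arr Quant" "pure Quant mixed_state \<subseteq> Arr Quant"
    unfolding mixing_def pure_def oslash_left_def oslash_right_def by auto
  show "mixing Quant mixed_state = oslash_left Quant (pure Quant mixed_state)" unfolding mixing_def ..
  \<comment> \<open>Galois argument: pure maps lift against all of \<open>mixing\<close> by the
    definition of \<open>mixing\<close>; conversely the mixed states are arrows, hence members of
    \<open>mixing\<close>, so lifting against \<open>mixing\<close> implies purity.\<close>
  have "mixed_state ` hobjs \<subseteq> Arr Quant"
  proof clarify
    fix A assume A: "A \<in> hobjs"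
    note hA = hobjsD[OF A] and F = some_onb[OF hobjsD[OF A]]
    have "\<forall>f\<in>some_onb A. inj_vec A f \<in> lin hunit A" using inj_vec_lin[OF hA] onb_simps(2)[OF F] by blast
    from HomD[OF karr_Hom[OF hobjs_hunit A this]] show "mixed_state A \<in> Arr Quant"
      unfolding mixed_state_kmap[OF hA F] by simp
  qed
  then have "mixed_state ` hobjs \<subseteq> mixing Quant mixed_state"
    unfolding mixing_def pure_def oslash_left_def oslash_right_def by auto
  then show "pure Quant mixed_state = oslash_right Quant (mixing Quant mixed_state)"
    unfolding mixing_def pure_def oslash_left_def oslash_right_def by auto
next
  fix f assume f: "f \<in> Arr Quant"
  define A B where "A = qdom f" and "B = qcod f"
  have fH: "f \<in> Hom Quant A B" using Arr_Hom[OF f] unfolding A_def B_def .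
  have A: "A \<in> hobjs" and B: "B \<in> hobjs" using HomD[OF fH] by auto
  note hA = hobjsD[OF A] and hB = hobjsD[OF B]
  obtain E G K where E: "E \<in> hobjs" and G: "onb E G" and K: "\<forall>g\<in>G. K g \<in> lin A B" and fK: "f = karr A B G K"
    using kraus_object[OF fH] by blast
  note hE = hobjsD[OF E] and Gs = onb_simps[OF G]
  obtain V where V: "V \<in> lin (tspace A E) B" and VK: "\<And>a g. a \<in> carrier A \<Longrightarrow> g \<in> G \<Longrightarrow> V (tvec A E a g) = K g a"
    using purifier[OF hA hB hE G K] by blast
  \<comment> \<open>The factorisation read off the dilation: adjoin the environment in its mixed
    state, then apply the pure map given by \<open>V\<close>.\<close>
  let ?l = "karr A (tspace A E) G (\<lambda>g a. tvec A E a g)" and ?p = "karr (tspace A E) B {()} (\<lambda>_. V)"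
  have tl: "\<forall>g\<in>G. (\<lambda>a. tvec A E a g) \<in> lin A (tspace A E)" using hA hE Gs by simp
  have "\<forall>g\<in>G. (\<lambda>a. V (tvec A E a g)) \<in> lin A B" using lin_comp[OF _ V] tl by blast
  then have "kmap A B G (\<lambda>g a. V (tvec A E a g)) = kmap A B G K"
    by (rule kmap_cong[OF hA hB _ K]) (use VK in blast)
  then have "f = Comp Quant ?p ?l"
    unfolding fK Quant_simps kmap_comp_single_left[OF hA tspace_simps(1)[OF hA hE] hB tl V Gs(1)] by simp
  then show "\<exists>l\<in>mixing Quant mixed_state. \<exists>r\<in>pure Quant mixed_state.
      Dom Quant l = Dom Quant f \<and> Cod Quant l = Dom Quant r \<and> Cod Quant r = Cod Quant f \<and> f = Comp Quant r l"
    using adjoin_mixing[OF A E G] rank_one_pure[OF hobjs_tspace[OF A E] B V]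
    by (intro bexI[of _ ?l] bexI[of _ ?p]) (simp_all add: A_def[symmetric] B_def[symmetric])
qed

lemma Quant_copure_discarding: "sm_wfs Quant (copure Quant discard) (discarding Quant discard)"
  unfolding sm_wfs_def
proof (intro conjI ballI)
  show "copure Quant discard \<subseteq> Arr Quant" "discarding Quant discard \<subseteq> Arr Quant"
    unfolding discarding_def copure_def oslash_left_def oslash_right_def by auto
  show "discarding Quant discard = oslash_right Quant (copure Quant discard)" unfolding discarding_def ..
  \<comment> \<open>The dual Galois argument: the discarding effects are arrows and so belong to
    \<open>discarding\<close>, which recovers \<open>copure\<close> from it.\<close>
  have "discard ` hobjs \<subseteq> Arr Quant"
  proof clarify
    fix A assume A: "A \<in> hobjs"
    note hA = hobjsD[OF A] and F = some_onb[OF hobjsD[OF A]]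
    have "\<forall>f\<in>some_onb A. proj_vec A f \<in> lin A hunit" using proj_vec_lin[OF hA] onb_simps(2)[OF F] by blast
    from HomD[OF karr_Hom[OF A hobjs_hunit this]] show "discard A \<in> Arr Quant"
      unfolding discard_kmap[OF hA F] by simp
  qed
  then have "discard ` hobjs \<subseteq> discarding Quant discard"
    unfolding discarding_def copure_def oslash_left_def oslash_right_def by auto
  then show "copure Quant discard = oslash_left Quant (discarding Quant discard)"
    unfolding discarding_def copure_def oslash_left_def oslash_right_def by auto
next
  fix f assume f: "f \<in> Arr Quant"
  define A B where "A = qdom f" and "B = qcod f"
  have fH: "f \<in> Hom Quant A B" using Arr_Hom[OF f] unfolding A_def B_def .
  have A: "A \<in> hobjs" and B: "B \<in> hobjs" using HomD[OF fH] by auto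
  note hA = hobjsD[OF A] and hB = hobjsD[OF B]
  obtain E G K where E: "E \<in> hobjs" and G: "onb E G" and K: "\<forall>g\<in>G. K g \<in> lin A B" and fK: "f = karr A B G K"
    using kraus_object[OF fH] by blast
  note hE = hobjsD[OF E] and Gs = onb_simps[OF G]
  obtain S where S: "S \<in> lin (tspace hunit B) B" and Su: "\<And>a. a \<in> carrier B \<Longrightarrow> S (tvec hunit B uvec a) = a"
    using left_unitor[OF hB] by blast
  let ?R = "\<lambda>g x. S (tmap E B hunit B (proj_vec E g) (\<lambda>x. x) x)"
  obtain V where V: "V \<in> lin A (tspace E B)" and VK: "\<And>g a. g \<in> G \<Longrightarrow> a \<in> carrier A \<Longrightarrow> ?R g (V a) = K g a"
    using copurifier[OF A B E G K S Su] by blast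
  have prl: "\<forall>g\<in>G. proj_vec E g \<in> lin E hunit" using proj_vec_lin[OF hE] Gs by blast
  have Rl: "\<forall>g\<in>G. ?R g \<in> lin (tspace E B) B" using lin_comp[OF tmap(1)[OF hE hB hunit_hilbert hB _ lin_id] S] prl by blast
  \<comment> \<open>The dual factorisation: dilate by \<open>V\<close>, then discard the
    environment.\<close>
  let ?c = "karr A (tspace E B) {()} (\<lambda>_. V)" and ?r = "karr (tspace E B) B G ?R"
  have "\<forall>g\<in>G. (\<lambda>a. ?R g (V a)) \<in> lin A B" using lin_comp[OF V] Rl by blast
  then have "kmap A B G (\<lambda>g a. ?R g (V a)) = kmap A B G K" by (rule kmap_cong[OF hA hB _ K VK])
  then have "f = Comp Quant ?r ?c"
    unfolding fK Quant_simps kmap_comp_single_right[OF hA tspace_simps(1)[OF hE hB] hB V Rl] by simp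
  then show "\<exists>l\<in>copure Quant discard. \<exists>r\<in>discarding Quant discard.
      Dom Quant l = Dom Quant f \<and> Cod Quant l = Dom Quant r \<and> Cod Quant r = Cod Quant f \<and> f = Comp Quant r l"
    using discard_discarding[OF B E G S Su] rank_one_copure[OF A hobjs_tspace[OF E B] V]
    by (intro bexI[of _ ?c] bexI[of _ ?r]) (simp_all add: A_def[symmetric] B_def[symmetric])
qed

theorem theorem23:
  shows "has_purification Quant mixed_state
       \<and> has_copurification Quant discard
       \<and> sm_wfs Quant (mixing Quant mixed_state) (pure Quant mixed_state)
       \<and> sm_wfs Quant (copure Quant discard) (discarding Quant discard)"
  by (intro conjI Quant_purification Quant_copurification Quant_mixing_pure Quant_copure_discarding)

end
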